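(* For every $d\ge1$, $d \cdot \overline{\mathbb{B}}_{1,d} \in \operatorname{md}(\overline{\mathbb{B}}_{2,d})$; that is, $d\cdot\overline{\mathbb{B}}_{1,d}$ is a minimal dilation hull of $\overline{\mathbb{B}}_{2,d}$.
   Context: $\overline{\mathbb{B}}_{p,d}=\{x\in\mathbb{R}^d:\|x\|_p\le1\}$. $(M_n)^d_{sa}$ denotes $d$-tuples of self-adjoint complex $n\times n$ matrices. For a $d$-tuple $A$ of bounded operators on a Hilbert space, $\mathcal{W}_1(A)=\{(\varphi(A_1),\dots,\varphi(A_d)) : \varphi \text{ a state on the unital } C^*\text{-algebra generated by } A\}$. A tuple $N$ on $H_2$ is a dilation of a tuple $X$ on $H_1$ ($X\prec N$) if there is an isometry $V:H_1\to H_2$ with $X_i=V^*N_iV$ for all $i$. A normal tuple is a tuple of commuting normal bounded operators; $\sigma(N)$ is its joint spectrum. For a closed convex set $K\subseteq\mathbb{R}^d$: $\mathcal{W}^{\max}_n(K)=\{X\in(M_n)^d_{sa}:\mathcal{W}_1(X)\subseteq K\}$, $\mathcal{W}^{\min}_n(K)=\{X\in(M_n)^d_{sa}: \text{there is a normal tuple } N \text{ on some Hilbert space with } X\prec N,\ \sigma(N)\subseteq K\}$, $\mathcal{W}^{\max}(K)=\bigcup_n\mathcal{W}^{\max}_n(K)$, $\mathcal{W}^{\min}(K)=\bigcup_n\mathcal{W}^{\min}_n(K)$ (containment is levelwise). For compact convex $K\subseteq\mathbb{R}^d$, $\mathcal{E}(K)=\{L\supseteq K : L\subseteq\mathbb{R}^d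 \text{ compact and convex},\ \mathcal{W}^{\max}(K)\subseteq\mathcal{W}^{\min}(L)\}$ (dilation hulls of $K$), and $\operatorname{md}(K)$ is the set of elements of $\mathcal{E}(K)$ that are minimal with respect to inclusion (minimal dilation hulls). *)

theory Defs
  imports
    "HOL-Analysis.Analysis"
    "Jordan_Normal_Form.Schur_Decomposition"
begin

no_notation vec_index (infixl \<open>$\<close> 100)

section \<open>Hilbert spaces and bounded operators\<close>

text \<open>
  Hilbert spaces are carrier-based: both the spaces \<open>\<complex>\<^sup>n\<close> for varying \<open>n\<close> and the (unspecified)
  spaces on which dilations live have to be quantified over inside definitions.
  The inner product is linear in its first argument. The fields \<open>mult\<close> and \<open>one\<close> inherited from
  the record type of modules play no role.
\<close>

record 'v hilbert = "(complex, 'v) module" +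
  ip :: "'v \<Rightarrow> 'v \<Rightarrow> complex"

definition hnorm :: "'v hilbert \<Rightarrow> 'v \<Rightarrow> real" where
  "hnorm H x = sqrt (Re (ip H x x))"

locale hilbert_space = vectorspace "class_ring :: complex ring" H
  for H :: "'v hilbert" (structure) +
  assumes ip_add_left:
      "\<lbrakk>x \<in> carrier H; y \<in> carrier H; z \<in> carrier H\<rbrakk> \<Longrightarrow> ip H (x \<oplus> y) z = ip H x z + ip H y z"
    and ip_smult_left:
      "\<lbrakk>x \<in> carrier H; y \<in> carrier H\<rbrakk> \<Longrightarrow> ip H (c \<odot>\<^bsub>H\<^esub> x) y = c * ip H x y"
    and ip_commute:
      "\<lbrakk>x \<in> carrier H; y \<in> carrier H\<rbrakk> \<Longrightarrow> ip H y x = cnj (ip H x y)"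
    and ip_pos:
      "\<lbrakk>x \<in> carrier H; x \<noteq> \<zero>\<^bsub>H\<^esub>\<rbrakk> \<Longrightarrow> 0 < Re (ip H x x)"
    and complete:
      "\<lbrakk>\<And>k. s k \<in> carrier H; \<And>e. 0 < e \<Longrightarrow> \<exists>M. \<forall>k\<ge>M. \<forall>m\<ge>M. hnorm H (s k \<ominus> s m) < e\<rbrakk> \<Longrightarrow>
       \<exists>x \<in> carrier H. (\<lambda>k. hnorm H (s k \<ominus> x)) \<longlonglongrightarrow> 0"

text \<open>
  Operators are extensional functions (\<open>undefined\<close> off the carrier), so that equality of operators
  is equality of functions.
\<close>

definition bounded_ops :: "'v hilbert \<Rightarrow> 'w hilbert \<Rightarrow> ('v \<Rightarrow> 'w) set" where
  "bounded_ops H\<^sub>1 H\<^sub>2 =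
     {T \<in> extensional (carrier H\<^sub>1) \<inter> module_hom (class_ring :: complex ring) H\<^sub>1 H\<^sub>2.
        \<exists>C. \<forall>x \<in> carrier H\<^sub>1. hnorm H\<^sub>2 (T x) \<le> C * hnorm H\<^sub>1 x}"

definition op_one :: "'v hilbert \<Rightarrow> 'v \<Rightarrow> 'v" where
  "op_one H = (\<lambda>x \<in> carrier H. x)"

definition op_add :: "'v hilbert \<Rightarrow> ('v \<Rightarrow> 'v) \<Rightarrow> ('v \<Rightarrow> 'v) \<Rightarrow> 'v \<Rightarrow> 'v" where
  "op_add H S T = (\<lambda>x \<in> carrier H. S x \<oplus>\<^bsub>H\<^esub> T x)"

definition op_diff :: "'v hilbert \<Rightarrow> ('v \<Rightarrow> 'v) \<Rightarrow> ('v \<Rightarrow> 'v) \<Rightarrow> 'v \<Rightarrow> 'v" where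
  "op_diff H S T = (\<lambda>x \<in> carrier H. S x \<ominus>\<^bsub>H\<^esub> T x)"

definition op_scale :: "'v hilbert \<Rightarrow> complex \<Rightarrow> ('v \<Rightarrow> 'v) \<Rightarrow> 'v \<Rightarrow> 'v" where
  "op_scale H c T = (\<lambda>x \<in> carrier H. c \<odot>\<^bsub>H\<^esub> T x)"

abbreviation op_mult :: "'v hilbert \<Rightarrow> ('v \<Rightarrow> 'v) \<Rightarrow> ('v \<Rightarrow> 'v) \<Rightarrow> 'v \<Rightarrow> 'v" where
  "op_mult H S T \<equiv> compose (carrier H) S T"

definition op_norm :: "'v hilbert \<Rightarrow> ('v \<Rightarrow> 'v) \<Rightarrow> real" where
  "op_norm H T = (SUP x \<in> {x \<in> carrier H. hnorm H x \<le> 1}. hnorm H (T x))"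

text \<open>
  \<open>is_adjoint H\<^sub>1 H\<^sub>2 T S\<close> says \<open>S = T\<^sup>*\<close> for \<open>T : H\<^sub>1 \<rightarrow> H\<^sub>2\<close>. It is a relation because existence of
  the adjoint is a theorem (Riesz).
\<close>

definition is_adjoint :: "'v hilbert \<Rightarrow> 'w hilbert \<Rightarrow> ('v \<Rightarrow> 'w) \<Rightarrow> ('w \<Rightarrow> 'v) \<Rightarrow> bool" where
  "is_adjoint H\<^sub>1 H\<^sub>2 T S \<longleftrightarrow> T \<in> bounded_ops H\<^sub>1 H\<^sub>2 \<and> S \<in> bounded_ops H\<^sub>2 H\<^sub>1 \<and>
     (\<forall>x \<in> carrier H\<^sub>1. \<forall>y \<in> carrier H\<^sub>2. ip H\<^sub>2 (T x) y = ip H\<^sub>1 x (S y))"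

definition isometry_op :: "'v hilbert \<Rightarrow> 'w hilbert \<Rightarrow> ('v \<Rightarrow> 'w) \<Rightarrow> bool" where
  "isometry_op H\<^sub>1 H\<^sub>2 V \<longleftrightarrow> V \<in> bounded_ops H\<^sub>1 H\<^sub>2 \<and>
     (\<forall>x \<in> carrier H\<^sub>1. hnorm H\<^sub>2 (V x) = hnorm H\<^sub>1 x)"

section \<open>Generated C*-algebras, states, joint spectrum\<close>

definition cstar_subalgebra :: "'v hilbert \<Rightarrow> ('v \<Rightarrow> 'v) set \<Rightarrow> bool" where
  "cstar_subalgebra H \<A> \<longleftrightarrow>
     \<A> \<subseteq> bounded_ops H H \<and>
     op_one H \<in> \<A> \<and>
     (\<forall>S \<in> \<A>. \<forall>T \<in> \<A>. op_add H S T \<in> \<A>) \<and>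
     (\<forall>c. \<forall>T \<in> \<A>. op_scale H c T \<in> \<A>) \<and>
     (\<forall>S \<in> \<A>. \<forall>T \<in> \<A>. op_mult H S T \<in> \<A>) \<and>
     (\<forall>T \<in> \<A>. \<forall>S. is_adjoint H H T S \<longrightarrow> S \<in> \<A>) \<and>
     (\<forall>T \<in> bounded_ops H H. (\<forall>e>0. \<exists>S \<in> \<A>. op_norm H (op_diff H S T) < e) \<longrightarrow> T \<in> \<A>)"

definition cstar_generated :: "'v hilbert \<Rightarrow> ('d \<Rightarrow> 'v \<Rightarrow> 'v) \<Rightarrow> ('v \<Rightarrow> 'v) set" where
  "cstar_generated H A = \<Inter> {\<A>. cstar_subalgebra H \<A> \<and> range A \<subseteq> \<A>}"

definition linear_functional_on ::
    "'v hilbert \<Rightarrow> ('v \<Rightarrow> 'v) set \<Rightarrow> (('v \<Rightarrow> 'v) \<Rightarrow> complex) \<Rightarrow> bool" where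
  "linear_functional_on H \<A> \<phi> \<longleftrightarrow>
     (\<forall>S \<in> \<A>. \<forall>T \<in> \<A>. \<phi> (op_add H S T) = \<phi> S + \<phi> T) \<and>
     (\<forall>c. \<forall>T \<in> \<A>. \<phi> (op_scale H c T) = c * \<phi> T)"

text \<open>The order on \<^typ>\<open>complex\<close> is the one with \<open>0 \<le> z\<close> iff \<open>z\<close> is real and nonnegative.\<close>

definition state :: "'v hilbert \<Rightarrow> ('v \<Rightarrow> 'v) set \<Rightarrow> (('v \<Rightarrow> 'v) \<Rightarrow> complex) \<Rightarrow> bool" where
  "state H \<A> \<phi> \<longleftrightarrow> linear_functional_on H \<A> \<phi> \<and> \<phi> (op_one H) = 1 \<and>
     (\<forall>T \<in> \<A>. \<forall>S. is_adjoint H H T S \<longrightarrow> 0 \<le> \<phi> (op_mult H S T))"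

definition character :: "'v hilbert \<Rightarrow> ('v \<Rightarrow> 'v) set \<Rightarrow> (('v \<Rightarrow> 'v) \<Rightarrow> complex) \<Rightarrow> bool" where
  "character H \<A> \<phi> \<longleftrightarrow> linear_functional_on H \<A> \<phi> \<and> \<phi> (op_one H) = 1 \<and>
     (\<forall>S \<in> \<A>. \<forall>T \<in> \<A>. \<phi> (op_mult H S T) = \<phi> S * \<phi> T)"

definition W1 :: "'v hilbert \<Rightarrow> ('d::finite \<Rightarrow> 'v \<Rightarrow> 'v) \<Rightarrow> (complex ^ 'd) set" where
  "W1 H A = {(\<chi> i. \<phi> (A i)) | \<phi>. state H (cstar_generated H A) \<phi>}"

definition normal_tuple :: "'v hilbert \<Rightarrow> ('d::finite \<Rightarrow> 'v \<Rightarrow> 'v) \<Rightarrow> bool" where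
  "normal_tuple H N \<longleftrightarrow>
     (\<forall>i. N i \<in> bounded_ops H H) \<and>
     (\<forall>i. \<exists>S. is_adjoint H H (N i) S \<and> op_mult H S (N i) = op_mult H (N i) S) \<and>
     (\<forall>i j. op_mult H (N i) (N j) = op_mult H (N j) (N i))"

text \<open>
  For a normal tuple the generated unital C*-algebra is commutative; the joint spectrum is its
  character space, viewed inside \<open>\<complex>\<^sup>d\<close> by evaluating characters at the tuple.
\<close>

definition joint_spectrum :: "'v hilbert \<Rightarrow> ('d::finite \<Rightarrow> 'v \<Rightarrow> 'v) \<Rightarrow> (complex ^ 'd) set" where
  "joint_spectrum H N = {(\<chi> i. \<phi> (N i)) | \<phi>. character H (cstar_generated H N) \<phi>}"

definition dilation ::
    "'v hilbert \<Rightarrow> ('d::finite \<Rightarrow> 'v \<Rightarrow> 'v) \<Rightarrow> 'w hilbert \<Rightarrow> ('d \<Rightarrow> 'w \<Rightarrow> 'w) \<Rightarrow> bool" where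
  "dilation H\<^sub>1 X H\<^sub>2 N \<longleftrightarrow>
     (\<exists>V Vs. isometry_op H\<^sub>1 H\<^sub>2 V \<and> is_adjoint H\<^sub>1 H\<^sub>2 V Vs \<and>
        (\<forall>i. X i = compose (carrier H\<^sub>1) Vs (compose (carrier H\<^sub>1) (N i) V)))"

section \<open>Minimal and maximal matrix convex sets, minimal dilation hulls\<close>

text \<open>\<open>Cn n\<close> is \<open>\<complex>\<^sup>n\<close> with its standard inner product.\<close>

definition Cn :: "nat \<Rightarrow> complex Matrix.vec hilbert" where
  "Cn n = module.extend (module_vec TYPE(complex) n) (hilbert.fields (\<bullet>c))"

definition mat_op :: "nat \<Rightarrow> complex mat \<Rightarrow> complex Matrix.vec \<Rightarrow> complex Matrix.vec" where
  "mat_op n A = (\<lambda>v \<in> carrier_vec n. A *\<^sub>v v)"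

definition sa_tuples :: "nat \<Rightarrow> ('d::finite \<Rightarrow> complex mat) set" where
  "sa_tuples n = {X. \<forall>i. X i \<in> carrier_mat n n \<and> mat_adjoint (X i) = X i}"

definition complexify :: "real ^ 'd \<Rightarrow> complex ^ 'd::finite" where
  "complexify x = (\<chi> i. complex_of_real (x $ i))"

definition Wmax :: "(real ^ 'd) set \<Rightarrow> nat \<Rightarrow> ('d::finite \<Rightarrow> complex mat) set" where
  "Wmax K n = {X \<in> sa_tuples n. W1 (Cn n) (\<lambda>i. mat_op n (X i)) \<subseteq> complexify ` K}"

text \<open>
  An existential quantifier in HOL cannot range over types, so ``some Hilbert space'' is read as
  some Hilbert space whose underlying set lies in the type \<open>(nat \<Rightarrow> complex) + 'u\<close>. For every \<open>'u\<close>
  this contains isomorphic copies of all separable Hilbert spaces, and by choice of \<open>'u\<close> of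
  Hilbert spaces of any cardinality.
\<close>

definition Wmin :: "'u itself \<Rightarrow> (real ^ 'd) set \<Rightarrow> nat \<Rightarrow> ('d::finite \<Rightarrow> complex mat) set" where
  "Wmin U K n = {X \<in> sa_tuples n.
     \<exists>(H :: ((nat \<Rightarrow> complex) + 'u) hilbert) N.
       hilbert_space H \<and> normal_tuple H N \<and>
       dilation (Cn n) (\<lambda>i. mat_op n (X i)) H N \<and>
       joint_spectrum H N \<subseteq> complexify ` K}"

definition dilation_hulls :: "'u itself \<Rightarrow> (real ^ 'd::finite) set \<Rightarrow> (real ^ 'd) set set" where
  "dilation_hulls U K =
     {L. K \<subseteq> L \<and> compact L \<and> convex L \<and> (\<forall>n\<ge>1. Wmax K n \<subseteq> Wmin U L n)}"

definition minimal_dilation_hulls ::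
    "'u itself \<Rightarrow> (real ^ 'd::finite) set \<Rightarrow> (real ^ 'd) set set" where
  "minimal_dilation_hulls U K =
     {L \<in> dilation_hulls U K. \<forall>L' \<in> dilation_hulls U K. L' \<subseteq> L \<longrightarrow> L' = L}"

definition lp_norm :: "real \<Rightarrow> real ^ 'd::finite \<Rightarrow> real" where
  "lp_norm p x = (\<Sum>i\<in>UNIV. \<bar>x $ i\<bar> powr p) powr (1 / p)"

definition lp_ball :: "real \<Rightarrow> (real ^ 'd::finite) set" where
  "lp_ball p = {x. lp_norm p x \<le> 1}"

end

(* That d B_1 is a dilation hull: the tuple N_i = d X_i (x) E_ii on (C^n)^d compresses to X along the
   diagonal embedding h |-> (h, ..., h) / sqrt d, and N_i N_j = 0 for distinct i and j confines its
   joint spectrum to the segments [-d, d] e_i.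

   Minimality: let X be anticommuting self-adjoint unitaries of trace zero, so that W_1(X) lies in the
   Euclidean ball, and let N be a normal dilation of X with joint spectrum in d B_1, along the isometry
   V. The operator sum_i N_i (x) conj(X_i) has square sum_i N_i^2 (x) 1, which is at most d^2, while its
   compression to the maximally entangled vector is d. The resulting equality gives
   N_i^3 V = d^2 N_i V, and trace X_i = 0 then makes both d and -d eigenvalues of N_i; a point of d B_1
   whose i-th coordinate is d or -d is an extreme point, so the spectrum contains all of them.

   Gelfand theory for the normal tuple is replaced by joint approximate eigenvectors: they extend from
   an operator to every operator commuting with it whose iterates have log-convex norms, and a sequence
   of joint approximate eigenvectors yields a character of the generated C*-algebra. *)

theory Submission
  imports Defs
begin

section \<open>Inner product spaces\<close>

text \<open>In terms of spectral measures, equality of the sum of the N_i^2 with d^2 on the range of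
  V says that the measures of the vectors in that range live on the points p of d B_1 of Euclidean
  norm d. These have one coordinate d or -d and all others 0, so p_i^3 = d^2 p_i there. Without
  spectral measures, the l1 constraint is expressed by the sums of the s_i N_i over sign patterns s:
  each has norm at most d, the mean of their squares is the sum of the N_i^2, and so each of them
  squares to d^2 on the range of V. Comparing two patterns that differ in one place isolates N_i. As
  the joint spectrum consists of values of characters, two bridges are needed: a large norm has to
  produce a character with a large value, and an exact eigenvector of N_i has to produce a character
  with that eigenvalue at N_i. Operators outside the tuple take part in this: the signed sums, for
  the norm bound, and the difference of N_i and its adjoint, to show that a real joint spectrum
  makes the tuple self-adjoint.\<close>

locale inner_space = vectorspace "class_ring :: complex ring" H
  for H :: "'v hilbert" (structure) +
  assumes ip_add_left:
      "\<lbrakk>x \<in> carrier H; y \<in> carrier H; z \<in> carrier H\<rbrakk> \<Longrightarrow> ip H (x \<oplus> y) z = ip H x z + ip H y z"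
    and ip_smult_left:
      "\<lbrakk>x \<in> carrier H; y \<in> carrier H\<rbrakk> \<Longrightarrow> ip H (c \<odot> x) y = c * ip H x y"
    and ip_commute:
      "\<lbrakk>x \<in> carrier H; y \<in> carrier H\<rbrakk> \<Longrightarrow> ip H y x = cnj (ip H x y)"
    and ip_pos:
      "\<lbrakk>x \<in> carrier H; x \<noteq> \<zero>\<rbrakk> \<Longrightarrow> 0 < Re (ip H x x)"

lemma hilbert_space_inner_space: "hilbert_space H \<Longrightarrow> inner_space H"
  unfolding hilbert_space_def hilbert_space_axioms_def inner_space_def inner_space_axioms_def
  by (elim conjE) (intro conjI, assumption+)

context inner_space
begin

lemma scale_closed [simp, intro]: "x \<in> carrier H \<Longrightarrow> c \<odot> x \<in> carrier H"
  using smult_closed by simp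

lemma ip_zero_left [simp]: "z \<in> carrier H \<Longrightarrow> ip H \<zero> z = 0"
  using ip_add_left[of \<zero> \<zero> z] by simp

lemma ip_uminus_left: "\<lbrakk>y \<in> carrier H; z \<in> carrier H\<rbrakk> \<Longrightarrow> ip H (\<ominus> y) z = - ip H y z"
  using ip_add_left[of y "\<ominus> y" z] by (simp add: M.r_neg eq_neg_iff_add_eq_0 add.commute)

lemma ip_minus_left:
  "\<lbrakk>x \<in> carrier H; y \<in> carrier H; z \<in> carrier H\<rbrakk> \<Longrightarrow> ip H (x \<ominus> y) z = ip H x z - ip H y z"
  by (simp add: a_minus_def ip_add_left ip_uminus_left)

lemma ip_zero_right [simp]: "z \<in> carrier H \<Longrightarrow> ip H z \<zero> = 0"
  using ip_commute[of \<zero> z] by simp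

lemma ip_add_right:
  "\<lbrakk>x \<in> carrier H; y \<in> carrier H; z \<in> carrier H\<rbrakk> \<Longrightarrow> ip H z (x \<oplus> y) = ip H z x + ip H z y"
  using ip_commute[of "x \<oplus> y" z] ip_commute[of x z] ip_commute[of y z] by (simp add: ip_add_left)

lemma ip_minus_right:
  "\<lbrakk>x \<in> carrier H; y \<in> carrier H; z \<in> carrier H\<rbrakk> \<Longrightarrow> ip H z (x \<ominus> y) = ip H z x - ip H z y"
  using ip_commute[of "x \<ominus> y" z] ip_commute[of x z] ip_commute[of y z] by (simp add: ip_minus_left)

lemma ip_smult_right:
  "\<lbrakk>x \<in> carrier H; y \<in> carrier H\<rbrakk> \<Longrightarrow> ip H y (c \<odot> x) = cnj c * ip H y x"
  using ip_commute[of "c \<odot> x" y] ip_commute[of x y] by (simp add: ip_smult_left)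

lemmas ip_linear = ip_add_left ip_add_right ip_minus_left ip_minus_right
  ip_smult_left ip_smult_right

lemma ip_finsum_left:
  assumes "finite F" "\<And>i. i \<in> F \<Longrightarrow> f i \<in> carrier H" "z \<in> carrier H"
  shows "ip H (finsum H f F) z = (\<Sum>i\<in>F. ip H (f i) z)"
  using assms
proof (induction F)
  case (insert i F)
  then have "finsum H f (insert i F) = f i \<oplus> finsum H f F"
    by (intro M.finsum_insert) auto
  moreover have "finsum H f F \<in> carrier H"
    using insert by (intro M.finsum_closed) auto
  ultimately show ?case
    using insert by (simp add: ip_add_left)
qed simp

lemma ip_finsum_right:
  assumes "finite F" "\<And>i. i \<in> F \<Longrightarrow> f i \<in> carrier H" "z \<in> carrier H"
  shows "ip H z (finsum H f F) = (\<Sum>i\<in>F. ip H z (f i))"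
proof -
  have "finsum H f F \<in> carrier H"
    using assms by (intro M.finsum_closed) auto
  then have "ip H z (finsum H f F) = cnj (ip H (finsum H f F) z)"
    using assms ip_commute by blast
  also have "\<dots> = (\<Sum>i\<in>F. cnj (ip H (f i) z))"
    using assms by (simp add: ip_finsum_left)
  also have "\<dots> = (\<Sum>i\<in>F. ip H z (f i))"
    using assms by (intro sum.cong refl ip_commute[symmetric]) auto
  finally show ?thesis .
qed

lemma ip_self_Im: "x \<in> carrier H \<Longrightarrow> Im (ip H x x) = 0"
  using ip_commute[of x x] by (simp add: complex_eq_iff)

lemma ip_self_nonneg: "x \<in> carrier H \<Longrightarrow> 0 \<le> Re (ip H x x)"
  using ip_pos[of x] by (cases "x = \<zero>") auto

lemma hnorm_nonneg [simp]: "x \<in> carrier H \<Longrightarrow> 0 \<le> hnorm H x"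
  by (simp add: hnorm_def ip_self_nonneg)

lemma hnorm_sq: "x \<in> carrier H \<Longrightarrow> (hnorm H x)\<^sup>2 = Re (ip H x x)"
  by (simp add: hnorm_def ip_self_nonneg)

lemma ip_self: "x \<in> carrier H \<Longrightarrow> ip H x x = complex_of_real ((hnorm H x)\<^sup>2)"
  by (simp add: hnorm_sq complex_eq_iff ip_self_Im)

lemma hnorm_eq_0_iff: "x \<in> carrier H \<Longrightarrow> hnorm H x = 0 \<longleftrightarrow> x = \<zero>"
  using ip_pos[of x] by (cases "x = \<zero>") (auto simp: hnorm_def)

lemma hnorm_zero [simp]: "hnorm H \<zero> = 0"
  by (simp add: hnorm_def)

lemma hnorm_pos: "\<lbrakk>x \<in> carrier H; x \<noteq> \<zero>\<rbrakk> \<Longrightarrow> 0 < hnorm H x"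
  using hnorm_eq_0_iff[of x] hnorm_nonneg[of x] by linarith

abbreviation residual :: "('v \<Rightarrow> 'v) \<Rightarrow> complex \<Rightarrow> 'v \<Rightarrow> 'v" where
  "residual T c x \<equiv> T x \<ominus> c \<odot> x"

text \<open>The difference is orthogonal to itself. Testing against every \<open>z\<close> turns an
  identity of vectors in a carrier into one of complex numbers, which \<open>ip_linear\<close> and
  ring simplification settle; most operator identities below are proved in this way.\<close>

lemma vec_eqI:
  assumes "x \<in> carrier H" "y \<in> carrier H" "\<And>z. z \<in> carrier H \<Longrightarrow> ip H x z = ip H y z"
  shows "x = y"
proof -
  have "ip H (x \<ominus> y) (x \<ominus> y) = 0"
    using assms by (simp add: ip_minus_left)
  then have "x \<ominus> y = \<zero>"
    using assms by (simp flip: hnorm_eq_0_iff add: hnorm_def)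
  then show ?thesis
    using assms by (simp add: M.minus_other_side a_minus_def M.minus_equality M.r_neg)
       (metis M.add.inv_closed M.add.inv_equality M.minus_minus)
qed

lemma hnorm_smult [simp]: "x \<in> carrier H \<Longrightarrow> hnorm H (c \<odot> x) = cmod c * hnorm H x"
proof -
  assume x: "x \<in> carrier H"
  have "ip H (c \<odot> x) (c \<odot> x) = complex_of_real ((cmod c)\<^sup>2) * ip H x x"
    using x by (simp add: ip_linear complex_norm_square mult_ac del: of_real_power)
  then show ?thesis
    using x by (simp add: hnorm_def real_sqrt_mult)
qed

lemma cauchy_schwarz:
  assumes x: "x \<in> carrier H" and y: "y \<in> carrier H"
  shows "cmod (ip H x y) \<le> hnorm H x * hnorm H y"
proof (cases "y = \<zero>")
  case False
  define c where "c = ip H x y / complex_of_real ((hnorm H y)\<^sup>2)"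
  have pos: "0 < hnorm H y"
    using y False by (rule hnorm_pos)
  have yx: "ip H y x = cnj (ip H x y)"
    using x y by (rule ip_commute)
  define z where "z = ip H x y"
  have "0 \<le> Re (ip H (x \<ominus> c \<odot> y) (x \<ominus> c \<odot> y))"
    using x y by (intro ip_self_nonneg) auto
  also have "ip H (x \<ominus> c \<odot> y) (x \<ominus> c \<odot> y) =
      complex_of_real ((hnorm H x)\<^sup>2) - cnj c * z - c * cnj z + c * cnj c * complex_of_real ((hnorm H y)\<^sup>2)"
    using x y by (simp add: ip_linear yx z_def ip_self[OF x] ip_self[OF y] algebra_simps)
  also have "\<dots> = complex_of_real ((hnorm H x)\<^sup>2 - (cmod z)\<^sup>2 / (hnorm H y)\<^sup>2)"
    using pos by (simp add: c_def field_simps complex_norm_square[symmetric] flip: z_def)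
  finally have "(cmod z)\<^sup>2 \<le> (hnorm H x)\<^sup>2 * (hnorm H y)\<^sup>2"
    using pos by (simp add: field_simps)
  then show ?thesis
    using x y by (simp add: z_def power_mult_distrib[symmetric] power2_le_iff_abs_le)
qed (use x in auto)

lemma hnorm_add:
  assumes x: "x \<in> carrier H" and y: "y \<in> carrier H"
  shows "hnorm H (x \<oplus> y) \<le> hnorm H x + hnorm H y"
proof (rule power2_le_imp_le)
  have "(hnorm H (x \<oplus> y))\<^sup>2 = (hnorm H x)\<^sup>2 + 2 * Re (ip H x y) + (hnorm H y)\<^sup>2"
    using x y by (simp add: hnorm_sq ip_linear ip_commute[of x y])
  also have "Re (ip H x y) \<le> hnorm H x * hnorm H y"
    using cauchy_schwarz[OF x y] complex_Re_le_cmod order_trans by blast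
  finally show "(hnorm H (x \<oplus> y))\<^sup>2 \<le> (hnorm H x + hnorm H y)\<^sup>2"
    by (simp add: power2_sum)
qed (use x y in auto)

lemma hnorm_minus:
  assumes x: "x \<in> carrier H" and y: "y \<in> carrier H"
  shows "hnorm H (x \<ominus> y) \<le> hnorm H x + hnorm H y"
proof -
  have "x \<ominus> y = x \<oplus> (-1) \<odot> y"
    using x y by (intro vec_eqI) (auto simp: ip_linear)
  then show ?thesis
    using hnorm_add[of x "(-1) \<odot> y"] x y by simp
qed

lemma hnorm_finsum:
  assumes "finite F" "\<And>i. i \<in> F \<Longrightarrow> f i \<in> carrier H"
  shows "hnorm H (finsum H f F) \<le> (\<Sum>i\<in>F. hnorm H (f i))"
  using assms
proof (induction F)
  case (insert i F)
  then have "finsum H f (insert i F) = f i \<oplus> finsum H f F"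
    by (intro M.finsum_insert) auto
  moreover have "finsum H f F \<in> carrier H"
    using insert by (intro M.finsum_closed) auto
  ultimately show ?case
    using insert hnorm_add[of "f i" "finsum H f F"] by fastforce
qed simp

end

section \<open>Bounded operators\<close>

lemma bounded_opsI:
  assumes "\<And>x. x \<in> carrier H\<^sub>1 \<Longrightarrow> T x \<in> carrier H\<^sub>2"
    and "\<And>x y. \<lbrakk>x \<in> carrier H\<^sub>1; y \<in> carrier H\<^sub>1\<rbrakk> \<Longrightarrow> T (x \<oplus>\<^bsub>H\<^sub>1\<^esub> y) = T x \<oplus>\<^bsub>H\<^sub>2\<^esub> T y"
    and "\<And>c x. x \<in> carrier H\<^sub>1 \<Longrightarrow> T (c \<odot>\<^bsub>H\<^sub>1\<^esub> x) = c \<odot>\<^bsub>H\<^sub>2\<^esub> T x"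
    and "\<And>x. x \<in> carrier H\<^sub>1 \<Longrightarrow> hnorm H\<^sub>2 (T x) \<le> C * hnorm H\<^sub>1 x"
    and "T \<in> extensional (carrier H\<^sub>1)"
  shows "T \<in> bounded_ops H\<^sub>1 H\<^sub>2"
  using assms unfolding bounded_ops_def module_hom_def by (auto intro!: exI[of _ C])

lemma
  assumes "T \<in> bounded_ops H\<^sub>1 H\<^sub>2"
  shows bounded_ops_closed: "x \<in> carrier H\<^sub>1 \<Longrightarrow> T x \<in> carrier H\<^sub>2"
    and bounded_ops_add: "\<lbrakk>x \<in> carrier H\<^sub>1; y \<in> carrier H\<^sub>1\<rbrakk> \<Longrightarrow> T (x \<oplus>\<^bsub>H\<^sub>1\<^esub> y) = T x \<oplus>\<^bsub>H\<^sub>2\<^esub> T y"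
    and bounded_ops_smult: "x \<in> carrier H\<^sub>1 \<Longrightarrow> T (c \<odot>\<^bsub>H\<^sub>1\<^esub> x) = c \<odot>\<^bsub>H\<^sub>2\<^esub> T x"
    and bounded_ops_extensional: "T \<in> extensional (carrier H\<^sub>1)"
  using assms unfolding bounded_ops_def module_hom_def by auto

context inner_space
begin

text \<open>A constant of at least 1 is nonnegative and may be divided by, as in the tolerance
  \<open>e0 * (b / C) ^ n\<close> of \<open>approx_eig_extend\<close>.\<close>

lemma bounded_ops_bound:
  assumes "T \<in> bounded_ops H H"
  obtains C where "1 \<le> C" "\<And>x. x \<in> carrier H \<Longrightarrow> hnorm H (T x) \<le> C * hnorm H x"
proof -
  from assms obtain C where C: "\<forall>x \<in> carrier H. hnorm H (T x) \<le> C * hnorm H x"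
    unfolding bounded_ops_def by auto
  have "hnorm H (T x) \<le> max C 1 * hnorm H x" if "x \<in> carrier H" for x
    using C that mult_right_mono[of C "max C 1" "hnorm H x"] by fastforce
  then show ?thesis
    using that[of "max C 1"] by simp
qed

lemma bounded_ops_minus:
  assumes "T \<in> bounded_ops H H" "x \<in> carrier H" "y \<in> carrier H"
  shows "T (x \<ominus> y) = T x \<ominus> T y"
proof -
  have "x = (x \<ominus> y) \<oplus> y"
    using assms by (intro vec_eqI) (auto simp: ip_linear)
  then have "T x = T (x \<ominus> y) \<oplus> T y"
    using assms bounded_ops_add[OF assms(1), of "x \<ominus> y" y] by simp
  then show ?thesis
    using assms bounded_ops_closed[OF assms(1)] by (intro vec_eqI) (auto simp: ip_linear)
qed

lemma bounded_ops_zero: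
  assumes "T \<in> bounded_ops H H" shows "T \<zero> = \<zero>"
proof -
  have "\<zero> = 0 \<odot> \<zero>" by (intro vec_eqI) (auto simp: ip_linear)
  then have "T \<zero> = 0 \<odot> T \<zero>"
    using bounded_ops_smult[OF assms, of \<zero> 0] by simp
  also have "\<dots> = \<zero>"
    using bounded_ops_closed[OF assms] by (intro vec_eqI) (auto simp: ip_linear)
  finally show ?thesis .
qed

lemma bounded_ops_finsum:
  assumes "T \<in> bounded_ops H H" "finite F" "\<And>i. i \<in> F \<Longrightarrow> f i \<in> carrier H"
  shows "T (finsum H f F) = finsum H (\<lambda>i. T (f i)) F"
  using assms(2,3)
proof (induction F)
  case empty
  then show ?case using bounded_ops_zero[OF assms(1)] by simp
next
  case (insert i F)
  have "finsum H f (insert i F) = f i \<oplus> finsum H f F"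
    using insert by (intro M.finsum_insert) auto
  moreover have "finsum H f F \<in> carrier H"
    using insert by (intro M.finsum_closed) auto
  moreover have "finsum H (\<lambda>i. T (f i)) (insert i F) = T (f i) \<oplus> finsum H (\<lambda>i. T (f i)) F"
    using insert bounded_ops_closed[OF assms(1)] by (intro M.finsum_insert) auto
  ultimately show ?case
    using insert bounded_ops_add[OF assms(1)] by simp
qed

lemma op_one_bounded: "op_one H \<in> bounded_ops H H"
  by (rule bounded_opsI[where C = 1]) (auto simp: op_one_def)

lemma op_add_bounded:
  assumes S: "S \<in> bounded_ops H H" and T: "T \<in> bounded_ops H H"
  shows "op_add H S T \<in> bounded_ops H H"
proof -
  obtain C where C: "\<And>x. x \<in> carrier H \<Longrightarrow> hnorm H (S x) \<le> C * hnorm H x"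
    using bounded_ops_bound[OF S] by blast
  obtain D where D: "\<And>x. x \<in> carrier H \<Longrightarrow> hnorm H (T x) \<le> D * hnorm H x"
    using bounded_ops_bound[OF T] by blast
  note [simp] = bounded_ops_closed[OF S] bounded_ops_closed[OF T]
  show ?thesis
  proof (rule bounded_opsI[where C = "C + D"])
    fix x assume "x \<in> carrier H"
    then show "hnorm H (op_add H S T x) \<le> (C + D) * hnorm H x"
      using C[of x] D[of x] hnorm_add[of "S x" "T x"] by (simp add: op_add_def algebra_simps)
  next
    fix x y assume "x \<in> carrier H" "y \<in> carrier H"
    then show "op_add H S T (x \<oplus> y) = op_add H S T x \<oplus> op_add H S T y"
      by (intro vec_eqI) (auto simp: op_add_def ip_linear bounded_ops_add[OF S] bounded_ops_add[OF T])
  next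
    fix c x assume "x \<in> carrier H"
    then show "op_add H S T (c \<odot> x) = c \<odot> op_add H S T x"
      by (intro vec_eqI) (auto simp: op_add_def ip_linear bounded_ops_smult[OF S] bounded_ops_smult[OF T] algebra_simps)
  qed (auto simp: op_add_def)
qed

lemma op_scale_bounded:
  assumes T: "T \<in> bounded_ops H H"
  shows "op_scale H c T \<in> bounded_ops H H"
proof -
  obtain D where D: "\<And>x. x \<in> carrier H \<Longrightarrow> hnorm H (T x) \<le> D * hnorm H x"
    using bounded_ops_bound[OF T] by blast
  note [simp] = bounded_ops_closed[OF T]
  show ?thesis
  proof (rule bounded_opsI[where C = "cmod c * D"])
    fix x assume "x \<in> carrier H"
    then show "hnorm H (op_scale H c T x) \<le> (cmod c * D) * hnorm H x"
      using D[of x] by (simp add: op_scale_def mult.assoc mult_left_mono)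
  next
    fix x y assume "x \<in> carrier H" "y \<in> carrier H"
    then show "op_scale H c T (x \<oplus> y) = op_scale H c T x \<oplus> op_scale H c T y"
      by (intro vec_eqI) (auto simp: op_scale_def ip_linear bounded_ops_add[OF T] algebra_simps)
  next
    fix a x assume "x \<in> carrier H"
    then show "op_scale H c T (a \<odot> x) = a \<odot> op_scale H c T x"
      by (intro vec_eqI) (auto simp: op_scale_def ip_linear bounded_ops_smult[OF T])
  qed (auto simp: op_scale_def)
qed

lemma op_diff_eq: "op_diff H S T = op_add H S (op_scale H (-1) T)"
  if "S \<in> bounded_ops H H" "T \<in> bounded_ops H H"
proof
  fix x
  show "op_diff H S T x = op_add H S (op_scale H (-1) T) x"
  proof (cases "x \<in> carrier H")
    case True
    then have "S x \<ominus> T x = S x \<oplus> (-1) \<odot> T x"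
      using bounded_ops_closed[OF that(1)] bounded_ops_closed[OF that(2)]
      by (intro vec_eqI) (auto simp: ip_linear)
    then show ?thesis using True by (simp add: op_diff_def op_add_def op_scale_def)
  qed (auto simp: op_diff_def op_add_def)
qed

lemma op_diff_bounded:
  "\<lbrakk>S \<in> bounded_ops H H; T \<in> bounded_ops H H\<rbrakk> \<Longrightarrow> op_diff H S T \<in> bounded_ops H H"
  by (simp add: op_diff_eq op_add_bounded op_scale_bounded)

lemma op_mult_bounded:
  assumes S: "S \<in> bounded_ops H H" and T: "T \<in> bounded_ops H H"
  shows "op_mult H S T \<in> bounded_ops H H"
proof -
  obtain C where C: "1 \<le> C" "\<And>x. x \<in> carrier H \<Longrightarrow> hnorm H (S x) \<le> C * hnorm H x"
    using bounded_ops_bound[OF S] by blast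
  obtain D where D: "\<And>x. x \<in> carrier H \<Longrightarrow> hnorm H (T x) \<le> D * hnorm H x"
    using bounded_ops_bound[OF T] by blast
  note [simp] = bounded_ops_closed[OF S] bounded_ops_closed[OF T]
  show ?thesis
  proof (rule bounded_opsI[where C = "C * D"])
    fix x assume x: "x \<in> carrier H"
    then have "hnorm H (S (T x)) \<le> C * hnorm H (T x)"
      by (intro C) simp
    also have "\<dots> \<le> C * (D * hnorm H x)"
      using C(1) D[OF x] by (intro mult_left_mono) auto
    finally show "hnorm H (op_mult H S T x) \<le> (C * D) * hnorm H x"
      using x by (simp add: compose_def mult.assoc)
  qed (auto simp: compose_def bounded_ops_add[OF T] bounded_ops_smult[OF T]
         bounded_ops_add[OF S] bounded_ops_smult[OF S])
qed

lemma op_norm_bound: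
  assumes T: "T \<in> bounded_ops H H" and x: "x \<in> carrier H"
  shows "hnorm H (T x) \<le> op_norm H T * hnorm H x"
proof (cases "x = \<zero>")
  case True
  then show ?thesis using bounded_ops_zero[OF T] by simp
next
  case False
  obtain C where C: "1 \<le> C" "\<And>x. x \<in> carrier H \<Longrightarrow> hnorm H (T x) \<le> C * hnorm H x"
    using bounded_ops_bound[OF T] by blast
  have pos: "0 < hnorm H x" using x False by (rule hnorm_pos)
  define u where "u = complex_of_real (1 / hnorm H x) \<odot> x"
  have u: "u \<in> carrier H" "hnorm H u = 1"
    using x pos by (simp_all add: u_def norm_divide)
  have "hnorm H (T u) \<le> op_norm H T"
    unfolding op_norm_def
  proof (rule cSUP_upper)
    \<comment> \<open>A supremum of reals bounds its members only when the set is bounded above;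
      this is where the bound of \<open>T\<close> enters.\<close>
    show "bdd_above ((\<lambda>x. hnorm H (T x)) ` {x \<in> carrier H. hnorm H x \<le> 1})"
    proof (rule bdd_aboveI2)
      fix y assume y: "y \<in> {x \<in> carrier H. hnorm H x \<le> 1}"
      then have "C * hnorm H y \<le> C * 1"
        using C(1) by (intro mult_left_mono) auto
      then show "hnorm H (T y) \<le> C"
        using C(2)[of y] y by simp
    qed
  qed (use u in auto)
  moreover have "hnorm H (T u) = hnorm H (T x) / hnorm H x"
    using x pos bounded_ops_closed[OF T] by (simp add: u_def bounded_ops_smult[OF T] del: of_real_divide)
  ultimately show ?thesis
    using pos by (simp add: field_simps)
qed

text \<open>Makes the family intersected in \<open>cstar_generated\<close> nonempty, so that the
  generated algebra is a set of bounded operators and not the universal set.\<close>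

lemma cstar_subalgebra_bounded_ops: "cstar_subalgebra H (bounded_ops H H)"
  unfolding cstar_subalgebra_def
  by (auto simp: op_one_bounded op_add_bounded op_scale_bounded op_mult_bounded is_adjoint_def)

end

lemma cstar_subalgebraD:
  assumes "cstar_subalgebra H \<A>"
  shows "T \<in> \<A> \<Longrightarrow> T \<in> bounded_ops H H" "op_one H \<in> \<A>"
    "\<lbrakk>S \<in> \<A>; T \<in> \<A>\<rbrakk> \<Longrightarrow> op_add H S T \<in> \<A>"
    "T \<in> \<A> \<Longrightarrow> op_scale H c T \<in> \<A>"
    "\<lbrakk>S \<in> \<A>; T \<in> \<A>\<rbrakk> \<Longrightarrow> op_mult H S T \<in> \<A>"
    "\<lbrakk>T \<in> \<A>; is_adjoint H H T S\<rbrakk> \<Longrightarrow> S \<in> \<A>"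
  using assms unfolding cstar_subalgebra_def by blast+

lemma cstar_subalgebra_generated:
  assumes "inner_space H" "\<And>i. A i \<in> bounded_ops H H"
  shows "cstar_subalgebra H (cstar_generated H A)"
proof -
  have sub: "cstar_generated H A \<subseteq> \<B>" if "cstar_subalgebra H \<B>" "range A \<subseteq> \<B>" for \<B>
    using that unfolding cstar_generated_def by blast
  have mem: "T \<in> cstar_generated H A"
    if "\<And>\<B>. cstar_subalgebra H \<B> \<Longrightarrow> range A \<subseteq> \<B> \<Longrightarrow> T \<in> \<B>" for T
    using that unfolding cstar_generated_def by blast
  have c1: "cstar_generated H A \<subseteq> bounded_ops H H"
    using assms inner_space.cstar_subalgebra_bounded_ops by (intro sub) auto
  have c2: "op_one H \<in> cstar_generated H A"
    by (rule mem) (rule cstar_subalgebraD)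
  have c3: "op_add H S T \<in> cstar_generated H A"
    if "S \<in> cstar_generated H A" "T \<in> cstar_generated H A" for S T
    using that sub by (intro mem cstar_subalgebraD(3)) blast+
  have c4: "op_scale H c T \<in> cstar_generated H A" if "T \<in> cstar_generated H A" for c T
    using that sub by (intro mem cstar_subalgebraD(4)) blast+
  have c5: "op_mult H S T \<in> cstar_generated H A"
    if "S \<in> cstar_generated H A" "T \<in> cstar_generated H A" for S T
    using that sub by (intro mem cstar_subalgebraD(5)) blast+
  have c6: "S \<in> cstar_generated H A"
    if T: "T \<in> cstar_generated H A" and ad: "is_adjoint H H T S" for S T
  proof (rule mem)
    fix \<B> assume "cstar_subalgebra H \<B>" "range A \<subseteq> \<B>"
    then show "S \<in> \<B>" using T ad sub cstar_subalgebraD(6) by blast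
  qed
  have c7: "T \<in> cstar_generated H A" if T: "T \<in> bounded_ops H H"
    and lim: "\<forall>e>0. \<exists>S \<in> cstar_generated H A. op_norm H (op_diff H S T) < e" for T
  proof (rule mem)
    fix \<B> assume B: "cstar_subalgebra H \<B>" "range A \<subseteq> \<B>"
    have "\<forall>e>0. \<exists>S \<in> \<B>. op_norm H (op_diff H S T) < e"
      using lim sub[OF B] by blast
    then show "T \<in> \<B>"
      using T B unfolding cstar_subalgebra_def by blast
  qed
  show ?thesis
    unfolding cstar_subalgebra_def[of H "cstar_generated H A"]
    by (intro conjI ballI allI impI c1 c2 c3 c4 c5; (assumption | erule (1) c6 | erule (1) c7))
qed

lemma cstar_generated_mem: "A i \<in> cstar_generated H A"
  unfolding cstar_generated_def by blast

section \<open>Points of the joint spectrum from approximate eigenvectors\<close>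

section \<open>Joint approximate eigenvectors\<close>

text \<open>The summands are the powers of \<open>q = cis (2 * pi * (k - j) / n)\<close>. This is an
  n-th root of unity, different from 1 for distinct \<open>j\<close> and \<open>k\<close> because
  their distance is less than \<open>n\<close>, so the geometric sum vanishes.\<close>

lemma sum_roots_of_unity_orthogonal:
  fixes n :: nat
  assumes "j < n" "k < n"
  shows "(\<Sum>m<n. cnj (cis (2 * pi * real m / real n)) ^ j * cis (2 * pi * real m / real n) ^ k)
    = (if j = k then of_nat n else 0)"
proof -
  define q where "q = cis (2 * pi * (real k - real j) / real n)"
  have n: "real n > 0" using assms by simp
  have trm: "cnj (cis (2 * pi * real m / real n)) ^ j * cis (2 * pi * real m / real n) ^ k = q ^ m" for m
  proof -
    have "cnj (cis (2 * pi * real m / real n)) ^ j * cis (2 * pi * real m / real n) ^ k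
        = cis (real j * - (2 * pi * real m / real n) + real k * (2 * pi * real m / real n))"
      by (simp only: cis_cnj Complex.DeMoivre cis_mult)
    also have "real j * - (2 * pi * real m / real n) + real k * (2 * pi * real m / real n)
        = real m * (2 * pi * (real k - real j) / real n)"
      using n by (simp add: field_simps)
    finally show ?thesis by (simp add: q_def Complex.DeMoivre)
  qed
  show ?thesis
  proof (cases "j = k")
    case True
    then show ?thesis unfolding trm by (simp add: q_def)
  next
    case False
    have "q ^ n = cis (2 * pi * (real k - real j))"
      using n by (simp add: q_def Complex.DeMoivre)
    also have "\<dots> = cis (2 * pi * of_int (int k - int j))"
      by simp
    also have "\<dots> = 1"
      by (rule cis_multiple_2pi) auto
    finally have qn: "q ^ n = 1" .
    have "q \<noteq> 1"
    proof
      assume "q = 1"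
      then have "cos (2 * pi * (real k - real j) / real n) = 1"
        by (metis q_def cis.sel(1) one_complex.sel(1))
      then obtain i :: int where "2 * pi * (real k - real j) / real n = of_int i * 2 * pi"
        by (auto simp: cos_one_2pi_int)
      then have "pi * (2 * (real k - real j)) = pi * (2 * (of_int i * real n))"
        using n by (simp add: field_simps)
      then have "real k - real j = of_int i * real n"
        by (simp only: mult_cancel_left) auto
      then have eq: "int k - int j = i * int n"
        by (metis of_int_diff of_int_eq_iff of_int_mult of_int_of_nat_eq)
      have "\<bar>i * int n\<bar> < int n" using assms unfolding eq[symmetric] by linarith
      then have "\<bar>i\<bar> * int n < 1 * int n" by (simp only: abs_mult abs_of_nat mult_1)
      then have "\<bar>i\<bar> < 1" by (rule mult_right_less_imp_less) simp
      then show False using eq False by simp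
    qed
    then show ?thesis
      unfolding trm using qn False by (simp add: geometric_sum)
  qed
qed

context inner_space
begin

lemma funpow_closed:
  assumes "N \<in> bounded_ops H H" "x \<in> carrier H"
  shows "(N ^^ k) x \<in> carrier H"
  using assms by (induction k) (auto dest: bounded_ops_closed)

text \<open>Averaging \<open>y\<close> over the \<open>n\<close>-th roots of unity \<open>z\<close> kills the cross terms, so that some \<open>z\<close> makes
  \<open>y\<close> long, while \<open>N y - r z y\<close> telescopes.\<close>

lemma geometric_eigenvector:
  assumes N: "N \<in> bounded_ops H H" and x: "x \<in> carrier H" and r: "0 < r" and n: "0 < n"
    and lower: "\<And>k. k < n \<Longrightarrow> r ^ k \<le> 2 * hnorm H ((N ^^ k) x)"
    and upper: "hnorm H ((N ^^ n) x) \<le> 2 * r ^ n" and x1: "hnorm H x = 1"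
  obtains z where "cmod z = 1"
    "real n \<le> 4 * (hnorm H (finsum H (\<lambda>k. (cnj z / of_real r) ^ k \<odot> (N ^^ k) x) {..<n}))\<^sup>2"
    "hnorm H (N (finsum H (\<lambda>k. (cnj z / of_real r) ^ k \<odot> (N ^^ k) x) {..<n}) \<ominus>
       (of_real r * z) \<odot> finsum H (\<lambda>k. (cnj z / of_real r) ^ k \<odot> (N ^^ k) x) {..<n}) \<le> 3 * r"
proof -
  define y where "y z = finsum H (\<lambda>k. (cnj z / of_real r) ^ k \<odot> (N ^^ k) x) {..<n}" for z
  define c where "c m = cis (2 * pi * real m / real n)" for m
  define G where "G j k = ip H ((N ^^ j) x) ((N ^^ k) x)" for j k
  note [simp] = funpow_closed[OF N x]
  have y_closed [simp]: "y z \<in> carrier H" for z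
    unfolding y_def by (rule M.finsum_closed) auto
  have ip_y: "ip H (y z) (y z) = (\<Sum>j<n. \<Sum>k<n. G j k / of_real r ^ (j + k) * (cnj z ^ j * z ^ k))" for z
  proof -
    have "ip H (y z) (y z) =
        (\<Sum>j<n. ip H ((cnj z / of_real r) ^ j \<odot> (N ^^ j) x) (y z))"
      by (subst (1) y_def) (rule ip_finsum_left; simp)
    also have "\<dots> = (\<Sum>j<n. \<Sum>k<n. ip H ((cnj z / of_real r) ^ j \<odot> (N ^^ j) x)
        ((cnj z / of_real r) ^ k \<odot> (N ^^ k) x))"
      unfolding y_def by (intro sum.cong refl ip_finsum_right) auto
    also have "\<dots> = (\<Sum>j<n. \<Sum>k<n. G j k / of_real r ^ (j + k) * (cnj z ^ j * z ^ k))"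
      by (intro sum.cong refl) (simp add: ip_linear G_def power_divide power_add field_simps)
    finally show ?thesis .
  qed
  have "(\<Sum>m<n. ip H (y (c m)) (y (c m))) =
      (\<Sum>j<n. \<Sum>k<n. \<Sum>m<n. G j k / of_real r ^ (j + k) * (cnj (c m) ^ j * c m ^ k))"
    unfolding ip_y by (subst sum.swap) (intro sum.cong refl sum.swap)
  also have "\<dots> = (\<Sum>j<n. \<Sum>k<n. G j k / of_real r ^ (j + k) * (if j = k then of_nat n else 0))"
    unfolding c_def sum_distrib_left[symmetric]
    by (intro sum.cong refl) (simp add: sum_roots_of_unity_orthogonal)
  also have "\<dots> = (\<Sum>j<n. G j j / of_real r ^ (j + j) * of_nat n)"
    by (intro sum.cong refl) (simp add: if_distrib[of "\<lambda>t. _ * t"] cong: if_cong)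
  finally have avg: "(\<Sum>m<n. ip H (y (c m)) (y (c m))) = (\<Sum>j<n. G j j / of_real r ^ (j + j) * of_nat n)" .
  \<comment> \<open>By \<open>lower\<close> every diagonal term is at least 1/4 before the factor
    \<open>n\<close>, so the mean over the roots of the squared norm of \<open>y\<close> is at least
    \<open>n / 4\<close>.\<close>
  have "(\<Sum>m<n. real n) \<le> (\<Sum>m<n. 4 * (hnorm H (y (c m)))\<^sup>2)"
  proof -
    have ge: "1/4 \<le> (hnorm H ((N ^^ j) x))\<^sup>2 / r ^ (j + j)" if "j < n" for j
    proof -
      have "(r ^ j)\<^sup>2 \<le> (2 * hnorm H ((N ^^ j) x))\<^sup>2"
        using lower[OF that] r by (intro power_mono) auto
      then show ?thesis
        using r by (simp add: field_simps power_add power2_eq_square)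
    qed
    have "complex_of_real (\<Sum>m<n. (hnorm H (y (c m)))\<^sup>2) =
        complex_of_real (\<Sum>j<n. (hnorm H ((N ^^ j) x))\<^sup>2 / r ^ (j + j) * n)"
      using avg by (simp add: G_def ip_self)
    then have "(\<Sum>m<n. (hnorm H (y (c m)))\<^sup>2) = (\<Sum>j<n. (hnorm H ((N ^^ j) x))\<^sup>2 / r ^ (j + j) * n)"
      by (simp only: of_real_eq_iff)
    also have "\<dots> \<ge> (\<Sum>j<n. 1/4 * real n)"
      using ge by (intro sum_mono mult_right_mono) auto
    finally show ?thesis
      by (simp flip: sum_distrib_left)
  qed
  then have "\<exists>m<n. real n \<le> 4 * (hnorm H (y (c m)))\<^sup>2"
  proof (rule contrapos_pp)
    assume "\<not> (\<exists>m<n. real n \<le> 4 * (hnorm H (y (c m)))\<^sup>2)"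
    then have "(\<Sum>m<n. 4 * (hnorm H (y (c m)))\<^sup>2) < (\<Sum>m<n. real n)"
      using n by (intro sum_strict_mono) (auto simp: not_le)
    then show "\<not> (\<Sum>m<n. real n) \<le> (\<Sum>m<n. 4 * (hnorm H (y (c m)))\<^sup>2)"
      by simp
  qed
  then obtain m where m: "real n \<le> 4 * (hnorm H (y (c m)))\<^sup>2"
    by blast
  define z where "z = c m"
  define w where "w = cnj z / of_real r"
  have z: "cmod z = 1" by (simp add: z_def c_def)
  then have zw: "of_real r * z * w = 1"
    using r by (simp add: w_def complex_norm_square[symmetric] mult.assoc)
  have cw: "cmod w = 1 / r"
    using z r by (simp add: w_def norm_divide)
  have y_eq: "y z = finsum H (\<lambda>k. w ^ k \<odot> (N ^^ k) x) {..<n}"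
    by (simp add: y_def w_def)
  have Ny: "N (y z) = finsum H (\<lambda>k. w ^ k \<odot> (N ^^ Suc k) x) {..<n}"
    unfolding y_eq by (subst bounded_ops_finsum[OF N]) (auto simp: bounded_ops_smult[OF N] intro!: M.finsum_cong')
  \<comment> \<open>As \<open>r z w = 1\<close>, the coefficient \<open>w ^ k\<close> equals
    \<open>r z w ^ (k + 1)\<close>. So \<open>N y\<close> is \<open>r z\<close> times the sum
    shifted by one index, and only the two end terms survive the subtraction.\<close>
  have tel: "N (y z) \<ominus> (of_real r * z) \<odot> y z =
      (of_real r * z) \<odot> (w ^ n \<odot> (N ^^ n) x \<ominus> x)"
  proof (rule vec_eqI)
    fix v assume v: "v \<in> carrier H"
    define g where "g k = w ^ k * ip H ((N ^^ k) x) v" for k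
    have *: "w ^ k * ip H ((N ^^ Suc k) x) v = of_real r * z * g (Suc k)" for k
    proof -
      have "of_real r * z * g (Suc k) = (of_real r * z * w) * (w ^ k * ip H ((N ^^ Suc k) x) v)"
        by (simp add: g_def algebra_simps)
      then show ?thesis by (simp add: zw)
    qed
    have "ip H (N (y z)) v = (\<Sum>k<n. w ^ k * ip H ((N ^^ Suc k) x) v)"
      unfolding Ny using v bounded_ops_closed[OF N] by (subst ip_finsum_left) (auto simp: ip_linear)
    also have "\<dots> = (\<Sum>k<n. of_real r * z * g (Suc k))"
      by (simp only: *)
    finally have 1: "ip H (N (y z)) v = of_real r * z * (\<Sum>k<n. g (Suc k))"
      by (simp add: sum_distrib_left)
    have 2: "ip H (y z) v = (\<Sum>k<n. g k)"
      unfolding y_eq using v by (subst ip_finsum_left) (auto simp: ip_linear g_def)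
    have "ip H (N (y z) \<ominus> (of_real r * z) \<odot> y z) v = of_real r * z * (\<Sum>k<n. g (Suc k) - g k)"
      using v bounded_ops_closed[OF N] by (simp add: ip_linear 1 2 sum_subtractf algebra_simps)
    also have "(\<Sum>k<n. g (Suc k) - g k) = g n - g 0"
      by (rule sum_lessThan_telescope)
    finally show "ip H (N (y z) \<ominus> (of_real r * z) \<odot> y z) v =
      ip H ((of_real r * z) \<odot> (w ^ n \<odot> (N ^^ n) x \<ominus> x)) v"
      using v x by (simp add: ip_linear g_def)
  qed (use x bounded_ops_closed[OF N] in auto)
  have "hnorm H (N (y z) \<ominus> (of_real r * z) \<odot> y z) \<le> r * (hnorm H (w ^ n \<odot> (N ^^ n) x) + hnorm H x)"
    unfolding tel using x r z hnorm_minus[of "w ^ n \<odot> (N ^^ n) x" x]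
    by (simp add: norm_mult)
  also have "\<dots> \<le> r * (2 + 1)"
    using r x1 upper by (simp add: norm_power cw power_divide field_simps)
  finally show ?thesis
    using that[of z] z m unfolding y_def z_def by simp
qed

text \<open>Known as paranormality. Cauchy-Schwarz gives it for normal operators, for the
  skew-adjoint \<open>D\<close> in \<open>N_self_adjoint\<close> and for the self-adjoint sums
  \<open>comb s\<close>, so one extension lemma serves all three.\<close>

definition paranormal :: "('v \<Rightarrow> 'v) \<Rightarrow> bool" where
  "paranormal T \<longleftrightarrow> (\<forall>x \<in> carrier H. (hnorm H (T x))\<^sup>2 \<le> hnorm H (T (T x)) * hnorm H x)"

text \<open>Paranormality says that the ratios of consecutive norms along an orbit do not decrease,
  so a lower bound on the first ratio persists.\<close>

lemma paranormal_growth: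
  assumes N: "N \<in> bounded_ops H H" and pn: "paranormal N" and x: "x \<in> carrier H"
    and b: "b * hnorm H x \<le> hnorm H (N x)"
  shows "b * hnorm H ((N ^^ k) x) \<le> hnorm H ((N ^^ Suc k) x)"
proof (induction k)
  case (Suc k)
  define a where "a k = hnorm H ((N ^^ k) x)" for k
  have nonneg: "0 \<le> a k" for k
    using funpow_closed[OF N x] by (simp add: a_def)
  have sq: "a (Suc k) * a (Suc k) \<le> a (Suc (Suc k)) * a k"
    using pn funpow_closed[OF N x, of k] by (simp add: paranormal_def a_def power2_eq_square)
  have IH: "b * a k \<le> a (Suc k)" using Suc by (simp add: a_def)
  show ?case
  proof (cases "a k = 0")
    \<comment> \<open>The ratio is undefined here, but the orbit has reached zero and stays
      there.\<close>
    case True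
    then have "(N ^^ k) x = \<zero>" using funpow_closed[OF N x] by (simp add: a_def hnorm_eq_0_iff)
    then show ?thesis by (simp add: bounded_ops_zero[OF N])
  next
    case False
    then have pos: "0 < a k" using nonneg[of k] by simp
    have "a k * (b * a (Suc k)) \<le> a (Suc k) * a (Suc k)"
      using mult_right_mono[OF IH nonneg[of "Suc k"]] by (simp add: mult_ac)
    also have "\<dots> \<le> a k * a (Suc (Suc k))" using sq by (simp add: mult_ac)
    finally show ?thesis using pos by (simp add: a_def)
  qed
qed (use b in simp)

text \<open>One vector has to serve all pairs at once. The family is a set of pairs so that
  operators outside the tuple can be put in and one operator may carry two values. For the empty set
  this only says that the space has a unit vector.\<close>

definition approx_eig :: "(('v \<Rightarrow> 'v) \<times> complex) set \<Rightarrow> bool" where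
  "approx_eig P \<longleftrightarrow> (\<forall>e>0. \<exists>x \<in> carrier H. hnorm H x = 1 \<and>
     (\<forall>(T, l) \<in> P. hnorm H (residual T l x) < e))"

lemma normalize_approx:
  assumes y: "y \<in> carrier H" "y \<noteq> \<zero>"
  obtains x c where "x \<in> carrier H" "hnorm H x = 1" "x = c \<odot> y" "cmod c = 1 / hnorm H y"
    "\<And>T l. T \<in> bounded_ops H H \<Longrightarrow> hnorm H (residual T l x) = hnorm H (residual T l y) / hnorm H y"
    "\<And>T. T \<in> bounded_ops H H \<Longrightarrow> hnorm H (T x) = hnorm H (T y) / hnorm H y"
proof -
  define c where "c = complex_of_real (1 / hnorm H y)"
  define x where "x = c \<odot> y"
  have pos: "0 < hnorm H y" using y by (rule hnorm_pos)
  have c: "cmod c = 1 / hnorm H y" using pos by (simp add: c_def norm_divide)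
  show ?thesis
  proof (rule that[of x c])
    fix T l assume T: "T \<in> bounded_ops H H"
    note [simp] = bounded_ops_closed[OF T]
    have "residual T l x = c \<odot> (residual T l y)"
      using y by (intro vec_eqI) (auto simp: x_def bounded_ops_smult[OF T] ip_linear algebra_simps)
    then show "hnorm H (residual T l x) = hnorm H (residual T l y) / hnorm H y"
      using y c by simp
  next
    fix T assume T: "T \<in> bounded_ops H H"
    note [simp] = bounded_ops_closed[OF T]
    show "hnorm H (T x) = hnorm H (T y) / hnorm H y"
      using y c by (simp add: x_def bounded_ops_smult[OF T])
  qed (use y c pos in \<open>auto simp: x_def\<close>)
qed

text \<open>As \<open>T\<close> commutes with \<open>N\<close>, the residual of
  \<open>(N ^^ k) x\<close> is the k-th iterate of the residual of \<open>x\<close>. Powers of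
  \<open>N\<close> thus spoil an approximate eigenvector of \<open>T\<close> by a factor
  \<open>C ^ k\<close> at most.\<close>

lemma funpow_approx_bound:
  assumes N: "N \<in> bounded_ops H H" and C: "0 \<le> C" "\<And>x. x \<in> carrier H \<Longrightarrow> hnorm H (N x) \<le> C * hnorm H x"
    and T: "T \<in> bounded_ops H H"
    and comm: "\<And>x. x \<in> carrier H \<Longrightarrow> T (N x) = N (T x)" and x: "x \<in> carrier H"
  shows "hnorm H (residual T l ((N ^^ k) x)) \<le> C ^ k * hnorm H (residual T l x)"
proof (induction k)
  case (Suc k)
  define u where "u = (N ^^ k) x"
  have u: "u \<in> carrier H" using funpow_closed[OF N x] by (simp add: u_def)
  note [simp] = bounded_ops_closed[OF T] bounded_ops_closed[OF N]
  have "residual T l (N u) = N (residual T l u)"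
    using u comm by (simp add: bounded_ops_minus[OF N] bounded_ops_smult[OF N])
  then have "hnorm H (residual T l (N u)) \<le> C * hnorm H (residual T l u)"
    using u C(2)[of "residual T l u"] by simp
  also have "\<dots> \<le> C * (C ^ k * hnorm H (residual T l x))"
    using Suc C by (intro mult_left_mono) (auto simp: u_def)
  finally show ?case by (simp add: u_def mult.assoc)
qed simp

end

context inner_space
begin

text \<open>The number \<open>r\<close> is the limit of the norms of \<open>N\<close> on the approximate eigenspaces of \<open>P\<close>. A vector
  where \<open>N\<close> nearly attains it stays so under powers of \<open>N\<close>, by paranormality; these powers therefore
  behave like those of \<open>r\<close> times an isometry.\<close>

lemma approx_eig_extend:
  assumes P: "approx_eig P" and N: "N \<in> bounded_ops H H" and pn: "paranormal N"
    and T: "\<And>T l. (T, l) \<in> P \<Longrightarrow> T \<in> bounded_ops H H"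
    and comm: "\<And>T l x. (T, l) \<in> P \<Longrightarrow> x \<in> carrier H \<Longrightarrow> T (N x) = N (T x)"
  obtains \<mu> where "approx_eig (insert (N, \<mu>) P)"
    "\<And>b. (\<And>e. e > 0 \<Longrightarrow> \<exists>x \<in> carrier H. hnorm H x = 1 \<and>
       (\<forall>(T, l) \<in> P. hnorm H (residual T l x) < e) \<and> b \<le> hnorm H (N x)) \<Longrightarrow> b \<le> cmod \<mu>"
proof -
  define E where "E e x \<longleftrightarrow> x \<in> carrier H \<and> hnorm H x = 1 \<and>
    (\<forall>(T, l) \<in> P. hnorm H (residual T l x) < e)" for e x
  \<comment> \<open>\<open>B\<close> holds the values that the norm of \<open>N x\<close> reaches or
    exceeds at every tolerance \<open>e\<close>; its supremum \<open>r\<close> will be the modulus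
    of the new eigenvalue.\<close>
  define B where "B = {b. \<forall>e>0. \<exists>x. E e x \<and> b \<le> hnorm H (N x)}"
  define r where "r = Sup B"
  obtain C where C: "1 \<le> C" "\<And>x. x \<in> carrier H \<Longrightarrow> hnorm H (N x) \<le> C * hnorm H x"
    using bounded_ops_bound[OF N] by blast
  have Nc [simp]: "N x \<in> carrier H" if "x \<in> carrier H" for x
    using that by (rule bounded_ops_closed[OF N])
  have E_mono: "E e' x" if "E e x" "e \<le> e'" for e e' x
    using that unfolding E_def by fastforce
  have ex: "\<exists>x. E e x" if "e > 0" for e
    using P that unfolding approx_eig_def E_def by blast
  have B0: "0 \<in> B"
    unfolding B_def mem_Collect_eq
  proof (intro allI impI)
    fix e :: real assume "e > 0"
    then obtain x where "E e x" using ex by blast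
    then show "\<exists>x. E e x \<and> 0 \<le> hnorm H (N x)" by (intro exI[of _ x]) (simp add: E_def)
  qed
  have BC: "b \<le> C" if b: "b \<in> B" for b
  proof -
    have "\<forall>e>0. \<exists>x. E e x \<and> b \<le> hnorm H (N x)"
      using b unfolding B_def by (rule CollectD)
    from this[rule_format, of 1]
    obtain x where "E 1 x" "b \<le> hnorm H (N x)" by auto
    then show ?thesis using C(2)[of x] by (simp add: E_def)
  qed
  have bdd: "bdd_above B" using BC by (rule bdd_aboveI)
  have r_ub: "b \<le> r" if "b \<in> B" for b
    unfolding r_def using that bdd by (rule cSup_upper)
  have r0: "0 \<le> r" using r_ub B0 .
  have rC: "r \<le> C" unfolding r_def using BC B0 by (intro cSup_least) auto
  have below: "b \<in> B" if br: "b < r" for b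
  proof -
    have "B \<noteq> {}" using B0 by auto
    then obtain b' where b': "b' \<in> B" "b < b'"
      using br less_cSup_iff[OF _ bdd, of b] unfolding r_def by auto
    show ?thesis unfolding B_def mem_Collect_eq
    proof (intro allI impI)
      fix e :: real assume "e > 0"
      moreover have "\<forall>e>0. \<exists>x. E e x \<and> b' \<le> hnorm H (N x)"
        using b'(1) unfolding B_def by (rule CollectD)
      ultimately obtain x where "E e x" "b' \<le> hnorm H (N x)" by auto
      then show "\<exists>x. E e x \<and> b \<le> hnorm H (N x)" using b'(2) by (intro exI[of _ x]) auto
    qed
  qed
  \<comment> \<open>A number above \<open>r\<close> bounds \<open>N\<close> strictly on all vectors
    of some fixed tolerance. Applied to iterates of a vector, this limits their growth from
    above.\<close>
  have above: "\<exists>e>0. \<forall>x. E e x \<longrightarrow> hnorm H (N x) < b" if "r < b" for b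
  proof -
    have "b \<notin> B" using r_ub[of b] that by auto
    then show ?thesis unfolding B_def by (auto simp: not_le)
  qed
  have "\<exists>\<mu>. cmod \<mu> = r \<and> approx_eig (insert (N, \<mu>) P)"
  proof (cases "r = 0")
    \<comment> \<open>Then \<open>N\<close> is arbitrarily small on approximate eigenvectors of
      \<open>P\<close>, and the new eigenvalue is 0.\<close>
    case True
    have "approx_eig (insert (N, 0) P)"
      unfolding approx_eig_def
    proof (intro allI impI)
      fix e :: real assume e: "e > 0"
      obtain e0 where e0: "e0 > 0" "\<And>x. E e0 x \<Longrightarrow> hnorm H (N x) < e"
        using above[of e] True e by auto
      obtain x where x: "E (min e e0) x" using ex[of "min e e0"] e e0 by auto
      then have "E e x" "hnorm H (N x) < e"
        using e0(2)[of x] E_mono[of _ x] by auto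
      moreover have "N x \<ominus> 0 \<odot> x = N x" if "x \<in> carrier H"
        using that by (intro vec_eqI) (auto simp: ip_linear)
      ultimately show "\<exists>x\<in>carrier H. hnorm H x = 1 \<and>
          (\<forall>(T, l)\<in>insert (N, 0) P. hnorm H (residual T l x) < e)"
        by (intro bexI[of _ x]) (auto simp: E_def)
    qed
    then show ?thesis using True by (intro exI[of _ 0]) auto
  next
    case False
    then have r: "0 < r" using r0 by simp
    have step: "\<exists>z y. cmod z = 1 \<and> E e y \<and> hnorm H (residual N (of_real r * z) y) < e"
      if e: "e > 0" for e
    proof -
      \<comment> \<open>The sum \<open>y\<close> below has norm at least half the square root of
        \<open>n\<close> and residual at most \<open>3 * r\<close>; this \<open>n\<close> makes
        their quotient smaller than \<open>e\<close>.\<close>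
      obtain n :: nat where n: "(6 * r / e)\<^sup>2 < real n" using reals_Archimedean2 by blast
      then have n0: "0 < n" using zero_le_power2[of "6 * r / e"] by linarith
      \<comment> \<open>Over \<open>n\<close> steps the norms stay above the powers of
        \<open>r * \<beta>\<close> and below those of \<open>r / \<beta>\<close>. By Bernoulli
        \<open>\<beta> ^ n\<close> is at least 1/2, so both estimates differ from
        \<open>r ^ k\<close> by a factor of at most 2, as \<open>geometric_eigenvector\<close>
        asks.\<close>
      define \<beta> where "\<beta> = 1 - 1 / (2 * real n)"
      have \<beta>: "1/2 \<le> \<beta>" "\<beta> < 1" using n0 by (simp_all add: \<beta>_def field_simps)
      have \<beta>n: "1/2 \<le> \<beta> ^ n"
        using Bernoulli_inequality[of "- 1 / (2 * real n)" n] n0 by (simp add: \<beta>_def field_simps)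
      define b where "b = r * \<beta>"
      have b: "0 < b" "b < r" using r \<beta> by (simp_all add: b_def)
      have "r < r / \<beta>" using r \<beta> by (simp add: field_simps)
      then obtain e0 where e0: "e0 > 0" "\<And>x. E e0 x \<Longrightarrow> hnorm H (N x) < r / \<beta>"
        using above by blast
      define K where "K = real n * (C / r) ^ n"
      have Cr: "1 \<le> C / r" using rC r by simp
      have K: "0 < K" using n0 Cr by (simp add: K_def)
      \<comment> \<open>The first bound keeps the normalised iterates up to the n-th within
        tolerance \<open>e0\<close>: their residuals grow at most by \<open>C ^ k\<close>, while
        their norms are at least \<open>b ^ k\<close>. The second keeps the residual of the sum
        \<open>y\<close> below \<open>e / 2\<close>, which suffices because \<open>y\<close> has
        norm at least 1/2; \<open>K\<close> bounds the effect of its \<open>n\<close>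
        summands.\<close>
      define e1 where "e1 = min (e0 * (b / C) ^ n) (e / (2 * K))"
      have e1: "0 < e1" using e e0 b C K by (simp add: e1_def)
      obtain x where Ex: "E e1 x" and bx: "b \<le> hnorm H (N x)"
        using below[OF b(2)] e1 unfolding B_def by blast
      then have x: "x \<in> carrier H" "hnorm H x = 1" by (auto simp: E_def)
      define a where "a k = hnorm H ((N ^^ k) x)" for k
      note [simp] = funpow_closed[OF N x(1)]
      have grow: "b * a k \<le> a (Suc k)" for k
        unfolding a_def using bx x by (intro paranormal_growth[OF N pn]) auto
      have a_ge: "b ^ k \<le> a k" for k
      proof (induction k)
        case (Suc k)
        then have "b * b ^ k \<le> b * a k" using b by (intro mult_left_mono) auto
        also have "\<dots> \<le> a (Suc k)" by (rule grow)
        finally show ?case by simp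
      qed (simp add: a_def x)
      have a_pos: "0 < a k" for k using a_ge[of k] b zero_less_power[of b k] by linarith
      \<comment> \<open>The normalised iterate still belongs to \<open>E e0\<close>, so the upper
        bound for vectors of that tolerance applies to it.\<close>
      have a_step: "a (Suc k) \<le> r / \<beta> * a k" if k: "k \<le> n" for k
      proof -
        define u where "u = (N ^^ k) x"
        have u: "u \<in> carrier H" "hnorm H u = a k" by (auto simp: u_def a_def)
        then have "u \<noteq> \<zero>" using a_pos[of k] by auto
        then obtain v c where v: "v \<in> carrier H" "hnorm H v = 1"
          "\<And>T l. T \<in> bounded_ops H H \<Longrightarrow> hnorm H (residual T l v) = hnorm H (residual T l u) / hnorm H u"
          "\<And>T. T \<in> bounded_ops H H \<Longrightarrow> hnorm H (T v) = hnorm H (T u) / hnorm H u"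
          using normalize_approx[OF u(1)] by metis
        have "hnorm H (residual T l v) < e0" if Tl: "(T, l) \<in> P" for T l
        proof -
          have "hnorm H (residual T l u) \<le> C ^ k * hnorm H (residual T l x)"
            unfolding u_def using C x T comm Tl by (intro funpow_approx_bound[OF N]) auto
          also have "\<dots> < C ^ k * e1"
            using Ex Tl C by (intro mult_strict_left_mono) (auto simp: E_def)
          also have "\<dots> \<le> C ^ k * (e0 * (b / C) ^ n)"
            using C by (intro mult_left_mono) (auto simp: e1_def)
          also have "\<dots> \<le> C ^ k * (e0 * (b / C) ^ k)"
            using C b rC e0 k by (intro mult_left_mono power_decreasing) auto
          also have "\<dots> = e0 * b ^ k" using C by (simp add: power_divide)
          also have "\<dots> \<le> e0 * a k" using a_ge e0 by (intro mult_left_mono) auto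
          finally show ?thesis
            using v(3)[OF T[OF Tl], of l] u a_pos[of k] by (simp add: pos_divide_less_eq)
        qed
        then have "E e0 v" using v by (auto simp: E_def)
        then have "hnorm H (N v) < r / \<beta>" by (rule e0)
        then have "hnorm H (N u) < r / \<beta> * a k"
          using v(4)[OF N] u a_pos[of k] by (simp add: pos_divide_less_eq)
        then show ?thesis by (simp add: u_def a_def)
      qed
      have a_le: "a k \<le> (r / \<beta>) ^ k" if "k \<le> n" for k
        using that
      proof (induction k)
        case (Suc k)
        have "a (Suc k) \<le> r / \<beta> * a k" using Suc.prems by (intro a_step) auto
        also have "\<dots> \<le> r / \<beta> * (r / \<beta>) ^ k"
          using Suc r \<beta> by (intro mult_left_mono) auto
        finally show ?case by simp
      qed (simp add: a_def x)
      have "a n \<le> r ^ n / \<beta> ^ n" using a_le[of n] by (simp add: power_divide)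
      also have "\<dots> \<le> r ^ n / (1/2)" using \<beta>n r \<beta> by (intro divide_left_mono) auto
      finally have upper: "a n \<le> 2 * r ^ n" by simp
      have lower: "r ^ k \<le> 2 * a k" if "k < n" for k
      proof -
        have "\<beta> ^ n \<le> \<beta> ^ k"
          using \<beta> that by (intro power_decreasing) auto
        then have "1/2 \<le> \<beta> ^ k" using \<beta>n by linarith
        then have "r ^ k * (1/2) \<le> r ^ k * \<beta> ^ k" using r by (intro mult_left_mono) auto
        also have "\<dots> = b ^ k" by (simp add: b_def power_mult_distrib)
        also have "\<dots> \<le> a k" by (rule a_ge)
        finally show ?thesis by simp
      qed
      obtain z where z: "cmod z = 1"
        and ny: "real n \<le> 4 * (hnorm H (finsum H (\<lambda>k. (cnj z / of_real r) ^ k \<odot> (N ^^ k) x) {..<n}))\<^sup>2"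
        and Ny: "hnorm H (N (finsum H (\<lambda>k. (cnj z / of_real r) ^ k \<odot> (N ^^ k) x) {..<n}) \<ominus>
          (of_real r * z) \<odot> finsum H (\<lambda>k. (cnj z / of_real r) ^ k \<odot> (N ^^ k) x) {..<n}) \<le> 3 * r"
        using geometric_eigenvector[OF N x(1) r n0] lower upper x(2) unfolding a_def by blast
      define y where "y = finsum H (\<lambda>k. (cnj z / of_real r) ^ k \<odot> (N ^^ k) x) {..<n}"
      have y: "y \<in> carrier H" unfolding y_def by (rule M.finsum_closed) auto
      have ny': "real n \<le> (2 * hnorm H y)\<^sup>2" using ny by (simp add: y_def power_mult_distrib)
      have y1: "1 \<le> 2 * hnorm H y"
      proof (rule power2_le_imp_le)
        show "1\<^sup>2 \<le> (2 * hnorm H y)\<^sup>2" using ny' n0 by simp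
      qed (use y in auto)
      have "(6 * r / e)\<^sup>2 < (2 * hnorm H y)\<^sup>2" using n ny' by linarith
      then have "6 * r / e < 2 * hnorm H y" by (rule power2_less_imp_less) (use y in auto)
      then have y2: "3 * r < e * hnorm H y" using e by (simp add: field_simps)
      have Ty: "hnorm H (residual T l y) < e * hnorm H y" if Tl: "(T, l) \<in> P" for T l
      proof -
        note Tc [simp] = bounded_ops_closed[OF T[OF Tl]]
        define w where "w = cnj z / complex_of_real r"
        have cw: "cmod w = 1 / r" using z r by (simp add: w_def norm_divide)
        define d where "d = hnorm H (residual T l x)"
        have d: "d < e1" "0 \<le> d" using Ex Tl x by (auto simp: E_def d_def)
        have Ty': "T y = finsum H (\<lambda>k. T (w ^ k \<odot> (N ^^ k) x)) {..<n}"
          unfolding y_def w_def by (rule bounded_ops_finsum[OF T[OF Tl]]) auto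
        have "residual T l y = finsum H (\<lambda>k. w ^ k \<odot> (residual T l ((N ^^ k) x))) {..<n}"
        proof (rule vec_eqI)
          fix v assume v: "v \<in> carrier H"
          have "ip H (T y) v = (\<Sum>k<n. w ^ k * ip H (T ((N ^^ k) x)) v)"
            unfolding Ty' using v by (subst ip_finsum_left) (auto simp: bounded_ops_smult[OF T[OF Tl]] ip_linear)
          moreover have "ip H y v = (\<Sum>k<n. w ^ k * ip H ((N ^^ k) x) v)"
            unfolding y_def w_def using v by (subst ip_finsum_left) (auto simp: ip_linear)
          ultimately show "ip H (residual T l y) v =
            ip H (finsum H (\<lambda>k. w ^ k \<odot> (residual T l ((N ^^ k) x))) {..<n}) v"
            using v y by (simp add: ip_finsum_left ip_linear sum_distrib_left sum_subtractf algebra_simps)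
        qed (use y in \<open>auto intro!: M.finsum_closed\<close>)
        then have "hnorm H (residual T l y) \<le>
            (\<Sum>k<n. hnorm H (w ^ k \<odot> (residual T l ((N ^^ k) x))))"
          using hnorm_finsum[of "{..<n}" "\<lambda>k. w ^ k \<odot> (residual T l ((N ^^ k) x))"] by simp
        also have "\<dots> \<le> (\<Sum>k<n. (C / r) ^ n * d)"
        proof (rule sum_mono)
          fix k assume "k \<in> {..<n}"
          have "hnorm H (w ^ k \<odot> (residual T l ((N ^^ k) x))) =
              (1 / r) ^ k * hnorm H (residual T l ((N ^^ k) x))"
            by (simp add: norm_power cw)
          also have "\<dots> \<le> (1 / r) ^ k * (C ^ k * d)"
            unfolding d_def using C x T comm Tl r
            by (intro mult_left_mono funpow_approx_bound[OF N]) auto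
          also have "\<dots> = (C / r) ^ k * d" by (simp add: power_divide)
          also have "\<dots> \<le> (C / r) ^ n * d"
            using Cr d \<open>k \<in> {..<n}\<close> by (intro mult_right_mono power_increasing) auto
          finally show "hnorm H (w ^ k \<odot> (residual T l ((N ^^ k) x))) \<le> (C / r) ^ n * d" .
        qed
        also have "\<dots> = K * d" by (simp add: K_def)
        also have "\<dots> < K * e1" using d K by simp
        also have "\<dots> \<le> K * (e / (2 * K))" using K by (intro mult_left_mono) (auto simp: e1_def)
        also have "\<dots> = e * (1/2)" using K by simp
        also have "\<dots> \<le> e * hnorm H y" using y1 e by (intro mult_left_mono) auto
        finally show ?thesis .
      qed
      have "y \<noteq> \<zero>" using y1 by auto
      then obtain v c where v: "v \<in> carrier H" "hnorm H v = 1"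
        "\<And>T l. T \<in> bounded_ops H H \<Longrightarrow> hnorm H (residual T l v) = hnorm H (residual T l y) / hnorm H y"
        using normalize_approx[OF y] by metis
      have pos: "0 < hnorm H y" using y1 by linarith
      have "E e v"
        using v T Ty pos by (auto simp: E_def pos_divide_less_eq)
      moreover have "hnorm H (residual N (of_real r * z) v) < e"
        using v(3)[OF N] Ny y2 pos unfolding y_def[symmetric] by (simp add: pos_divide_less_eq)
      ultimately show ?thesis using z by blast
    qed
    have "\<exists>zy. \<forall>m::nat. cmod (fst (zy m)) = 1 \<and> E (inverse (real (Suc m))) (snd (zy m)) \<and>
      hnorm H (N (snd (zy m)) \<ominus> (of_real r * fst (zy m)) \<odot> snd (zy m)) < inverse (real (Suc m))"
      using step by (intro choice) (metis fst_conv snd_conv inverse_positive_iff_positive of_nat_0_less_iff zero_less_Suc)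
    then obtain zy where zy: "\<And>m::nat. cmod (fst (zy m)) = 1" "\<And>m. E (inverse (real (Suc m))) (snd (zy m))"
      "\<And>m. hnorm H (N (snd (zy m)) \<ominus> (of_real r * fst (zy m)) \<odot> snd (zy m)) < inverse (real (Suc m))"
      by blast
    \<comment> \<open>The unimodular factor found so far depends on the tolerance. Compactness of
      the circle provides one limit factor that serves every tolerance.\<close>
    have "seq_compact (sphere (0::complex) 1)"
      by (intro compact_imp_seq_compact) simp
    from seq_compactE[OF this, of "\<lambda>m. fst (zy m)"]
    obtain z s where z: "z \<in> sphere (0::complex) 1" and s: "strict_mono (s :: nat \<Rightarrow> nat)"
      and lim: "((\<lambda>m. fst (zy m)) \<circ> s) \<longlonglongrightarrow> z"
      using zy(1) by auto
    have "approx_eig (insert (N, of_real r * z) P)"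
      unfolding approx_eig_def
    proof (intro allI impI)
      fix e :: real assume e: "e > 0"
      have "\<forall>\<^sub>F m in sequentially. dist (fst (zy (s m))) z < e / (2 * r)"
        using lim e r by (auto simp: tendsto_iff)
      moreover have "\<forall>\<^sub>F m in sequentially. inverse (real (Suc m)) < e / 2"
        using order_tendstoD(2)[OF LIMSEQ_inverse_real_of_nat, of "e / 2"] e by simp
      ultimately have "\<forall>\<^sub>F m in sequentially. dist (fst (zy (s m))) z < e / (2 * r) \<and> inverse (real (Suc m)) < e / 2"
        by (rule eventually_conj)
      then obtain m where m: "dist (fst (zy (s m))) z < e / (2 * r)" "inverse (real (Suc m)) < e / 2"
        by (auto simp: eventually_sequentially)
      define y where "y = snd (zy (s m))"
      define z' where "z' = fst (zy (s m))"
      have "inverse (real (Suc (s m))) \<le> inverse (real (Suc m))"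
        using seq_suble[OF s, of m] by (simp add: field_simps)
      then have sm: "inverse (real (Suc (s m))) < e / 2" using m by linarith
      have "inverse (real (Suc (s m))) \<le> e" using sm e by linarith
      then have Ey: "E e y" using zy(2)[of "s m"] E_mono unfolding y_def by blast
      then have y: "y \<in> carrier H" "hnorm H y = 1" by (auto simp: E_def)
      have "residual N (of_real r * z) y =
          (residual N (of_real r * z') y) \<oplus> (of_real r * (z' - z)) \<odot> y"
        using y by (intro vec_eqI) (auto simp: ip_linear algebra_simps)
      then have "hnorm H (residual N (of_real r * z) y) \<le>
          hnorm H (residual N (of_real r * z') y) + hnorm H ((of_real r * (z' - z)) \<odot> y)"
        using hnorm_add[of "residual N (of_real r * z') y" "(of_real r * (z' - z)) \<odot> y"] y by simp
      also have "\<dots> < e / 2 + e / 2"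
      proof (rule add_strict_mono)
        show "hnorm H (residual N (of_real r * z') y) < e / 2"
          using zy(3)[of "s m"] sm unfolding y_def z'_def by linarith
        show "hnorm H ((of_real r * (z' - z)) \<odot> y) < e / 2"
          using m(1) r y by (simp add: norm_mult z'_def dist_norm pos_less_divide_eq mult_ac)
      qed
      finally have "hnorm H (residual N (of_real r * z) y) < e" by simp
      then show "\<exists>x\<in>carrier H. hnorm H x = 1 \<and>
          (\<forall>(T, l)\<in>insert (N, of_real r * z) P. hnorm H (residual T l x) < e)"
        using Ey by (intro bexI[of _ y]) (auto simp: E_def)
    qed
    moreover have "cmod (of_real r * z) = r" using z r by (simp add: norm_mult)
    ultimately show ?thesis by blast
  qed
  then obtain \<mu> where \<mu>: "cmod \<mu> = r" "approx_eig (insert (N, \<mu>) P)" by blast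
  show ?thesis
  proof (rule that[OF \<mu>(2)])
    fix b
    assume "\<And>e. e > 0 \<Longrightarrow> \<exists>x \<in> carrier H. hnorm H x = 1 \<and>
       (\<forall>(T, l) \<in> P. hnorm H (residual T l x) < e) \<and> b \<le> hnorm H (N x)"
    then have "b \<in> B" unfolding B_def E_def by blast
    then show "b \<le> cmod \<mu>" using r_ub \<mu> by simp
  qed
qed

lemma approx_eig_extend_finite:
  assumes "finite F" and P: "approx_eig P"
    and N: "\<And>i. N i \<in> bounded_ops H H" and pn: "\<And>i. paranormal (N i)"
    and T: "\<And>T l. (T, l) \<in> P \<Longrightarrow> T \<in> bounded_ops H H"
    and comm: "\<And>T l i x. (T, l) \<in> P \<Longrightarrow> x \<in> carrier H \<Longrightarrow> T (N i x) = N i (T x)"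
    and commN: "\<And>i j x. x \<in> carrier H \<Longrightarrow> N i (N j x) = N j (N i x)"
  shows "\<exists>\<mu>. approx_eig (P \<union> (\<lambda>i. (N i, \<mu> i)) ` F)"
  using assms(1)
proof (induction F)
  case (insert i F)
  then obtain \<mu> where \<mu>: "approx_eig (P \<union> (\<lambda>i. (N i, \<mu> i)) ` F)" by blast
  obtain m where m: "approx_eig (insert (N i, m) (P \<union> (\<lambda>i. (N i, \<mu> i)) ` F))"
    by (rule approx_eig_extend[OF \<mu> N pn, of i]) (use T N comm commN in auto)
  have "(\<lambda>j. (N j, (\<mu>(i := m)) j)) ` insert i F = insert (N i, m) ((\<lambda>i. (N i, \<mu> i)) ` F)"
    using insert.hyps by auto
  then show ?case using m by (intro exI[of _ "\<mu>(i := m)"]) simp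
qed (use P in auto)

lemma approx_eig_mono: "\<lbrakk>approx_eig P; Q \<subseteq> P\<rbrakk> \<Longrightarrow> approx_eig Q"
  unfolding approx_eig_def by blast

end

section \<open>Characters from approximate eigenvectors\<close>

context inner_space
begin

lemma is_adjointD:
  assumes "is_adjoint H H T S" "x \<in> carrier H" "y \<in> carrier H"
  shows "ip H (T x) y = ip H x (S y)" "ip H (S x) y = ip H x (T y)"
proof -
  have T: "T \<in> bounded_ops H H" and S: "S \<in> bounded_ops H H"
    and eq: "\<And>x y. x \<in> carrier H \<Longrightarrow> y \<in> carrier H \<Longrightarrow> ip H (T x) y = ip H x (S y)"
    using assms(1) unfolding is_adjoint_def by auto
  show "ip H (T x) y = ip H x (S y)" using eq assms by blast
  have "ip H (S x) y = cnj (ip H y (S x))"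
    using assms bounded_ops_closed[OF S] by (intro ip_commute) auto
  also have "\<dots> = cnj (ip H (T y) x)" using eq assms by simp
  also have "\<dots> = ip H x (T y)"
    using assms bounded_ops_closed[OF T] by (intro ip_commute[symmetric]) auto
  finally show "ip H (S x) y = ip H x (T y)" .
qed

text \<open>\<open>T - c\<close> is again normal with adjoint \<open>S - cnj c\<close>, and a normal
  operator and its adjoint have the same norm on every vector.\<close>

lemma normal_adjoint_eigen_norm:
  assumes adj: "is_adjoint H H T S" and comm: "op_mult H S T = op_mult H T S" and x: "x \<in> carrier H"
  shows "hnorm H (residual S (cnj c) x) = hnorm H (residual T c x)"
proof -
  have T: "T \<in> bounded_ops H H" and S: "S \<in> bounded_ops H H"
    using adj unfolding is_adjoint_def by auto
  note [simp] = bounded_ops_closed[OF T] bounded_ops_closed[OF S]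
  have "S (T x) = T (S x)"
    using fun_cong[OF comm, of x] x by (simp add: compose_def)
  then have "ip H (S x) (S x) = ip H (T x) (T x)"
    using x by (simp add: is_adjointD[OF adj])
  then show ?thesis
    using x by (simp add: hnorm_def ip_linear is_adjointD(2)[OF adj] is_adjointD(1)[OF adj, of x x, symmetric] algebra_simps)
qed

text \<open>The squared norm of \<open>T x\<close> is \<open>ip H (S (T x)) x\<close>.
  Cauchy-Schwarz applies, and normality replaces the norm of \<open>S (T x)\<close> by that of
  \<open>T (T x)\<close>.\<close>

lemma normal_paranormal:
  assumes adj: "is_adjoint H H T S" and comm: "op_mult H S T = op_mult H T S"
  shows "paranormal T"
  unfolding paranormal_def
proof
  fix x assume x: "x \<in> carrier H"
  have T: "T \<in> bounded_ops H H" and S: "S \<in> bounded_ops H H"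
    using adj unfolding is_adjoint_def by auto
  note [simp] = bounded_ops_closed[OF T] bounded_ops_closed[OF S]
  have z: "y \<ominus> 0 \<odot> w = y" if "y \<in> carrier H" "w \<in> carrier H" for y w
    using that by (intro vec_eqI) (auto simp: ip_linear)
  have "(hnorm H (T x))\<^sup>2 = Re (ip H (S (T x)) x)"
    using x by (simp add: hnorm_sq is_adjointD(2)[OF adj])
  also have "\<dots> \<le> hnorm H (S (T x)) * hnorm H x"
    using x cauchy_schwarz[of "S (T x)" x] complex_Re_le_cmod order_trans by simp blast
  also have "hnorm H (S (T x)) = hnorm H (T (T x))"
    using normal_adjoint_eigen_norm[OF adj comm, of "T x" 0] x by (simp add: z)
  finally show "(hnorm H (T x))\<^sup>2 \<le> hnorm H (T (T x)) * hnorm H x" .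
qed

text \<open>The second condition is a form of \<open>(S\<^sup>* - c\<^sup>*) x\<^sub>k \<longrightarrow> 0\<close> that does not presuppose that \<open>S\<^sup>*\<close> exists.\<close>

definition eigval_along :: "(nat \<Rightarrow> 'v) \<Rightarrow> ('v \<Rightarrow> 'v) \<Rightarrow> complex \<Rightarrow> bool" where
  "eigval_along xs S c \<longleftrightarrow> (\<exists>e. e \<longlonglongrightarrow> (0::real) \<and>
     (\<forall>k. hnorm H (residual S c (xs k)) \<le> e k \<and>
       (\<forall>y \<in> carrier H. cmod (ip H (residual S c y) (xs k)) \<le> e k * hnorm H y)))"

text \<open>For a fixed sequence \<open>xs\<close> of unit vectors, the operators with an eigenvalue
  along \<open>xs\<close> form a C*-subalgebra on which the eigenvalue is linear and multiplicative.
  It contains the generated algebra as soon as it contains the generators, and the eigenvalue then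
  restricts to a character.\<close>

context
  fixes xs :: "nat \<Rightarrow> 'v"
  assumes xs: "\<And>k. xs k \<in> carrier H" "\<And>k. hnorm H (xs k) = 1"
begin

text \<open>With \<open>S = T\<close> and \<open>\<delta> = 0\<close> this is uniqueness of the
  eigenvalue; for a sequence of operators converging in norm it makes the eigenvalues a Cauchy
  sequence.\<close>

lemma eigval_along_dist:
  assumes S: "S \<in> bounded_ops H H" and T: "T \<in> bounded_ops H H"
    and c: "eigval_along xs S c" and d: "eigval_along xs T d"
    and diff: "\<And>x. x \<in> carrier H \<Longrightarrow> hnorm H (S x \<ominus> T x) \<le> \<delta> * hnorm H x"
  shows "cmod (c - d) \<le> \<delta>"
proof -
  note [simp] = bounded_ops_closed[OF S] bounded_ops_closed[OF T] xs
  obtain e where e: "e \<longlonglongrightarrow> 0" "\<And>k. hnorm H (residual S c (xs k)) \<le> e k"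
    using c unfolding eigval_along_def by blast
  obtain f where f: "f \<longlonglongrightarrow> 0" "\<And>k. hnorm H (residual T d (xs k)) \<le> f k"
    using d unfolding eigval_along_def by blast
  have "cmod (c - d) \<le> \<delta> + (e k + f k)" for k
  proof -
    have "(c - d) \<odot> xs k = (S (xs k) \<ominus> T (xs k)) \<oplus>
        ((residual T d (xs k)) \<ominus> (residual S c (xs k)))"
      by (intro vec_eqI) (auto simp: ip_linear algebra_simps)
    then have "cmod (c - d) = hnorm H ((S (xs k) \<ominus> T (xs k)) \<oplus>
        ((residual T d (xs k)) \<ominus> (residual S c (xs k))))"
      using hnorm_smult[of "xs k" "c - d"] by simp
    also have "\<dots> \<le> hnorm H (S (xs k) \<ominus> T (xs k)) + hnorm H ((residual T d (xs k)) \<ominus> (residual S c (xs k)))"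
      by (rule hnorm_add) auto
    also have "hnorm H ((residual T d (xs k)) \<ominus> (residual S c (xs k))) \<le>
        hnorm H (residual T d (xs k)) + hnorm H (residual S c (xs k))"
      by (rule hnorm_minus) auto
    finally show ?thesis
      using diff[of "xs k"] e(2)[of k] f(2)[of k] by simp
  qed
  moreover have "(\<lambda>k. \<delta> + (e k + f k)) \<longlonglongrightarrow> \<delta> + (0 + 0)"
    using e f by (intro tendsto_intros)
  ultimately show ?thesis
    using LIMSEQ_le_const[of "\<lambda>k. \<delta> + (e k + f k)" \<delta> "cmod (c - d)"] by auto
qed

lemma eigval_along_unique:
  assumes "S \<in> bounded_ops H H" "eigval_along xs S c" "eigval_along xs S d"
  shows "c = d"
proof -
  have "hnorm H (S x \<ominus> S x) \<le> 0 * hnorm H x" if "x \<in> carrier H" for x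
    using that bounded_ops_closed[OF assms(1)] by (simp add: a_minus_def M.r_neg)
  then show ?thesis
    using eigval_along_dist[OF assms(1,1,2,3), of 0] by simp
qed

lemma eigval_along_one: "eigval_along xs (op_one H) 1"
proof -
  have eq: "x \<ominus> 1 \<odot> x = \<zero>" if "x \<in> carrier H" for x
    using that by (intro vec_eqI) (auto simp: ip_linear)
  show ?thesis
    using xs unfolding eigval_along_def by (intro exI[of _ "\<lambda>_. 0"]) (auto simp: op_one_def eq)
qed

lemma eigval_along_add:
  assumes S: "S \<in> bounded_ops H H" and T: "T \<in> bounded_ops H H"
    and c: "eigval_along xs S c" and d: "eigval_along xs T d"
  shows "eigval_along xs (op_add H S T) (c + d)"
proof -
  note [simp] = bounded_ops_closed[OF S] bounded_ops_closed[OF T] xs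
  obtain e where e: "e \<longlonglongrightarrow> 0" "\<And>k. hnorm H (residual S c (xs k)) \<le> e k"
    "\<And>k y. y \<in> carrier H \<Longrightarrow> cmod (ip H (residual S c y) (xs k)) \<le> e k * hnorm H y"
    using c unfolding eigval_along_def by blast
  obtain f where f: "f \<longlonglongrightarrow> 0" "\<And>k. hnorm H (residual T d (xs k)) \<le> f k"
    "\<And>k y. y \<in> carrier H \<Longrightarrow> cmod (ip H (residual T d y) (xs k)) \<le> f k * hnorm H y"
    using d unfolding eigval_along_def by blast
  have eq: "residual (op_add H S T) (c + d) y = (residual S c y) \<oplus> (residual T d y)"
    if "y \<in> carrier H" for y
    using that by (intro vec_eqI) (auto simp: op_add_def ip_linear algebra_simps)
  have "(\<lambda>k. e k + f k) \<longlonglongrightarrow> 0 + 0" using e f by (intro tendsto_intros)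
  moreover have "hnorm H (residual (op_add H S T) (c + d) (xs k)) \<le> e k + f k" for k
    using e(2)[of k] f(2)[of k] hnorm_add[of "residual S c (xs k)" "residual T d (xs k)"]
    by (simp add: eq)
  moreover have "cmod (ip H (residual (op_add H S T) (c + d) y) (xs k)) \<le> (e k + f k) * hnorm H y"
    if y: "y \<in> carrier H" for y k
  proof -
    have "ip H (residual (op_add H S T) (c + d) y) (xs k) =
        ip H (residual S c y) (xs k) + ip H (residual T d y) (xs k)"
      using y by (simp add: eq ip_add_left)
    then show ?thesis
      using e(3)[OF y, of k] f(3)[OF y, of k]
        norm_triangle_ineq[of "ip H (residual S c y) (xs k)" "ip H (residual T d y) (xs k)"]
      by (simp add: distrib_right)
  qed
  ultimately show ?thesis
    unfolding eigval_along_def by (intro exI[of _ "\<lambda>k. e k + f k"]) auto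
qed

lemma eigval_along_scale:
  assumes T: "T \<in> bounded_ops H H" and d: "eigval_along xs T d"
  shows "eigval_along xs (op_scale H a T) (a * d)"
proof -
  note [simp] = bounded_ops_closed[OF T] xs
  obtain f where f: "f \<longlonglongrightarrow> 0" "\<And>k. hnorm H (residual T d (xs k)) \<le> f k"
    "\<And>k y. y \<in> carrier H \<Longrightarrow> cmod (ip H (residual T d y) (xs k)) \<le> f k * hnorm H y"
    using d unfolding eigval_along_def by blast
  have eq: "residual (op_scale H a T) (a * d) y = a \<odot> (residual T d y)"
    if "y \<in> carrier H" for y
    using that by (intro vec_eqI) (auto simp: op_scale_def ip_linear algebra_simps)
  have "(\<lambda>k. cmod a * f k) \<longlonglongrightarrow> cmod a * 0" using f by (intro tendsto_intros)
  moreover have "hnorm H (residual (op_scale H a T) (a * d) (xs k)) \<le> cmod a * f k" for k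
    using f(2)[of k] by (simp add: eq mult_left_mono)
  moreover have "cmod (ip H (residual (op_scale H a T) (a * d) y) (xs k)) \<le> (cmod a * f k) * hnorm H y"
    if y: "y \<in> carrier H" for y k
    using f(3)[OF y, of k] y by (simp add: eq ip_smult_left norm_mult mult.assoc mult_left_mono)
  ultimately show ?thesis
    unfolding eigval_along_def by (intro exI[of _ "\<lambda>k. cmod a * f k"]) auto
qed

text \<open>\<open>ST - cd\<close> is split as \<open>S (T - d) + d (S - c)\<close> for the norm at
  \<open>xs k\<close>, where the residuals have to act first, and as
  \<open>(S - c) T + c (T - d)\<close> for the functional, where they have to act last.\<close>

lemma eigval_along_mult:
  assumes S: "S \<in> bounded_ops H H" and T: "T \<in> bounded_ops H H"
    and c: "eigval_along xs S c" and d: "eigval_along xs T d"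
  shows "eigval_along xs (op_mult H S T) (c * d)"
proof -
  note [simp] = bounded_ops_closed[OF S] bounded_ops_closed[OF T] xs
  obtain e where e: "e \<longlonglongrightarrow> 0" "\<And>k. hnorm H (residual S c (xs k)) \<le> e k"
    "\<And>k y. y \<in> carrier H \<Longrightarrow> cmod (ip H (residual S c y) (xs k)) \<le> e k * hnorm H y"
    using c unfolding eigval_along_def by blast
  obtain f where f: "f \<longlonglongrightarrow> 0" "\<And>k. hnorm H (residual T d (xs k)) \<le> f k"
    "\<And>k y. y \<in> carrier H \<Longrightarrow> cmod (ip H (residual T d y) (xs k)) \<le> f k * hnorm H y"
    using d unfolding eigval_along_def by blast
  obtain A where A: "1 \<le> A" "\<And>x. x \<in> carrier H \<Longrightarrow> hnorm H (S x) \<le> A * hnorm H x"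
    using bounded_ops_bound[OF S] by blast
  obtain B where B: "1 \<le> B" "\<And>x. x \<in> carrier H \<Longrightarrow> hnorm H (T x) \<le> B * hnorm H x"
    using bounded_ops_bound[OF T] by blast
  have e0: "0 \<le> e k" for k by (rule order_trans[OF hnorm_nonneg e(2)]) simp
  have f0: "0 \<le> f k" for k by (rule order_trans[OF hnorm_nonneg f(2)]) simp
  define g where "g k = (A * f k + cmod d * e k) + (B * e k + cmod c * f k)" for k
  have "g \<longlonglongrightarrow> (A * 0 + cmod d * 0) + (B * 0 + cmod c * 0)"
    unfolding g_def using e f by (intro tendsto_intros)
  moreover have "hnorm H (residual (op_mult H S T) (c * d) (xs k)) \<le> g k" for k
  proof -
    have "residual (op_mult H S T) (c * d) (xs k) =
        S (residual T d (xs k)) \<oplus> d \<odot> (residual S c (xs k))"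
      by (intro vec_eqI) (auto simp: compose_def bounded_ops_minus[OF S] bounded_ops_smult[OF S] ip_linear algebra_simps)
    then have "hnorm H (residual (op_mult H S T) (c * d) (xs k)) \<le>
        hnorm H (S (residual T d (xs k))) + cmod d * hnorm H (residual S c (xs k))"
      using hnorm_add[of "S (residual T d (xs k))" "d \<odot> (residual S c (xs k))"] by simp
    also have "\<dots> \<le> A * f k + cmod d * e k"
    proof (rule add_mono)
      have "hnorm H (S (residual T d (xs k))) \<le> A * hnorm H (residual T d (xs k))"
        by (intro A(2)) auto
      also have "\<dots> \<le> A * f k" using A(1) f(2) by (intro mult_left_mono) auto
      finally show "hnorm H (S (residual T d (xs k))) \<le> A * f k" .
      show "cmod d * hnorm H (residual S c (xs k)) \<le> cmod d * e k"
        using e(2) by (intro mult_left_mono) auto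
    qed
    also have "\<dots> \<le> g k" unfolding g_def using e0 f0 B(1) by simp
    finally show ?thesis .
  qed
  moreover have "cmod (ip H (residual (op_mult H S T) (c * d) y) (xs k)) \<le> g k * hnorm H y"
    if y: "y \<in> carrier H" for y k
  proof -
    have "ip H (residual (op_mult H S T) (c * d) y) (xs k) =
        ip H (S (T y) \<ominus> c \<odot> T y) (xs k) + c * ip H (residual T d y) (xs k)"
      using y by (simp add: compose_def ip_linear algebra_simps)
    then have "cmod (ip H (residual (op_mult H S T) (c * d) y) (xs k)) \<le>
        cmod (ip H (S (T y) \<ominus> c \<odot> T y) (xs k)) + cmod c * cmod (ip H (residual T d y) (xs k))"
      using norm_triangle_ineq[of "ip H (S (T y) \<ominus> c \<odot> T y) (xs k)" "c * ip H (residual T d y) (xs k)"]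
      by (simp add: norm_mult)
    also have "\<dots> \<le> e k * (B * hnorm H y) + cmod c * (f k * hnorm H y)"
    proof (rule add_mono)
      have "cmod (ip H (S (T y) \<ominus> c \<odot> T y) (xs k)) \<le> e k * hnorm H (T y)"
        using y by (intro e(3)) auto
      also have "\<dots> \<le> e k * (B * hnorm H y)" using e0 B(2)[OF y] by (intro mult_left_mono) auto
      finally show "cmod (ip H (S (T y) \<ominus> c \<odot> T y) (xs k)) \<le> e k * (B * hnorm H y)" .
      show "cmod c * cmod (ip H (residual T d y) (xs k)) \<le> cmod c * (f k * hnorm H y)"
        using f(3)[OF y] by (intro mult_left_mono) auto
    qed
    also have "\<dots> = (B * e k + cmod c * f k) * hnorm H y" by (simp add: algebra_simps)
    also have "\<dots> \<le> g k * hnorm H y"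
      unfolding g_def using e0 f0 A(1) y by (intro mult_right_mono) auto
    finally show ?thesis .
  qed
  ultimately show ?thesis
    unfolding eigval_along_def by (intro exI[of _ g]) auto
qed

text \<open>Passing to the adjoint exchanges the two conditions in
  \<open>eigval_along\<close>.\<close>

lemma eigval_along_adjoint:
  assumes adj: "is_adjoint H H T S" and d: "eigval_along xs T d"
  shows "eigval_along xs S (cnj d)"
proof -
  have T: "T \<in> bounded_ops H H" and S: "S \<in> bounded_ops H H"
    using adj unfolding is_adjoint_def by auto
  note [simp] = bounded_ops_closed[OF T] bounded_ops_closed[OF S] xs
  obtain f where f: "f \<longlonglongrightarrow> 0" "\<And>k. hnorm H (residual T d (xs k)) \<le> f k"
    "\<And>k y. y \<in> carrier H \<Longrightarrow> cmod (ip H (residual T d y) (xs k)) \<le> f k * hnorm H y"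
    using d unfolding eigval_along_def by blast
  have f0: "0 \<le> f k" for k by (rule order_trans[OF hnorm_nonneg f(2)]) simp
  have "hnorm H (residual S (cnj d) (xs k)) \<le> f k" for k
  proof -
    \<comment> \<open>Testing the functional with the residual itself bounds its squared norm by
      \<open>f k\<close> times its norm.\<close>
    define v where "v = residual S (cnj d) (xs k)"
    have v: "v \<in> carrier H" by (auto simp: v_def)
    have "ip H (residual T d v) (xs k) = ip H v (residual S (cnj d) (xs k))"
      using v by (simp add: ip_linear is_adjointD(1)[OF adj])
    then have "ip H (residual T d v) (xs k) = complex_of_real ((hnorm H v)\<^sup>2)"
      using v by (simp add: ip_self flip: v_def)
    then have "hnorm H v * hnorm H v \<le> f k * hnorm H v"
      using f(3)[OF v, of k] by (simp add: power2_eq_square norm_mult v)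
    then show ?thesis
      using hnorm_nonneg[OF v] f0[of k] unfolding v_def[symmetric]
      by (cases "hnorm H v = 0") auto
  qed
  moreover have "cmod (ip H (residual S (cnj d) y) (xs k)) \<le> f k * hnorm H y" if y: "y \<in> carrier H" for y k
  proof -
    have "ip H (residual S (cnj d) y) (xs k) = ip H y (residual T d (xs k))"
      using y by (simp add: ip_linear is_adjointD(2)[OF adj])
    then have "cmod (ip H (residual S (cnj d) y) (xs k)) \<le> hnorm H y * hnorm H (residual T d (xs k))"
      using cauchy_schwarz[of y "residual T d (xs k)"] y by simp
    also have "\<dots> \<le> hnorm H y * f k" using f(2) y by (intro mult_left_mono) auto
    finally show ?thesis by (simp add: mult.commute)
  qed
  ultimately show ?thesis
    unfolding eigval_along_def using f(1) by (intro exI[of _ f]) auto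
qed

lemma eigval_along_closed:
  assumes T: "T \<in> bounded_ops H H"
    and approx: "\<And>e. e > 0 \<Longrightarrow> \<exists>S \<in> bounded_ops H H. (\<exists>c. eigval_along xs S c) \<and> op_norm H (op_diff H S T) < e"
  shows "\<exists>c. eigval_along xs T c"
proof -
  define \<delta> where "\<delta> m = inverse (real (Suc m))" for m
  have \<delta>: "\<And>m. \<delta> m > 0" "\<delta> \<longlonglongrightarrow> 0"
    using LIMSEQ_inverse_real_of_nat unfolding \<delta>_def by simp_all
  have "\<forall>m. \<exists>S. S \<in> bounded_ops H H \<and> (\<exists>c. eigval_along xs S c) \<and> op_norm H (op_diff H S T) < \<delta> m"
    using approx \<delta> by blast
  then obtain S where S: "\<And>m. S m \<in> bounded_ops H H" "\<And>m. \<exists>c. eigval_along xs (S m) c"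
    "\<And>m. op_norm H (op_diff H (S m) T) < \<delta> m" by metis
  obtain c where c: "\<And>m. eigval_along xs (S m) (c m)" using S(2) by metis
  note [simp] = bounded_ops_closed[OF T] bounded_ops_closed[OF S(1)] xs
  have ST: "hnorm H (S m x \<ominus> T x) \<le> \<delta> m * hnorm H x" if x: "x \<in> carrier H" for m x
  proof -
    have "hnorm H (op_diff H (S m) T x) \<le> op_norm H (op_diff H (S m) T) * hnorm H x"
      using S(1) T x by (intro op_norm_bound op_diff_bounded)
    also have "\<dots> \<le> \<delta> m * hnorm H x" using S(3)[of m] x by (intro mult_right_mono) auto
    finally show ?thesis using x by (simp add: op_diff_def)
  qed
  have dist: "cmod (c m - c l) \<le> \<delta> m + \<delta> l" for m l
  proof (rule eigval_along_dist[OF S(1) S(1) c c])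
    fix x assume x: "x \<in> carrier H"
    have "S m x \<ominus> S l x = (S m x \<ominus> T x) \<ominus> (S l x \<ominus> T x)"
      using x by (intro vec_eqI) (auto simp: ip_linear)
    then have "hnorm H (S m x \<ominus> S l x) \<le> hnorm H (S m x \<ominus> T x) + hnorm H (S l x \<ominus> T x)"
      using hnorm_minus[of "S m x \<ominus> T x" "S l x \<ominus> T x"] x by simp
    also have "\<dots> \<le> (\<delta> m + \<delta> l) * hnorm H x"
      using ST[OF x, of m] ST[OF x, of l] by (simp add: distrib_right)
    finally show "hnorm H (S m x \<ominus> S l x) \<le> (\<delta> m + \<delta> l) * hnorm H x" .
  qed
  have "Cauchy c"
  proof (rule CauchyI)
    fix e :: real assume e: "0 < e"
    have "\<forall>\<^sub>F m in sequentially. \<delta> m < e / 2"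
      using order_tendstoD(2)[OF \<delta>(2), of "e / 2"] e by simp
    then obtain M where M: "\<And>m. m \<ge> M \<Longrightarrow> \<delta> m < e / 2" by (auto simp: eventually_sequentially)
    show "\<exists>M. \<forall>m\<ge>M. \<forall>n\<ge>M. norm (c m - c n) < e"
    proof (intro exI[of _ M] allI impI)
      fix m n assume "M \<le> m" "M \<le> n"
      then show "norm (c m - c n) < e" using dist[of m n] M[of m] M[of n] by linarith
    qed
  qed
  then obtain d where d: "c \<longlonglongrightarrow> d" by (auto simp: Cauchy_convergent_iff convergent_def)
  have "\<forall>m. \<exists>e. e \<longlonglongrightarrow> 0 \<and> (\<forall>k. hnorm H (residual (S m) (c m) (xs k)) \<le> e k \<and>
       (\<forall>y \<in> carrier H. cmod (ip H (residual (S m) (c m) y) (xs k)) \<le> e k * hnorm H y))"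
    using c unfolding eigval_along_def by blast
  then obtain e where "\<forall>m. e m \<longlonglongrightarrow> 0 \<and> (\<forall>k. hnorm H (residual (S m) (c m) (xs k)) \<le> e m k \<and>
       (\<forall>y \<in> carrier H. cmod (ip H (residual (S m) (c m) y) (xs k)) \<le> e m k * hnorm H y))"
    by (rule choice[THEN exE])
  then have e: "\<And>m. e m \<longlonglongrightarrow> 0"
    "\<And>m k. hnorm H (residual (S m) (c m) (xs k)) \<le> e m k"
    "\<And>m k y. y \<in> carrier H \<Longrightarrow> cmod (ip H (residual (S m) (c m) y) (xs k)) \<le> e m k * hnorm H y"
    by auto
  have e0: "0 \<le> e m k" for m k by (rule order_trans[OF hnorm_nonneg e(2)]) simp
  define g where "g m k = \<delta> m + e m k + cmod (c m - d)" for m k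
  have g0: "0 \<le> g m k" for m k
    unfolding g_def using e0[of m k] \<delta>(1)[of m] by simp
  \<comment> \<open>Every approximant \<open>S m\<close> gives the error bound \<open>g m k\<close>.
    The infimum over \<open>m\<close> tends to 0: some \<open>m\<close> makes the two terms free of
    \<open>k\<close> small, and \<open>e m k\<close> tends to 0 for that \<open>m\<close>.\<close>
  define h where "h k = (INF m. g m k)" for k
  have bdd: "bdd_below (range (\<lambda>m. g m k))" for k using g0 by (intro bdd_belowI2[of _ 0])
  have dec: "residual T d y = ((residual (S m) (c m) y) \<ominus> (S m y \<ominus> T y)) \<oplus> (c m - d) \<odot> y"
    if "y \<in> carrier H" for y m
    using that by (intro vec_eqI) (auto simp: ip_linear algebra_simps)
  have "hnorm H (residual T d (xs k)) \<le> g m k" for m k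
  proof -
    have "hnorm H (residual T d (xs k)) \<le>
        hnorm H ((residual (S m) (c m) (xs k)) \<ominus> (S m (xs k) \<ominus> T (xs k))) + hnorm H ((c m - d) \<odot> xs k)"
      unfolding dec[OF xs(1), of _ m] by (rule hnorm_add) auto
    also have "hnorm H ((residual (S m) (c m) (xs k)) \<ominus> (S m (xs k) \<ominus> T (xs k))) \<le>
        hnorm H (residual (S m) (c m) (xs k)) + hnorm H (S m (xs k) \<ominus> T (xs k))"
      by (rule hnorm_minus) auto
    finally show ?thesis
      unfolding g_def using e(2)[of m k] ST[of "xs k" m] by simp
  qed
  then have 1: "hnorm H (residual T d (xs k)) \<le> h k" for k
    unfolding h_def by (intro cINF_greatest) auto
  have ipT: "cmod (ip H (residual T d y) (xs k)) \<le> g m k * hnorm H y" if y: "y \<in> carrier H" for m k y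
  proof -
    have "ip H (residual T d y) (xs k) =
        (ip H (residual (S m) (c m) y) (xs k) - ip H (S m y \<ominus> T y) (xs k)) + (c m - d) * ip H y (xs k)"
      using y by (simp add: ip_linear algebra_simps)
    then have "cmod (ip H (residual T d y) (xs k)) \<le>
        (cmod (ip H (residual (S m) (c m) y) (xs k)) + cmod (ip H (S m y \<ominus> T y) (xs k))) + cmod (c m - d) * cmod (ip H y (xs k))"
      using norm_triangle_ineq[of "ip H (residual (S m) (c m) y) (xs k) - ip H (S m y \<ominus> T y) (xs k)" "(c m - d) * ip H y (xs k)"]
        norm_triangle_ineq4[of "ip H (residual (S m) (c m) y) (xs k)" "ip H (S m y \<ominus> T y) (xs k)"]
      by (simp only: norm_mult)
    also have "\<dots> \<le> (e m k * hnorm H y + \<delta> m * hnorm H y) + cmod (c m - d) * hnorm H y"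
    proof (intro add_mono mult_left_mono)
      show "cmod (ip H (S m y \<ominus> T y) (xs k)) \<le> \<delta> m * hnorm H y"
        using cauchy_schwarz[of "S m y \<ominus> T y" "xs k"] ST[OF y, of m] y by simp
      show "cmod (ip H y (xs k)) \<le> hnorm H y"
        using cauchy_schwarz[of y "xs k"] y by simp
    qed (use e(3)[OF y] in auto)
    finally show ?thesis by (simp add: g_def algebra_simps)
  qed
  have 2: "cmod (ip H (residual T d y) (xs k)) \<le> h k * hnorm H y" if y: "y \<in> carrier H" for k y
  proof (cases "hnorm H y = 0")
    case True
    then show ?thesis using ipT[OF y, of k 0] by simp
  next
    case False
    then have pos: "0 < hnorm H y" using hnorm_nonneg[OF y] by linarith
    have "cmod (ip H (residual T d y) (xs k)) / hnorm H y \<le> h k"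
      unfolding h_def using ipT[OF y, of k] pos by (intro cINF_greatest) (auto simp: pos_divide_le_eq)
    then show ?thesis using pos by (simp add: pos_divide_le_eq)
  qed
  have "h \<longlonglongrightarrow> 0"
  proof (rule tendstoI)
    fix \<epsilon> :: real assume \<epsilon>: "0 < \<epsilon>"
    have "(\<lambda>m. \<delta> m + cmod (c m - d)) \<longlonglongrightarrow> 0 + cmod (d - d)"
      using \<delta>(2) d by (intro tendsto_intros)
    then have "\<forall>\<^sub>F m in sequentially. \<delta> m + cmod (c m - d) < \<epsilon> / 2"
      by (rule order_tendstoD(2)) (use \<epsilon> in simp)
    then obtain m where m: "\<delta> m + cmod (c m - d) < \<epsilon> / 2" by (auto simp: eventually_sequentially)
    have "\<forall>\<^sub>F k in sequentially. e m k < \<epsilon> / 2"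
      by (rule order_tendstoD(2)[OF e(1)]) (use \<epsilon> in simp)
    then show "\<forall>\<^sub>F k in sequentially. dist (h k) 0 < \<epsilon>"
    proof eventually_elim
      case (elim k)
      have "h k \<le> g m k" unfolding h_def using bdd by (intro cINF_lower) auto
      moreover have "0 \<le> h k" unfolding h_def using g0 by (intro cINF_greatest) auto
      ultimately show ?case using elim m by (simp add: g_def)
    qed
  qed
  then show ?thesis
    unfolding eigval_along_def using 1 2 by (intro exI[of _ d] exI[of _ h]) auto
qed

lemma cstar_subalgebra_eigval_along:
  "cstar_subalgebra H {S \<in> bounded_ops H H. \<exists>c. eigval_along xs S c}"
proof -
  have "\<exists>c. eigval_along xs T c" if T: "T \<in> bounded_ops H H"
    and lim: "\<forall>e>0. \<exists>S \<in> {S \<in> bounded_ops H H. \<exists>c. eigval_along xs S c}. op_norm H (op_diff H S T) < e" for T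
  proof (rule eigval_along_closed[OF T])
    fix e :: real assume "e > 0"
    with lim obtain S where "S \<in> {S \<in> bounded_ops H H. \<exists>c. eigval_along xs S c}"
      "op_norm H (op_diff H S T) < e" by blast
    then show "\<exists>S \<in> bounded_ops H H. (\<exists>c. eigval_along xs S c) \<and> op_norm H (op_diff H S T) < e"
      by (intro bexI[of _ S]) simp_all
  qed
  moreover have "S \<in> bounded_ops H H" if "is_adjoint H H T S" for S T
    using that unfolding is_adjoint_def by blast
  ultimately show ?thesis
    unfolding cstar_subalgebra_def
    by (intro conjI ballI allI impI; clarsimp simp: op_one_bounded op_add_bounded op_scale_bounded op_mult_bounded)
      (metis eigval_along_one eigval_along_add eigval_along_scale eigval_along_mult eigval_along_adjoint)+
qed

end

text \<open>The character is the eigenvalue along a sequence of joint approximate eigenvectors.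
  Normality supplies the second condition in \<open>eigval_along\<close>, because the residuals of
  the adjoint have the same norms.\<close>

lemma joint_spectrum_approx_eig:
  fixes N :: "'d::finite \<Rightarrow> 'v \<Rightarrow> 'v"
  assumes nt: "normal_tuple H N" and ae: "approx_eig (range (\<lambda>i. (N i, \<mu> i)))"
  shows "(\<chi> i. \<mu> i) \<in> joint_spectrum H N"
proof -
  have N: "N i \<in> bounded_ops H H" for i using nt unfolding normal_tuple_def by blast
  have "\<forall>k. \<exists>x \<in> carrier H. hnorm H x = 1 \<and> (\<forall>i. hnorm H (residual (N i) (\<mu> i) x) < inverse (real (Suc k)))"
  proof
    fix k
    have "inverse (real (Suc k)) > 0" by simp
    then show "\<exists>x \<in> carrier H. hnorm H x = 1 \<and> (\<forall>i. hnorm H (residual (N i) (\<mu> i) x) < inverse (real (Suc k)))"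
      using ae unfolding approx_eig_def by fastforce
  qed
  then obtain xs where xs: "\<And>k. xs k \<in> carrier H" "\<And>k. hnorm H (xs k) = 1"
    "\<And>i k. hnorm H (residual (N i) (\<mu> i) (xs k)) < inverse (real (Suc k))" by metis
  define \<B> where "\<B> = {S \<in> bounded_ops H H. \<exists>c. eigval_along xs S c}"
  have B: "cstar_subalgebra H \<B>"
    unfolding \<B>_def using xs(1,2) by (rule cstar_subalgebra_eigval_along)
  have eN: "eigval_along xs (N i) (\<mu> i)" for i
  proof -
    obtain S where adj: "is_adjoint H H (N i) S" and comm: "op_mult H S (N i) = op_mult H (N i) S"
      using nt unfolding normal_tuple_def by blast
    have S: "S \<in> bounded_ops H H" using adj unfolding is_adjoint_def by blast
    note [simp] = bounded_ops_closed[OF S] bounded_ops_closed[OF N]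
    have "cmod (ip H (residual (N i) (\<mu> i) y) (xs k)) \<le> inverse (real (Suc k)) * hnorm H y"
      if y: "y \<in> carrier H" for y k
    proof -
      have "ip H (residual (N i) (\<mu> i) y) (xs k) = ip H y (residual S (cnj (\<mu> i)) (xs k))"
        using y xs(1) by (simp add: ip_linear is_adjointD(1)[OF adj])
      then have "cmod (ip H (residual (N i) (\<mu> i) y) (xs k)) \<le> hnorm H y * hnorm H (residual (N i) (\<mu> i) (xs k))"
        using cauchy_schwarz[of y "residual S (cnj (\<mu> i)) (xs k)"] y xs(1)
        by (simp add: normal_adjoint_eigen_norm[OF adj comm])
      also have "\<dots> \<le> hnorm H y * inverse (real (Suc k))"
        using xs(3)[of i k] y by (intro mult_left_mono) auto
      finally show ?thesis by (simp add: mult.commute)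
    qed
    then show ?thesis
      unfolding eigval_along_def using xs(3)[of i] LIMSEQ_inverse_real_of_nat
      by (intro exI[of _ "\<lambda>k. inverse (real (Suc k))"]) (auto intro: less_imp_le)
  qed
  define \<phi> where "\<phi> S = (THE c. eigval_along xs S c)" for S
  have phi: "\<phi> S = c" if "S \<in> bounded_ops H H" "eigval_along xs S c" for S c
    unfolding \<phi>_def using that eigval_along_unique[OF xs(1,2)] by (intro the_equality) auto
  have sub: "cstar_generated H N \<subseteq> \<B>"
    using B N eN unfolding cstar_generated_def \<B>_def by blast
  have "character H (cstar_generated H N) \<phi>"
    unfolding character_def linear_functional_on_def
  proof (intro conjI ballI allI)
    fix S T assume "S \<in> cstar_generated H N" "T \<in> cstar_generated H N"
    then have ST: "S \<in> bounded_ops H H" "T \<in> bounded_ops H H"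
      and "\<exists>c. eigval_along xs S c" "\<exists>d. eigval_along xs T d"
      using sub unfolding \<B>_def by auto
    then obtain c d where c: "eigval_along xs S c" and d: "eigval_along xs T d" by blast
    show "\<phi> (op_add H S T) = \<phi> S + \<phi> T"
      using ST c d by (simp add: phi op_add_bounded eigval_along_add[OF xs(1,2)])
    show "\<phi> (op_mult H S T) = \<phi> S * \<phi> T"
      using ST c d by (simp add: phi op_mult_bounded eigval_along_mult[OF xs(1,2)])
  next
    fix a T assume "T \<in> cstar_generated H N"
    then have T: "T \<in> bounded_ops H H" and "\<exists>d. eigval_along xs T d"
      using sub unfolding \<B>_def by auto
    then obtain d where d: "eigval_along xs T d" by blast
    show "\<phi> (op_scale H a T) = a * \<phi> T"
      using T d by (simp add: phi op_scale_bounded eigval_along_scale[OF xs(1,2)])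
  next
    show "\<phi> (op_one H) = 1"
      by (rule phi[OF op_one_bounded eigval_along_one[OF xs(1,2)]])
  qed
  moreover have "\<phi> (N i) = \<mu> i" for i using phi N eN by blast
  ultimately show ?thesis
    unfolding joint_spectrum_def by (intro CollectI exI[of _ \<phi>]) auto
qed

end

section \<open>Normal tuples with real joint spectrum\<close>

context inner_space
begin

lemma approx_eig_empty:
  assumes "x \<in> carrier H" "x \<noteq> \<zero>" shows "approx_eig {}"
  using normalize_approx[OF assms] unfolding approx_eig_def by (metis empty_iff)

text \<open>Extending the empty family puts no constraint on the unit vectors tested, so the
  maximality of the new eigenvalue compares it with the norm of \<open>T\<close> at the normalised
  \<open>x\<close>. In this way bounds on approximate eigenvalues become bounds on norms.\<close>

lemma approx_eig_norm:
  assumes T: "T \<in> bounded_ops H H" and pn: "paranormal T" and x: "x \<in> carrier H" "x \<noteq> \<zero>"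
  obtains l where "approx_eig {(T, l)}" "hnorm H (T x) \<le> cmod l * hnorm H x"
proof -
  obtain u where u: "u \<in> carrier H" "hnorm H u = 1" "hnorm H (T u) = hnorm H (T x) / hnorm H x"
    using normalize_approx[OF x] T by metis
  obtain l where l: "approx_eig {(T, l)}"
    "\<And>b. (\<And>e. e > 0 \<Longrightarrow> \<exists>x \<in> carrier H. hnorm H x = 1 \<and>
       (\<forall>(T, l) \<in> {}. hnorm H (residual T l x) < e) \<and> b \<le> hnorm H (T x)) \<Longrightarrow> b \<le> cmod l"
    by (rule approx_eig_extend[OF approx_eig_empty[OF x] T pn]) auto
  have "hnorm H (T u) \<le> cmod l"
    by (rule l(2)) (use u(1,2) in \<open>auto intro!: bexI[of _ u]\<close>)
  then show ?thesis
    using that[OF l(1)] u(3) hnorm_pos[OF x] by (simp add: pos_divide_le_eq)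
qed

text \<open>At a common approximate eigenvector the numbers \<open>ip H (T x) x\<close> are close to
  the eigenvalues, so linear relations between the operators pass to the eigenvalues.\<close>

lemma approx_eig_ip:
  assumes P: "approx_eig P" and e: "e > 0" and T: "\<And>T l. (T, l) \<in> P \<Longrightarrow> T \<in> bounded_ops H H"
  obtains x where "x \<in> carrier H" "hnorm H x = 1" "\<forall>(T, l) \<in> P. cmod (ip H (T x) x - l) < e"
proof -
  obtain x where x: "x \<in> carrier H" "hnorm H x = 1" "\<forall>(T, l) \<in> P. hnorm H (residual T l x) < e"
    using P[unfolded approx_eig_def, rule_format, OF e] by (elim bexE conjE)
  have "cmod (ip H (T x) x - l) < e" if Tl: "(T, l) \<in> P" for T l
  proof -
    note [simp] = bounded_ops_closed[OF T[OF Tl]]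
    have "ip H (T x) x - l = ip H (residual T l x) x"
      using x by (simp add: ip_linear ip_self)
    then have "cmod (ip H (T x) x - l) \<le> hnorm H (residual T l x) * hnorm H x"
      using cauchy_schwarz[of "residual T l x" x] x by simp
    then show ?thesis using x(2) bspec[OF x(3) Tl] by simp
  qed
  then have "\<forall>(T, l) \<in> P. cmod (ip H (T x) x - l) < e" by auto
  then show ?thesis by (rule that[OF x(1,2)])
qed

lemma joint_spectrum_extend:
  fixes N :: "'d::finite \<Rightarrow> 'v \<Rightarrow> 'v"
  assumes nt: "normal_tuple H N" and T: "T \<in> bounded_ops H H"
    and comm: "\<And>x i. x \<in> carrier H \<Longrightarrow> T (N i x) = N i (T x)" and ae: "approx_eig {(T, l)}"
  obtains \<mu> where "(\<chi> i. \<mu> i) \<in> joint_spectrum H N" "approx_eig (insert (T, l) (range (\<lambda>i. (N i, \<mu> i))))"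
proof -
  have N: "N i \<in> bounded_ops H H" for i using nt unfolding normal_tuple_def by blast
  have pn: "paranormal (N i)" for i
    using nt normal_paranormal unfolding normal_tuple_def by blast
  have commN: "N i (N j x) = N j (N i x)" if "x \<in> carrier H" for i j x
  proof -
    have "op_mult H (N i) (N j) x = op_mult H (N j) (N i) x"
      using nt unfolding normal_tuple_def by metis
    then show ?thesis using that by (simp add: compose_def)
  qed
  have "\<exists>\<mu>. approx_eig ({(T, l)} \<union> (\<lambda>i. (N i, \<mu> i)) ` UNIV)"
    by (rule approx_eig_extend_finite[OF _ ae N pn]) (use T comm commN in auto)
  then obtain \<mu> where \<mu>: "approx_eig (insert (T, l) (range (\<lambda>i. (N i, \<mu> i))))" by auto
  then have "approx_eig (range (\<lambda>i. (N i, \<mu> i)))" by (rule approx_eig_mono) auto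
  then show ?thesis using that[OF _ \<mu>] joint_spectrum_approx_eig[OF nt] by blast
qed

end

locale real_normal_tuple = inner_space H for H :: "'v hilbert" (structure) +
  fixes N :: "'d::finite \<Rightarrow> 'v \<Rightarrow> 'v" and L :: "(real ^ 'd) set"
  assumes normal: "normal_tuple H N" and spectrum: "joint_spectrum H N \<subseteq> complexify ` L"
begin

lemma N_bounded: "N i \<in> bounded_ops H H"
  using normal unfolding normal_tuple_def by blast

lemma N_closed [simp]: "x \<in> carrier H \<Longrightarrow> N i x \<in> carrier H"
  using N_bounded by (rule bounded_ops_closed)

lemma N_commute: "x \<in> carrier H \<Longrightarrow> N i (N j x) = N j (N i x)"
proof -
  have "op_mult H (N i) (N j) x = op_mult H (N j) (N i) x"
    using normal unfolding normal_tuple_def by metis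
  then show "x \<in> carrier H \<Longrightarrow> N i (N j x) = N j (N i x)" by (simp add: compose_def)
qed

lemma real_joint_approx_eig:
  assumes T: "T \<in> bounded_ops H H" and comm: "\<And>x i. x \<in> carrier H \<Longrightarrow> T (N i x) = N i (T x)"
    and ae: "approx_eig {(T, l)}"
  obtains p where "p \<in> L" "approx_eig (insert (T, l) (range (\<lambda>i. (N i, complex_of_real (p $ i)))))"
proof -
  obtain \<mu> where \<mu>: "(\<chi> i. \<mu> i) \<in> joint_spectrum H N" "approx_eig (insert (T, l) (range (\<lambda>i. (N i, \<mu> i))))"
    by (rule joint_spectrum_extend[OF normal T comm ae])
  then obtain p where p: "p \<in> L" "(\<chi> i. \<mu> i) = complexify p" using spectrum by blast
  then have "\<mu> i = complex_of_real (p $ i)" for i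
    by (simp add: complexify_def vec_eq_iff)
  then show ?thesis using that[OF p(1)] \<mu>(2) by simp
qed

text \<open>Extending \<open>(N i, l)\<close> to the whole tuple makes \<open>N i\<close> occur with
  both \<open>l\<close> and \<open>p $ i\<close>; a common approximate eigenvector forces the two to
  agree.\<close>

lemma N_eigenvalue:
  assumes ae: "approx_eig {(N i, l)}"
  obtains p where "p \<in> L" "l = complex_of_real (p $ i)"
proof -
  obtain p where p: "p \<in> L" "approx_eig (insert (N i, l) (range (\<lambda>i. (N i, complex_of_real (p $ i)))))"
    by (rule real_joint_approx_eig[OF N_bounded N_commute ae])
  have "cmod (l - complex_of_real (p $ i)) \<le> 0 + e" if e: "0 < e" for e
  proof -
    have e2: "e / 2 > 0" using e by simp
    have bdd: "T \<in> bounded_ops H H" if "(T, l') \<in> insert (N i, l) (range (\<lambda>i. (N i, complex_of_real (p $ i))))" for T l'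
      using that N_bounded by auto
    obtain x where x: "x \<in> carrier H" "hnorm H x = 1" "\<forall>(T, l') \<in> insert (N i, l) (range (\<lambda>i. (N i, complex_of_real (p $ i)))). cmod (ip H (T x) x - l') < e / 2"
      by (rule approx_eig_ip[OF p(2) e2 bdd])
    have "cmod (ip H (N i x) x - l) < e / 2" "cmod (ip H (N i x) x - complex_of_real (p $ i)) < e / 2"
      using x by auto
    then have "cmod ((ip H (N i x) x - complex_of_real (p $ i)) - (ip H (N i x) x - l)) < e"
      using norm_triangle_ineq4[of "ip H (N i x) x - complex_of_real (p $ i)" "ip H (N i x) x - l"] by linarith
    then show ?thesis by simp
  qed
  then have "cmod (l - complex_of_real (p $ i)) \<le> 0" by (rule field_le_epsilon)
  then show ?thesis using that[OF p(1)] by simp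
qed

text \<open>If \<open>D = N\<^sub>i - N\<^sub>i\<^sup>*\<close> were nonzero, it would have a nonzero approximate eigenvalue \<open>l\<close>; extending to
  \<open>N\<^sub>i\<close> gives \<open>l = m - m\<^sup>*\<close> for an approximate eigenvalue \<open>m\<close> of \<open>N\<^sub>i\<close>, which is real.\<close>

lemma N_self_adjoint:
  assumes x: "x \<in> carrier H" and y: "y \<in> carrier H"
  shows "ip H (N i x) y = ip H x (N i y)"
proof -
  obtain S where adj: "is_adjoint H H (N i) S" and comm: "op_mult H S (N i) = op_mult H (N i) S"
    using normal unfolding normal_tuple_def by blast
  have S: "S \<in> bounded_ops H H" using adj unfolding is_adjoint_def by blast
  note [simp] = bounded_ops_closed[OF S]
  have SN: "S (N i x) = N i (S x)" if "x \<in> carrier H" for x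
    using fun_cong[OF comm, of x] that by (simp add: compose_def)
  define D where "D = op_diff H (N i) S"
  have D: "D \<in> bounded_ops H H" unfolding D_def by (intro op_diff_bounded N_bounded S)
  have Dx: "D x = N i x \<ominus> S x" if "x \<in> carrier H" for x using that by (simp add: D_def op_diff_def)
  note [simp] = bounded_ops_closed[OF D]
  have ipD: "ip H (D x) y = - ip H x (D y)" if "x \<in> carrier H" "y \<in> carrier H" for x y
    using that by (simp add: Dx ip_linear is_adjointD[OF adj])
  \<comment> \<open>\<open>D\<close> is skew-adjoint, so its squared norm at \<open>x\<close> is, up
    to sign, the inner product of \<open>D (D x)\<close> with \<open>x\<close>.\<close>
  have pnD: "paranormal D"
    unfolding paranormal_def
  proof
    fix x assume x: "x \<in> carrier H"
    have "(hnorm H (D x))\<^sup>2 = Re (- ip H (D (D x)) x)"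
      using x ipD[of "D x" x] by (simp add: hnorm_sq)
    also have "\<dots> \<le> cmod (- ip H (D (D x)) x)" by (rule complex_Re_le_cmod)
    also have "\<dots> \<le> hnorm H (D (D x)) * hnorm H x" using x cauchy_schwarz by simp
    finally show "(hnorm H (D x))\<^sup>2 \<le> hnorm H (D (D x)) * hnorm H x" .
  qed
  have "D x = \<zero>" if x: "x \<in> carrier H" for x
  proof (rule ccontr)
    assume Dx0: "D x \<noteq> \<zero>"
    then have x0: "x \<noteq> \<zero>" using bounded_ops_zero[OF D] by auto
    obtain l where l: "approx_eig {(D, l)}" "hnorm H (D x) \<le> cmod l * hnorm H x"
      by (rule approx_eig_norm[OF D pnD x x0])
    then have l0: "l \<noteq> 0" using hnorm_pos[of "D x"] Dx0 x by auto
    have commD: "D (N i x) = N i (D x)" if "x \<in> carrier H" for x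
      using that by (simp add: Dx SN bounded_ops_minus[OF N_bounded])
    have pn: "paranormal (N i)" using normal_paranormal[OF adj comm] .
    obtain m where m: "approx_eig {(N i, m), (D, l)}"
      by (rule approx_eig_extend[OF l(1) N_bounded pn]) (use D commD in auto)
    then have "approx_eig {(N i, m)}" by (rule approx_eig_mono) auto
    then obtain p where "m = complex_of_real (p $ i)" by (rule N_eigenvalue)
    then have real: "cnj m = m" by simp
    have "cmod l \<le> 0 + e" if e: "0 < e" for e
    proof -
      have e3: "e / 3 > 0" using e by simp
      have bdd: "T \<in> bounded_ops H H" if "(T, l') \<in> {(N i, m), (D, l)}" for T l'
        using that N_bounded D by auto
      obtain x where x: "x \<in> carrier H" "hnorm H x = 1" "\<forall>(T, l') \<in> {(N i, m), (D, l)}. cmod (ip H (T x) x - l') < e / 3"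
        by (rule approx_eig_ip[OF m e3 bdd])
      define z where "z = ip H (N i x) x"
      have "ip H (S x) x = cnj z"
        using x is_adjointD(2)[OF adj, of x x] ip_commute[of "N i x" x] by (simp add: z_def)
      then have "ip H (D x) x = z - cnj z" using x by (simp add: Dx ip_linear z_def)
      then have "cmod (z - m) < e / 3" "cmod (z - cnj z - l) < e / 3" using x(3) by (auto simp: z_def)
      moreover have "cmod (cnj z - m) = cmod (z - m)"
        using real by (metis complex_cnj_diff complex_mod_cnj)
      ultimately have "cmod (((z - m) - (cnj z - m)) - (z - cnj z - l)) < e"
        using norm_triangle_ineq4[of "(z - m) - (cnj z - m)" "z - cnj z - l"]
          norm_triangle_ineq4[of "z - m" "cnj z - m"] by linarith
      then show ?thesis by simp
    qed
    then have "cmod l \<le> 0" by (rule field_le_epsilon)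
    then show False using l0 by simp
  qed
  then have "N i y \<ominus> S y = \<zero>" using Dx y by metis
  then have "ip H x (N i y) - ip H x (S y) = 0"
    using x y by (metis N_closed \<open>S \<in> bounded_ops H H\<close> bounded_ops_closed ip_minus_right ip_zero_right)
  then show ?thesis using x y by (simp add: is_adjointD(1)[OF adj])
qed

text \<open>For sign patterns \<open>s\<close> this is the operator counterpart of the linear forms
  whose maximum is the l1 norm; real coefficients keep it self-adjoint.\<close>

definition comb :: "('d \<Rightarrow> real) \<Rightarrow> 'v \<Rightarrow> 'v" where
  "comb s x = finsum H (\<lambda>i. complex_of_real (s i) \<odot> N i x) UNIV"

lemma comb_closed [simp]: "x \<in> carrier H \<Longrightarrow> comb s x \<in> carrier H"
  unfolding comb_def by (rule M.finsum_closed) auto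

lemma ip_comb_left:
  "\<lbrakk>x \<in> carrier H; z \<in> carrier H\<rbrakk> \<Longrightarrow> ip H (comb s x) z = (\<Sum>i\<in>UNIV. complex_of_real (s i) * ip H (N i x) z)"
  unfolding comb_def by (subst ip_finsum_left) (auto simp: ip_linear)

lemma ip_comb_right:
  "\<lbrakk>x \<in> carrier H; z \<in> carrier H\<rbrakk> \<Longrightarrow> ip H z (comb s x) = (\<Sum>i\<in>UNIV. complex_of_real (s i) * ip H z (N i x))"
  unfolding comb_def by (subst ip_finsum_right) (auto simp: ip_linear)

lemma comb_self_adjoint:
  "\<lbrakk>x \<in> carrier H; y \<in> carrier H\<rbrakk> \<Longrightarrow> ip H (comb s x) y = ip H x (comb s y)"
  by (simp add: ip_comb_left ip_comb_right N_self_adjoint)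

lemma comb_commute: "x \<in> carrier H \<Longrightarrow> comb s (N i x) = N i (comb s x)"
  by (rule vec_eqI) (auto simp: ip_comb_left N_self_adjoint[of "comb s x"] N_commute[of x _ i] N_self_adjoint[of "N _ x" _ i])

lemma comb_bounded: "restrict (comb s) (carrier H) \<in> bounded_ops H H"
proof -
  have "\<forall>i. \<exists>C. \<forall>x \<in> carrier H. hnorm H (N i x) \<le> C * hnorm H x"
    using bounded_ops_bound[OF N_bounded] by metis
  then obtain C where C: "\<And>i x. x \<in> carrier H \<Longrightarrow> hnorm H (N i x) \<le> C i * hnorm H x" by metis
  show ?thesis
  proof (rule bounded_opsI[where C = "\<Sum>i\<in>UNIV. \<bar>s i\<bar> * C i"])
    fix x assume x: "x \<in> carrier H"
    have "hnorm H (comb s x) \<le> (\<Sum>i\<in>UNIV. hnorm H (complex_of_real (s i) \<odot> N i x))"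
      unfolding comb_def using x by (intro hnorm_finsum) auto
    also have "\<dots> \<le> (\<Sum>i\<in>UNIV. \<bar>s i\<bar> * (C i * hnorm H x))"
      using x C by (intro sum_mono) (auto intro!: mult_left_mono)
    finally show "hnorm H (restrict (comb s) (carrier H) x) \<le> (\<Sum>i\<in>UNIV. \<bar>s i\<bar> * C i) * hnorm H x"
      using x by (simp add: sum_distrib_right mult.assoc)
  next
    fix x y assume "x \<in> carrier H" "y \<in> carrier H"
    then show "restrict (comb s) (carrier H) (x \<oplus> y) =
        restrict (comb s) (carrier H) x \<oplus> restrict (comb s) (carrier H) y"
      by (intro vec_eqI) (auto simp: ip_comb_left ip_linear bounded_ops_add[OF N_bounded] algebra_simps sum.distrib)
  next
    fix c x assume "x \<in> carrier H"
    then show "restrict (comb s) (carrier H) (c \<odot> x) = c \<odot> restrict (comb s) (carrier H) x"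
      by (intro vec_eqI) (auto simp: ip_comb_left ip_linear bounded_ops_smult[OF N_bounded] sum_distrib_left algebra_simps)
  qed auto
qed

text \<open>\<open>comb s\<close> is self-adjoint, so its norm at \<open>x\<close> is dominated by
  an approximate eigenvalue \<open>l\<close>. Extending \<open>l\<close> to the tuple shows that
  \<open>l\<close> is the value of the linear form \<open>s\<close> at a point of
  \<open>L\<close>.\<close>

lemma comb_norm_le:
  assumes L: "\<And>p. p \<in> L \<Longrightarrow> \<bar>\<Sum>i\<in>UNIV. s i * p $ i\<bar> \<le> c" and x: "x \<in> carrier H"
  shows "hnorm H (comb s x) \<le> c * hnorm H x"
proof (cases "x = \<zero>")
  case True
  then have "comb s x = \<zero>"
    by (intro vec_eqI) (auto simp: ip_comb_left bounded_ops_zero[OF N_bounded])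
  then show ?thesis using True by simp
next
  case False
  define T where "T = restrict (comb s) (carrier H)"
  have T: "T \<in> bounded_ops H H" unfolding T_def by (rule comb_bounded)
  have Tx: "T x = comb s x" if "x \<in> carrier H" for x using that by (simp add: T_def)
  have "paranormal T"
    unfolding paranormal_def
  proof
    fix x assume x: "x \<in> carrier H"
    have "(hnorm H (T x))\<^sup>2 = Re (ip H (T (T x)) x)"
      using x by (simp add: hnorm_sq Tx comb_self_adjoint)
    also have "\<dots> \<le> cmod (ip H (T (T x)) x)" by (rule complex_Re_le_cmod)
    also have "\<dots> \<le> hnorm H (T (T x)) * hnorm H x" using x cauchy_schwarz by (simp add: Tx)
    finally show "(hnorm H (T x))\<^sup>2 \<le> hnorm H (T (T x)) * hnorm H x" .
  qed
  then obtain l where l: "approx_eig {(T, l)}" "hnorm H (T x) \<le> cmod l * hnorm H x"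
    by (rule approx_eig_norm[OF T _ x False])
  have comm: "T (N i x) = N i (T x)" if "x \<in> carrier H" for i x
    using that by (simp add: Tx comb_commute)
  obtain p where p: "p \<in> L" "approx_eig (insert (T, l) (range (\<lambda>i. (N i, complex_of_real (p $ i)))))"
    by (rule real_joint_approx_eig[OF T comm l(1)])
  define w where "w = complex_of_real (\<Sum>i\<in>UNIV. s i * p $ i)"
  \<comment> \<open>The errors of all \<open>N i\<close>, weighted by \<open>s\<close>, and that of
    \<open>T\<close> itself add up to \<open>K\<close> times the individual tolerance.\<close>
  define K where "K = 1 + (\<Sum>i\<in>UNIV. \<bar>s i\<bar>)"
  have K: "1 \<le> K" by (simp add: K_def sum_nonneg)
  have "cmod (l - w) \<le> 0 + e" if e: "0 < e" for e
  proof -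
    have eK: "e / K > 0" using e K by simp
    have bdd: "T' \<in> bounded_ops H H" if "(T', l') \<in> insert (T, l) (range (\<lambda>i. (N i, complex_of_real (p $ i))))" for T' l'
      using that N_bounded T by auto
    obtain x where x: "x \<in> carrier H" "hnorm H x = 1"
      "\<forall>(T', l') \<in> insert (T, l) (range (\<lambda>i. (N i, complex_of_real (p $ i)))). cmod (ip H (T' x) x - l') < e / K"
      by (rule approx_eig_ip[OF p(2) eK bdd])
    have 1: "cmod (ip H (T x) x - l) \<le> e / K" using x(3) by (intro less_imp_le) auto
    have 2: "cmod (ip H (N i x) x - complex_of_real (p $ i)) \<le> e / K" for i
      using x(3) by (intro less_imp_le) auto
    have "ip H (T x) x - w = (\<Sum>i\<in>UNIV. complex_of_real (s i) * (ip H (N i x) x - complex_of_real (p $ i)))"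
      using x by (simp add: Tx ip_comb_left w_def sum_subtractf right_diff_distrib)
    then have "cmod (ip H (T x) x - w) \<le> (\<Sum>i\<in>UNIV. cmod (complex_of_real (s i) * (ip H (N i x) x - complex_of_real (p $ i))))"
      by (simp only: norm_sum)
    also have "\<dots> \<le> (\<Sum>i\<in>UNIV. \<bar>s i\<bar> * (e / K))"
      using 2 by (intro sum_mono) (simp only: norm_mult norm_of_real mult_left_mono abs_ge_zero)
    finally have "cmod (ip H (T x) x - w) \<le> (\<Sum>i\<in>UNIV. \<bar>s i\<bar>) * (e / K)"
      by (simp only: sum_distrib_right)
    moreover have "cmod ((ip H (T x) x - w) - (ip H (T x) x - l)) \<le> cmod (ip H (T x) x - w) + cmod (ip H (T x) x - l)"
      by (rule norm_triangle_ineq4)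
    ultimately have "cmod (l - w) \<le> (\<Sum>i\<in>UNIV. \<bar>s i\<bar>) * (e / K) + e / K" using 1 by simp
    also have "\<dots> = K * (e / K)" by (simp only: K_def distrib_right mult_1 add.commute)
    also have "\<dots> = e" using K by simp
    finally show ?thesis by simp
  qed
  then have "cmod (l - w) \<le> 0" by (rule field_le_epsilon)
  then have "cmod l = \<bar>\<Sum>i\<in>UNIV. s i * p $ i\<bar>" by (simp only: norm_le_zero_iff right_minus_eq w_def norm_of_real)
  then have "cmod l \<le> c" using L[OF p(1)] by simp
  then have "cmod l * hnorm H x \<le> c * hnorm H x" using x by (intro mult_right_mono) auto
  then show ?thesis using l(2) x by (simp add: Tx)
qed

lemma N_exact_eigenvalue:
  assumes y: "y \<in> carrier H" "y \<noteq> \<zero>" and Ny: "N i y = complex_of_real l \<odot> y"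
  obtains p where "p \<in> L" "p $ i = l"
proof -
  obtain x where x: "x \<in> carrier H" "hnorm H x = 1"
    "hnorm H (residual (N i) (complex_of_real l) x) = hnorm H (residual (N i) (complex_of_real l) y) / hnorm H y"
    using normalize_approx[OF y] N_bounded by metis
  have "residual (N i) (complex_of_real l) y = \<zero>"
    using y unfolding Ny by (intro vec_eqI) (auto simp: ip_linear)
  then have "hnorm H (residual (N i) (complex_of_real l) x) = 0" using x(3) by simp
  then have "approx_eig {(N i, complex_of_real l)}"
    unfolding approx_eig_def using x by (intro allI impI bexI[of _ x]) auto
  then obtain p where "p \<in> L" "complex_of_real l = complex_of_real (p $ i)" by (rule N_eigenvalue)
  then show ?thesis using that by simp
qed

end

section \<open>The equality case for a dilation of Clifford matrices\<close>

section \<open>Forcing the extreme points\<close>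

text \<open>The mixed terms cancel in pairs. This evaluates the square of a sum of anticommuting
  terms, in \<open>sum_norm_N_ge\<close> and in
  \<open>state_anticommuting_involutions\<close>.\<close>

lemma sum_antisymmetric_off_diagonal:
  fixes S :: "'a \<Rightarrow> 'a \<Rightarrow> complex"
  assumes "finite A" "\<And>i j. i \<in> A \<Longrightarrow> j \<in> A \<Longrightarrow> i \<noteq> j \<Longrightarrow> S i j = - S j i"
  shows "(\<Sum>i\<in>A. \<Sum>j\<in>A. S i j) = (\<Sum>i\<in>A. S i i)"
proof -
  have "2 * (\<Sum>i\<in>A. \<Sum>j\<in>A. S i j) = (\<Sum>i\<in>A. \<Sum>j\<in>A. S i j) + (\<Sum>j\<in>A. \<Sum>i\<in>A. S i j)"
    by (subst sum.swap) simp
  also have "\<dots> = (\<Sum>i\<in>A. \<Sum>j\<in>A. S i j + S j i)"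
    by (simp add: sum.distrib)
  also have "\<dots> = (\<Sum>i\<in>A. \<Sum>j\<in>A. if i = j then 2 * S i i else 0)"
  proof (intro sum.cong refl)
    fix i j assume "i \<in> A" "j \<in> A"
    then show "S i j + S j i = (if i = j then 2 * S i i else 0)"
      using assms(2)[of i j] by (cases "i = j") simp_all
  qed
  also have "\<dots> = 2 * (\<Sum>i\<in>A. S i i)"
    using assms(1) by (simp add: sum_distrib_left)
  finally show ?thesis by simp
qed

definition signs :: "('d::finite \<Rightarrow> real) set" where
  "signs = {s. \<forall>i. s i \<in> {1, -1}}"

lemma finite_signs: "finite (signs :: ('d::finite \<Rightarrow> real) set)"
proof -
  have eq: "(signs :: ('d \<Rightarrow> real) set) = Pi\<^sub>E UNIV (\<lambda>_. {1, -1})"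
    by (auto simp: signs_def PiE_def extensional_def Pi_def)
  show ?thesis
    unfolding eq by (intro finite_PiE) auto
qed

text \<open>For distinct indices, flipping the sign at \<open>i\<close> permutes
  \<open>signs\<close> and negates the summand.\<close>

lemma sum_signs:
  "(\<Sum>s\<in>(signs :: ('d::finite \<Rightarrow> real) set). s i * s j) = (if i = j then real (card (signs :: ('d \<Rightarrow> real) set)) else 0)"
proof (cases "i = j")
  case True
  have "s i * s i = 1" if "s \<in> signs" for s :: "'d \<Rightarrow> real"
    using that unfolding signs_def by (cases "s i = 1") auto
  then show ?thesis using True by simp
next
  case False
  have "(\<Sum>s\<in>(signs :: ('d \<Rightarrow> real) set). s i * s j) = (\<Sum>s\<in>(signs :: ('d \<Rightarrow> real) set). - (s i * s j))"
    by (rule sum.reindex_bij_witness[of _ "\<lambda>s. s(i := - s i)" "\<lambda>s. s(i := - s i)"])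
       (use False in \<open>auto simp: signs_def\<close>)
  then show ?thesis using False by (simp add: sum_negf)
qed

text \<open>A dilation in coordinates: \<open>v k\<close> is the image of the k-th unit vector under
  the isometry, and \<open>compression\<close> says entrywise that \<open>N i\<close> compresses to
  the matrix \<open>a i\<close>. The conditions on \<open>a\<close> are those of trace-free
  anticommuting self-adjoint unitaries.\<close>

locale clifford_dilation = real_normal_tuple H N L
  for H :: "'v hilbert" (structure) and N :: "'d::finite \<Rightarrow> 'v \<Rightarrow> 'v" and L :: "(real ^ 'd) set" +
  fixes n :: nat and v :: "nat \<Rightarrow> 'v" and a :: "'d \<Rightarrow> nat \<Rightarrow> nat \<Rightarrow> complex" and d :: real
  assumes n: "0 < n"
    and v: "\<And>k. k < n \<Longrightarrow> v k \<in> carrier H"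
    and orth: "\<And>k l. \<lbrakk>k < n; l < n\<rbrakk> \<Longrightarrow> ip H (v k) (v l) = (if k = l then 1 else 0)"
    and compression: "\<And>i k l. \<lbrakk>k < n; l < n\<rbrakk> \<Longrightarrow> ip H (N i (v l)) (v k) = a i k l"
    and a_hermitian: "\<And>i k l. \<lbrakk>k < n; l < n\<rbrakk> \<Longrightarrow> cnj (a i k l) = a i l k"
    and a_square: "\<And>i k l. \<lbrakk>k < n; l < n\<rbrakk> \<Longrightarrow> (\<Sum>m<n. a i k m * a i m l) = (if k = l then 1 else 0)"
    and a_anticommute: "\<And>i j k l. \<lbrakk>i \<noteq> j; k < n; l < n\<rbrakk> \<Longrightarrow>
      (\<Sum>m<n. a i k m * a j m l) = - (\<Sum>m<n. a j k m * a i m l)"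
    and a_trace: "\<And>i. (\<Sum>k<n. a i k k) = 0"
    and L: "\<And>p. p \<in> L \<Longrightarrow> (\<Sum>i\<in>UNIV. \<bar>p $ i\<bar>) \<le> d"
    and d: "d = real CARD('d)"
begin

lemma v_norm: "k < n \<Longrightarrow> hnorm H (v k) = 1"
  by (simp add: hnorm_def orth)

text \<open>With \<open>w\<^sub>l = \<Sum>\<^sub>i N\<^sub>i V X\<^sub>i e\<^sub>l\<close>, the inequality is \<open>\<Sum>\<^sub>l \<parallel>w\<^sub>l - d v\<^sub>l\<parallel>\<^sup>2 \<ge> 0\<close>: anticommutation of the \<open>X\<^sub>i\<close> against
  commutation of the \<open>N\<^sub>i\<close> removes the mixed terms.\<close>

lemma sum_norm_N_ge: "d\<^sup>2 * real n \<le> (\<Sum>l<n. \<Sum>i\<in>UNIV. (hnorm H (N i (v l)))\<^sup>2)"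
proof -
  define A where "A = (UNIV :: 'd set) \<times> {..<n}"
  have A: "finite A" by (simp add: A_def)
  define w where "w l = finsum H (\<lambda>(i, k). a i k l \<odot> N i (v k)) A" for l
  have fc: "(case q of (i, k) \<Rightarrow> a i k l \<odot> N i (v k)) \<in> carrier H" if "q \<in> A" for q l
    using that v by (auto simp: A_def)
  have w: "w l \<in> carrier H" for l
    unfolding w_def using fc by (intro M.finsum_closed) auto
  have ipw: "ip H (w l) z = (\<Sum>i\<in>UNIV. \<Sum>k<n. a i k l * ip H (N i (v k)) z)" if "z \<in> carrier H" for l z
  proof -
    have "ip H (w l) z = (\<Sum>q\<in>A. ip H (case q of (i, k) \<Rightarrow> a i k l \<odot> N i (v k)) z)"
      unfolding w_def using fc that by (intro ip_finsum_left A) auto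
    also have "\<dots> = (\<Sum>(i, k)\<in>A. a i k l * ip H (N i (v k)) z)"
      using v that by (intro sum.cong refl) (auto simp: A_def ip_linear)
    finally show ?thesis by (simp add: A_def sum.cartesian_product)
  qed
  have ipw': "ip H z (w l) = (\<Sum>i\<in>UNIV. \<Sum>k<n. cnj (a i k l) * ip H z (N i (v k)))" if "z \<in> carrier H" for l z
  proof -
    have "ip H z (w l) = cnj (ip H (w l) z)" using that w by (intro ip_commute) auto
    also have "\<dots> = (\<Sum>i\<in>UNIV. \<Sum>k<n. cnj (a i k l) * cnj (ip H (N i (v k)) z))"
      using that by (simp add: ipw)
    also have "\<dots> = (\<Sum>i\<in>UNIV. \<Sum>k<n. cnj (a i k l) * ip H z (N i (v k)))"
      using that v by (intro sum.cong refl arg_cong2[where f = "(*)"] ip_commute[symmetric]) auto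
    finally show ?thesis .
  qed
  define g where "g i j k k' = ip H (N i (v k)) (N j (v k'))" for i j k k'
  define S where "S i j = (\<Sum>k<n. \<Sum>k'<n. (\<Sum>l<n. a i k l * a j l k') * g i j k k')" for i j
  \<comment> \<open>Moving one factor across by self-adjointness leaves a product of two commuting
    operators.\<close>
  have g_sym: "g i j k k' = g j i k k'" if "k < n" "k' < n" for i j k k'
    using v that by (simp add: g_def N_self_adjoint[symmetric] N_commute)
  have anti: "S i j = - S j i" if "i \<noteq> j" for i j
    unfolding S_def using that by (simp add: a_anticommute[OF that] g_sym[of _ _ i j] sum_negf)
  have "(\<Sum>i\<in>UNIV. \<Sum>j\<in>UNIV. S i j) = (\<Sum>i\<in>UNIV. S i i)"
    by (rule sum_antisymmetric_off_diagonal[OF finite anti])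
  moreover have "S i i = (\<Sum>k<n. g i i k k)" for i
  proof -
    have "S i i = (\<Sum>k<n. \<Sum>k'<n. (if k = k' then 1 else 0) * g i i k k')"
      unfolding S_def by (intro sum.cong refl arg_cong2[where f = "(*)"] a_square) auto
    also have "\<dots> = (\<Sum>k<n. g i i k k)"
      by (simp add: mult_if_delta)
    finally show ?thesis .
  qed
  ultimately have SS: "(\<Sum>i\<in>UNIV. \<Sum>j\<in>UNIV. S i j) = (\<Sum>i\<in>UNIV. \<Sum>k<n. g i i k k)"
    by simp
  \<comment> \<open>\<open>a_hermitian\<close> removes the conjugation from the second factor. The
    interchanges then move the sum over \<open>l\<close> innermost, where it is an entry of the
    product of \<open>a i\<close> and \<open>a j\<close>.\<close>
  have "(\<Sum>l<n. ip H (w l) (w l)) =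
      (\<Sum>l<n. \<Sum>i\<in>UNIV. \<Sum>k<n. a i k l * (\<Sum>j\<in>UNIV. \<Sum>k'<n. a j l k' * g i j k k'))"
    unfolding ipw[OF w] using v by (intro sum.cong refl) (simp add: ipw' g_def a_hermitian)
  also have "\<dots> = (\<Sum>l<n. \<Sum>i\<in>UNIV. \<Sum>k<n. \<Sum>j\<in>UNIV. \<Sum>k'<n. a i k l * a j l k' * g i j k k')"
    by (simp add: sum_distrib_left mult.assoc)
  also have "\<dots> = (\<Sum>i\<in>UNIV. \<Sum>l<n. \<Sum>k<n. \<Sum>j\<in>UNIV. \<Sum>k'<n. a i k l * a j l k' * g i j k k')"
    by (rule sum.swap)
  also have "\<dots> = (\<Sum>i\<in>UNIV. \<Sum>l<n. \<Sum>j\<in>UNIV. \<Sum>k<n. \<Sum>k'<n. a i k l * a j l k' * g i j k k')"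
    by (intro sum.cong refl sum.swap)
  also have "\<dots> = (\<Sum>i\<in>UNIV. \<Sum>j\<in>UNIV. \<Sum>l<n. \<Sum>k<n. \<Sum>k'<n. a i k l * a j l k' * g i j k k')"
    by (intro sum.cong refl sum.swap)
  also have "\<dots> = (\<Sum>i\<in>UNIV. \<Sum>j\<in>UNIV. \<Sum>k<n. \<Sum>l<n. \<Sum>k'<n. a i k l * a j l k' * g i j k k')"
    by (intro sum.cong refl sum.swap)
  also have "\<dots> = (\<Sum>i\<in>UNIV. \<Sum>j\<in>UNIV. \<Sum>k<n. \<Sum>k'<n. \<Sum>l<n. a i k l * a j l k' * g i j k k')"
    by (intro sum.cong refl sum.swap)
  also have "\<dots> = (\<Sum>i\<in>UNIV. \<Sum>j\<in>UNIV. S i j)"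
    by (simp add: S_def sum_distrib_right)
  finally have ww: "(\<Sum>l<n. ip H (w l) (w l)) = (\<Sum>i\<in>UNIV. \<Sum>k<n. g i i k k)" using SS by simp
  \<comment> \<open>For each \<open>i\<close> the double sum is the trace of the square of
    \<open>a i\<close>, that is \<open>n\<close>; the \<open>d\<close> values of \<open>i\<close>
    give \<open>d * n\<close>.\<close>
  have "(\<Sum>l<n. ip H (w l) (v l)) = (\<Sum>l<n. \<Sum>i\<in>UNIV. \<Sum>k<n. a i k l * a i l k)"
    using v by (intro sum.cong refl) (simp add: ipw compression)
  also have "\<dots> = (\<Sum>i\<in>UNIV. \<Sum>l<n. \<Sum>k<n. a i k l * a i l k)" by (rule sum.swap)
  also have "\<dots> = (\<Sum>i\<in>(UNIV::'d set). \<Sum>k<n. \<Sum>l<n. a i k l * a i l k)" by (intro sum.cong refl sum.swap)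
  also have "\<dots> = (\<Sum>i\<in>(UNIV::'d set). \<Sum>k<n. 1)" by (intro sum.cong refl) (simp add: a_square)
  finally have wv: "(\<Sum>l<n. ip H (w l) (v l)) = complex_of_real (d * real n)" by (simp add: d)
  have vw: "(\<Sum>l<n. ip H (v l) (w l)) = complex_of_real (d * real n)"
  proof -
    have "(\<Sum>l<n. ip H (v l) (w l)) = (\<Sum>l<n. cnj (ip H (w l) (v l)))"
      using v w by (intro sum.cong refl ip_commute) auto
    also have "\<dots> = cnj (\<Sum>l<n. ip H (w l) (v l))" by simp
    finally show ?thesis by (simp add: wv)
  qed
  \<comment> \<open>In the total of the squared norms, the mixed terms contribute
    \<open>- 2 * d\<^sup>2 * n\<close> and the vectors \<open>v l\<close> contribute
    \<open>d\<^sup>2 * n\<close>.\<close>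
  define u where "u l = w l \<ominus> complex_of_real d \<odot> v l" for l
  have "(\<Sum>l<n. ip H (u l) (u l)) =
      (\<Sum>l<n. ip H (w l) (w l) - d * ip H (w l) (v l) - d * ip H (v l) (w l) + d\<^sup>2)"
    using v w by (intro sum.cong refl) (simp add: u_def ip_linear orth algebra_simps power2_eq_square)
  also have "\<dots> = (\<Sum>l<n. ip H (w l) (w l)) - d * (\<Sum>l<n. ip H (w l) (v l)) - d * (\<Sum>l<n. ip H (v l) (w l)) + of_nat n * d\<^sup>2"
    by (simp add: sum.distrib sum_subtractf sum_distrib_left)
  also have "\<dots> = (\<Sum>i\<in>UNIV. \<Sum>k<n. g i i k k) - complex_of_real (d\<^sup>2 * real n)"
    unfolding ww wv vw by (simp add: power2_eq_square algebra_simps)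
  also have "(\<Sum>i\<in>UNIV. \<Sum>k<n. g i i k k) = complex_of_real (\<Sum>i\<in>UNIV. \<Sum>k<n. (hnorm H (N i (v k)))\<^sup>2)"
    using v by (simp add: g_def ip_self)
  finally have "Re (\<Sum>l<n. ip H (u l) (u l)) = (\<Sum>i\<in>UNIV. \<Sum>k<n. (hnorm H (N i (v k)))\<^sup>2) - d\<^sup>2 * real n"
    by (simp only: minus_complex.sel Re_complex_of_real)
  moreover have "0 \<le> Re (\<Sum>l<n. ip H (u l) (u l))"
    using v w by (auto intro!: sum_nonneg ip_self_nonneg simp: u_def)
  moreover have "(\<Sum>i\<in>UNIV. \<Sum>k<n. (hnorm H (N i (v k)))\<^sup>2) = (\<Sum>l<n. \<Sum>i\<in>UNIV. (hnorm H (N i (v l)))\<^sup>2)"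
    by (rule sum.swap)
  ultimately show ?thesis by simp
qed

lemma comb_contraction:
  assumes s: "s \<in> signs" and x: "x \<in> carrier H"
  shows "hnorm H (comb s x) \<le> d * hnorm H x"
proof (rule comb_norm_le[OF _ x])
  fix p assume p: "p \<in> L"
  have "\<bar>s i\<bar> = 1" for i
  proof -
    have "s i = 1 \<or> s i = -1" using s by (simp add: signs_def)
    then show ?thesis by auto
  qed
  then have "\<bar>\<Sum>i\<in>UNIV. s i * p $ i\<bar> \<le> (\<Sum>i\<in>UNIV. \<bar>p $ i\<bar>)"
    using sum_abs[of "\<lambda>i. s i * p $ i" UNIV] by (simp add: abs_mult)
  then show "\<bar>\<Sum>i\<in>UNIV. s i * p $ i\<bar> \<le> d" using L[OF p] by simp
qed

text \<open>Averaged over all signs, \<open>\<parallel>\<Sum>\<^sub>i s\<^sub>i N\<^sub>i v\<^sub>l\<parallel>\<^sup>2\<close> is \<open>\<Sum>\<^sub>i \<parallel>N\<^sub>i v\<^sub>l\<parallel>\<^sup>2\<close>, so there is equality for every choice of signs.\<close>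

lemma comb_norm_eq:
  assumes s: "s \<in> signs" and l: "l < n"
  shows "hnorm H (comb s (v l)) = d"
proof -
  let ?S = "signs :: ('d \<Rightarrow> real) set"
  define f where "f l s = d\<^sup>2 - (hnorm H (comb s (v l)))\<^sup>2" for l and s :: "'d \<Rightarrow> real"
  have f0: "0 \<le> f l s" if "l < n" "s \<in> ?S" for l s
  proof -
    have "hnorm H (comb s (v l)) \<le> d" using comb_contraction[OF that(2) v[OF that(1)]] that v_norm by simp
    then have "(hnorm H (comb s (v l)))\<^sup>2 \<le> d\<^sup>2" using v that by (intro power_mono) auto
    then show ?thesis by (simp add: f_def)
  qed
  have "(\<Sum>s\<in>?S. f l s) = real (card ?S) * (d\<^sup>2 - (\<Sum>i\<in>UNIV. (hnorm H (N i (v l)))\<^sup>2))" if l: "l < n" for l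
  proof -
    have "(hnorm H (comb s (v l)))\<^sup>2 = (\<Sum>i\<in>UNIV. \<Sum>j\<in>UNIV. (s i * s j) * Re (ip H (N i (v l)) (N j (v l))))" for s
    proof -
      have "ip H (comb s (v l)) (comb s (v l)) =
          (\<Sum>i\<in>UNIV. \<Sum>j\<in>UNIV. complex_of_real (s i * s j) * ip H (N i (v l)) (N j (v l)))"
        using v[OF l] unfolding ip_comb_left[OF v[OF l] comb_closed[OF v[OF l]]]
        by (simp add: ip_comb_right sum_distrib_left mult.assoc)
      then show ?thesis
        using v[OF l] by (simp add: hnorm_sq del: of_real_mult)
    qed
    then have "(\<Sum>s\<in>?S. (hnorm H (comb s (v l)))\<^sup>2) =
        (\<Sum>s\<in>?S. \<Sum>i\<in>UNIV. \<Sum>j\<in>UNIV. (s i * s j) * Re (ip H (N i (v l)) (N j (v l))))"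
      by simp
    also have "\<dots> = (\<Sum>i\<in>UNIV. \<Sum>s\<in>?S. \<Sum>j\<in>UNIV. (s i * s j) * Re (ip H (N i (v l)) (N j (v l))))"
      by (rule sum.swap)
    also have "\<dots> = (\<Sum>i\<in>UNIV. \<Sum>j\<in>UNIV. \<Sum>s\<in>?S. (s i * s j) * Re (ip H (N i (v l)) (N j (v l))))"
      by (intro sum.cong refl sum.swap)
    also have "\<dots> = (\<Sum>i\<in>UNIV. \<Sum>j\<in>UNIV. (if i = j then real (card ?S) else 0) * Re (ip H (N i (v l)) (N j (v l))))"
      by (simp only: sum_distrib_right[symmetric] sum_signs)
    also have "\<dots> = (\<Sum>i\<in>UNIV. real (card ?S) * Re (ip H (N i (v l)) (N i (v l))))"
    proof (intro sum.cong refl)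
      fix i
      have "(\<Sum>j\<in>UNIV. (if i = j then real (card ?S) else 0) * Re (ip H (N i (v l)) (N j (v l)))) =
          (\<Sum>j\<in>UNIV. if i = j then real (card ?S) * Re (ip H (N i (v l)) (N j (v l))) else 0)"
        by (intro sum.cong refl) simp
      then show "(\<Sum>j\<in>UNIV. (if i = j then real (card ?S) else 0) * Re (ip H (N i (v l)) (N j (v l)))) =
          real (card ?S) * Re (ip H (N i (v l)) (N i (v l)))"
        by simp
    qed
    finally show ?thesis
      using v[OF l] by (simp add: f_def sum_subtractf hnorm_sq sum_distrib_left right_diff_distrib)
  qed
  \<comment> \<open>The defects \<open>f l s\<close> are nonnegative, while
    \<open>sum_norm_N_ge\<close> makes their total nonpositive, so each of them vanishes.\<close>
  then have "(\<Sum>l<n. \<Sum>s\<in>?S. f l s) =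
      real (card ?S) * (d\<^sup>2 * real n - (\<Sum>l<n. \<Sum>i\<in>UNIV. (hnorm H (N i (v l)))\<^sup>2))"
    by (simp add: sum_subtractf flip: sum_distrib_left)
  also have "\<dots> \<le> 0"
    using sum_norm_N_ge by (intro mult_nonneg_nonpos) auto
  finally have le: "(\<Sum>l<n. \<Sum>s\<in>?S. f l s) \<le> 0" .
  have "f l s \<le> (\<Sum>s\<in>?S. f l s)"
    using s l f0 finite_signs by (intro member_le_sum) auto
  also have "\<dots> \<le> (\<Sum>l<n. \<Sum>s\<in>?S. f l s)"
    using l f0 by (intro member_le_sum[of l]) (auto intro!: sum_nonneg)
  finally have "f l s = 0" using le f0[OF l s] by linarith
  then have "(hnorm H (comb s (v l)))\<^sup>2 = d\<^sup>2" by (simp add: f_def)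
  then show ?thesis using v[OF l] d by (simp add: power2_eq_iff_nonneg)
qed

text \<open>The equality case for a self-adjoint operator of norm at most \<open>d\<close>: as
  \<open>x\<close> has norm 1 and \<open>comb s x\<close> has norm \<open>d\<close>, expanding the
  squared norm of the difference of the two sides gives at most
  \<open>d ^ 4 - 2 * d ^ 4 + d ^ 4\<close>.\<close>

lemma comb_comb:
  assumes s: "s \<in> signs" and l: "l < n"
  shows "comb s (comb s (v l)) = complex_of_real (d\<^sup>2) \<odot> v l"
proof -
  define x where "x = v l"
  have x: "x \<in> carrier H" "hnorm H x = 1" using v l v_norm by (auto simp: x_def)
  have Tx: "hnorm H (comb s x) = d" using comb_norm_eq[OF s l] by (simp add: x_def)
  have "hnorm H (comb s (comb s x)) \<le> d * d" using comb_contraction[OF s, of "comb s x"] x Tx by simp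
  then have "(hnorm H (comb s (comb s x)))\<^sup>2 \<le> (d * d)\<^sup>2" using x by (intro power_mono) auto
  then have TTx: "Re (ip H (comb s (comb s x)) (comb s (comb s x))) \<le> d ^ 4"
    using x by (simp flip: hnorm_sq add: power2_eq_square power4_eq_xxxx mult.assoc)
  define y where "y = comb s (comb s x) \<ominus> complex_of_real (d\<^sup>2) \<odot> x"
  have y: "y \<in> carrier H" using x by (simp add: y_def)
  have 1: "ip H (comb s (comb s x)) x = complex_of_real (d\<^sup>2)"
    using x by (simp add: comb_self_adjoint ip_self Tx)
  have 2: "ip H x (comb s (comb s x)) = complex_of_real (d\<^sup>2)"
    using x by (simp add: ip_self Tx flip: comb_self_adjoint)
  have "ip H y y = ip H (comb s (comb s x)) (comb s (comb s x)) - complex_of_real (d ^ 4)"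
    unfolding y_def using x by (simp add: ip_minus_left ip_minus_right ip_smult_left ip_smult_right 1 2 ip_self[OF x(1)] x(2) power2_eq_square power4_eq_xxxx)
  then have "Re (ip H y y) \<le> 0" using TTx by simp
  then have "y = \<zero>" using ip_pos[OF y] by force
  then have "ip H (comb s (comb s x)) z = ip H (complex_of_real (d\<^sup>2) \<odot> x) z" if "z \<in> carrier H" for z
    using ip_minus_left[of "comb s (comb s x)" "complex_of_real (d\<^sup>2) \<odot> x" z] x that unfolding y_def by simp
  then show ?thesis
    unfolding x_def[symmetric] using x by (intro vec_eqI) auto
qed

lemma comb_linear:
  assumes "x \<in> carrier H" "y \<in> carrier H"
  shows "comb s (x \<ominus> c \<odot> y) = comb s x \<ominus> c \<odot> comb s y"
  using assms by (intro vec_eqI)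
    (auto simp: ip_linear comb_self_adjoint)

text \<open>Let S be the sum of all \<open>N j\<close>, and T = S - 2 N_i the sum with the sign of
  \<open>N i\<close> reversed. Both squares agree on \<open>x\<close>, so N_i S x = N_i^2 x. Using
  this twice, with commutation, gives N_i S^2 x = N_i^3 x, and S^2 x is \<open>d\<^sup>2\<close>
  times \<open>x\<close>.\<close>

lemma N_cubed:
  assumes l: "l < n"
  shows "N i (N i (N i (v l))) = complex_of_real (d\<^sup>2) \<odot> N i (v l)"
proof -
  define x where "x = v l"
  have x: "x \<in> carrier H" using v l by (simp add: x_def)
  define s where "s = (\<lambda>_::'d. 1::real)"
  define t where "t = s(i := -1)"
  have st: "s \<in> signs" "t \<in> signs" by (auto simp: s_def t_def signs_def)
  have t_eq: "comb t z = comb s z \<ominus> 2 \<odot> N i z" if z: "z \<in> carrier H" for z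
  proof (rule vec_eqI)
    fix u assume u: "u \<in> carrier H"
    have "ip H (comb t z) u = (\<Sum>j\<in>UNIV. ip H (N j z) u - (if j = i then 2 * ip H (N i z) u else 0))"
      using z u unfolding ip_comb_left[OF z u] by (intro sum.cong refl) (auto simp: s_def t_def)
    also have "\<dots> = (\<Sum>j\<in>UNIV. ip H (N j z) u) - 2 * ip H (N i z) u"
      by (simp add: sum_subtractf)
    finally show "ip H (comb t z) u = ip H (comb s z \<ominus> 2 \<odot> N i z) u"
      using z u by (simp add: ip_linear ip_comb_left s_def)
  qed (use z in auto)
  have "comb t (comb t x) = comb s (comb s x)"
    using comb_comb[OF st(1) l] comb_comb[OF st(2) l] by (simp add: x_def)
  then have eq: "comb s (comb s x \<ominus> 2 \<odot> N i x) \<ominus> 2 \<odot> N i (comb s x \<ominus> 2 \<odot> N i x) = comb s (comb s x)"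
    using x by (simp add: t_eq)
  have NT: "N i (comb s x) = N i (N i x)"
  proof (rule vec_eqI)
    fix u assume u: "u \<in> carrier H"
    have "ip H (comb s (comb s x \<ominus> 2 \<odot> N i x) \<ominus> 2 \<odot> N i (comb s x \<ominus> 2 \<odot> N i x)) u =
        ip H (comb s (comb s x)) u - 4 * ip H (N i (comb s x)) u + 4 * ip H (N i (N i x)) u"
      using x u by (simp add: comb_linear bounded_ops_minus[OF N_bounded] bounded_ops_smult[OF N_bounded] comb_commute)
        (simp add: ip_linear algebra_simps)
    then show "ip H (N i (comb s x)) u = ip H (N i (N i x)) u"
      unfolding eq by simp
  qed (use x in auto)
  have "N i (comb s (comb s x)) = comb s (N i (comb s x))" using x by (simp add: comb_commute)
  also have "\<dots> = N i (N i (comb s x))" using x by (simp add: NT comb_commute)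
  also have "\<dots> = N i (N i (N i x))" by (simp add: NT)
  finally have "N i (N i (N i x)) = N i (comb s (comb s x))" ..
  also have "\<dots> = complex_of_real (d\<^sup>2) \<odot> N i x"
    using comb_comb[OF st(1) l] x by (simp add: x_def[symmetric] bounded_ops_smult[OF N_bounded])
  finally show ?thesis by (simp add: x_def)
qed

text \<open>With \<open>c = \<sigma> * d\<close>, \<open>N_cubed\<close> says that (N_i - c)(N_i +
  c) N_i kills \<open>v l\<close>, so \<open>y l\<close>, which is (N_i + c) N_i applied to
  \<open>v l\<close>, is an eigenvector for \<open>c\<close> unless it vanishes. If it vanished for
  all \<open>l\<close>, pairing with \<open>v l\<close> and summing would make the total squared
  norm of the \<open>N i (v l)\<close> a multiple of the trace of \<open>a i\<close>, hence 0; but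
  \<open>a i\<close> squares to the identity.\<close>

lemma extreme_point:
  assumes \<sigma>: "\<sigma> \<in> {1, -1}"
  obtains p where "p \<in> L" "p $ i = \<sigma> * d"
proof -
  define c where "c = complex_of_real (\<sigma> * d)"
  have c: "c * c = complex_of_real (d\<^sup>2)" "cnj c = c" using \<sigma> by (auto simp: c_def power2_eq_square)
  have cc: "(complex_of_real d)\<^sup>2 = c * c" using c(1) by simp
  define y where "y l = N i (N i (v l)) \<oplus> c \<odot> N i (v l)" for l
  have y: "y l \<in> carrier H" if "l < n" for l using v[OF that] by (simp add: y_def)
  have Ny: "N i (y l) = c \<odot> y l" if l: "l < n" for l
    using v[OF l] by (intro vec_eqI)
      (auto simp: y_def bounded_ops_add[OF N_bounded] bounded_ops_smult[OF N_bounded] N_cubed[OF l] ip_linear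
        cc algebra_simps)
  have "\<exists>l<n. y l \<noteq> \<zero>"
  proof (rule ccontr)
    assume "\<not> (\<exists>l<n. y l \<noteq> \<zero>)"
    then have y0: "y l = \<zero>" if "l < n" for l using that by blast
    have "complex_of_real ((hnorm H (N i (v l)))\<^sup>2) = - c * a i l l" if l: "l < n" for l
    proof -
      have "0 = ip H (y l) (v l)" using y0 l v by simp
      also have "\<dots> = ip H (N i (v l)) (N i (v l)) + c * a i l l"
        using v[OF l] l by (simp add: y_def ip_linear compression N_self_adjoint[of "N i (v l)"])
      finally show ?thesis using v[OF l] by (simp add: ip_self eq_neg_iff_add_eq_0)
    qed
    then have "complex_of_real (\<Sum>l<n. (hnorm H (N i (v l)))\<^sup>2) = (\<Sum>l<n. - c * a i l l)" by simp
    also have "\<dots> = 0" by (simp only: sum_distrib_left[symmetric] a_trace mult_zero_right)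
    finally have "(\<Sum>l<n. (hnorm H (N i (v l)))\<^sup>2) = 0" by (simp only: of_real_eq_0_iff)
    then have "hnorm H (N i (v l)) = 0" if "l < n" for l
      using that by (subst (asm) sum_nonneg_eq_0_iff) auto
    then have "N i (v l) = \<zero>" if "l < n" for l
      using that v by (simp add: hnorm_eq_0_iff)
    then have "a i 0 m = 0" if "m < n" for m
      using compression[of 0 m i] n that v by simp
    then show False using a_square[of 0 0 i] n by simp
  qed
  then obtain l where l: "l < n" "y l \<noteq> \<zero>" by blast
  have "N i (y l) = complex_of_real (\<sigma> * d) \<odot> y l" using Ny[OF l(1)] by (simp only: c_def)
  then show ?thesis by (rule N_exact_eigenvalue[OF y[OF l(1)] l(2)]) (rule that)
qed

end

notation vec_index (infixl \<open>$v\<close> 100)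

section \<open>Clifford matrices and the minimality of the cross-polytope\<close>

section \<open>States and vector states\<close>

context inner_space
begin

lemma vector_state_W1:
  fixes A :: "'d::finite \<Rightarrow> 'v \<Rightarrow> 'v"
  assumes A: "\<And>i. A i \<in> bounded_ops H H" and u: "u \<in> carrier H" "hnorm H u = 1"
  shows "(\<chi> i. ip H (A i u) u) \<in> W1 H A"
proof -
  have bdd: "T \<in> bounded_ops H H" if "T \<in> cstar_generated H A" for T
    using cstar_subalgebra_generated[OF inner_space_axioms A] that by (rule cstar_subalgebraD)
  have closed: "T u \<in> carrier H" if "T \<in> cstar_generated H A" for T
    using bdd[OF that] u(1) by (rule bounded_ops_closed)
  have "state H (cstar_generated H A) (\<lambda>T. ip H (T u) u)"
    unfolding state_def linear_functional_on_def
  proof (intro conjI ballI allI impI)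
    fix T S assume T: "T \<in> cstar_generated H A" and adj: "is_adjoint H H T S"
    have S: "S \<in> bounded_ops H H" using adj unfolding is_adjoint_def by blast
    have "ip H (op_mult H S T u) u = ip H (T u) (T u)"
      using u bounded_ops_closed[OF bdd[OF T]] by (simp add: compose_def is_adjointD(2)[OF adj])
    then show "0 \<le> ip H (op_mult H S T u) u"
      using u bounded_ops_closed[OF bdd[OF T]] by (simp add: less_eq_complex_def ip_self_nonneg ip_self_Im)
  qed (use u closed in \<open>auto simp: op_add_def op_scale_def op_one_def ip_linear ip_self\<close>)
  then show ?thesis
    unfolding W1_def by (intro CollectI exI[of _ "\<lambda>T. ip H (T u) u"]) simp
qed

end

text \<open>Let \<open>T\<close> be the sum of the \<open>A i\<close> with coefficients
  \<open>r i\<close>, and \<open>q\<close> the sum of the squares of the \<open>r i\<close>.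
  Anticommutation makes \<open>T\<close> square to \<open>q\<close>, and the state takes the value
  \<open>q\<close> at \<open>T\<close>. Its variance at \<open>T\<close> is therefore
  \<open>q - q\<^sup>2\<close>, and positivity gives \<open>q \<le> 1\<close>.\<close>

lemma state_anticommuting_involutions:
  fixes H :: "'v hilbert" (structure) and A :: "'d::finite \<Rightarrow> 'v \<Rightarrow> 'v"
  assumes H: "inner_space H" and adj: "\<And>i. is_adjoint H H (A i) (A i)"
    and sq: "\<And>i x. x \<in> carrier H \<Longrightarrow> A i (A i x) = x"
    and anti: "\<And>i j x z. i \<noteq> j \<Longrightarrow> x \<in> carrier H \<Longrightarrow> z \<in> carrier H \<Longrightarrow> ip H (A i (A j x)) z = - ip H (A j (A i x)) z"
    and st: "state H (cstar_generated H A) \<phi>"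
  obtains r where "\<And>i. \<phi> (A i) = complex_of_real (r i)" "(\<Sum>i\<in>UNIV. (r i)\<^sup>2) \<le> 1"
proof -
  interpret inner_space H by fact
  have A: "A i \<in> bounded_ops H H" for i using adj unfolding is_adjoint_def by blast
  note [simp] = bounded_ops_closed[OF A]
  let ?C = "cstar_generated H A"
  have C: "cstar_subalgebra H ?C" by (rule cstar_subalgebra_generated[OF H A])
  note Cs = cstar_subalgebraD[OF C]
  have add: "\<phi> (op_add H S T) = \<phi> S + \<phi> T" if "S \<in> ?C" "T \<in> ?C" for S T
    using st that unfolding state_def linear_functional_on_def by blast
  have scale: "\<phi> (op_scale H c T) = c * \<phi> T" if "T \<in> ?C" for c T
    using st that unfolding state_def linear_functional_on_def by blast
  have one: "\<phi> (op_one H) = 1" using st unfolding state_def by blast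
  have pos: "0 \<le> \<phi> (op_mult H T T)" if "T \<in> ?C" "is_adjoint H H T T" for T
    using st that unfolding state_def by blast
  have adjI: "is_adjoint H H T T" if "T \<in> ?C" "\<And>x y. x \<in> carrier H \<Longrightarrow> y \<in> carrier H \<Longrightarrow> ip H (T x) y = ip H x (T y)" for T
    using that Cs(1)[OF that(1)] unfolding is_adjoint_def by blast
  define r where "r i = Re (\<phi> (A i))" for i
  have real: "\<phi> (A i) = complex_of_real (r i)" for i
  proof -
    \<comment> \<open>\<open>A i + 1\<close> is half of its own square, hence positive, which makes
      the value of the state at \<open>A i\<close> real.\<close>
    define B where "B = op_add H (A i) (op_one H)"
    have B: "B \<in> ?C" unfolding B_def by (intro Cs(2-5) cstar_generated_mem)
    have "op_mult H B B = op_scale H 2 B"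
    proof
      fix x show "op_mult H B B x = op_scale H 2 B x"
      proof (cases "x \<in> carrier H")
        case True
        then have "B (B x) = 2 \<odot> B x"
          by (intro vec_eqI) (auto simp: B_def op_add_def op_one_def ip_linear bounded_ops_add[OF A] sq)
        then show ?thesis using True by (simp add: compose_def op_scale_def)
      qed (simp add: compose_def op_scale_def)
    qed
    moreover have "is_adjoint H H B B"
      using B by (rule adjI) (auto simp: B_def op_add_def op_one_def ip_linear is_adjointD(1)[OF adj])
    ultimately have "0 \<le> 2 * (\<phi> (A i) + 1)"
      using pos[OF B] B by (simp add: scale B_def add one Cs cstar_generated_mem)
    then have "Im (\<phi> (A i)) = 0" by (simp add: less_eq_complex_def)
    then show ?thesis by (simp add: r_def complex_eq_iff)
  qed
  define q where "q = (\<Sum>i\<in>UNIV. (r i)\<^sup>2)"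
  \<comment> \<open>Partial sums, because membership in the algebra and additivity of the state are
    given for \<open>op_add\<close>, that is one summand at a time.\<close>
  define Y where "Y F = restrict (\<lambda>x. finsum H (\<lambda>i. complex_of_real (r i) \<odot> A i x) F) (carrier H)" for F
  have YC: "Y F \<in> ?C \<and> \<phi> (Y F) = (\<Sum>i\<in>F. complex_of_real ((r i)\<^sup>2))" if "finite F" for F
    using that
  proof (induction F)
    case empty
    have "Y {} = op_scale H 0 (op_one H)"
    proof
      fix x show "Y {} x = op_scale H 0 (op_one H) x"
      proof (cases "x \<in> carrier H")
        case True
        then have "0 \<odot> x = \<zero>" by (intro vec_eqI) (auto simp: ip_linear)
        then show ?thesis using True by (simp add: Y_def op_scale_def op_one_def)
      qed (simp add: Y_def op_scale_def)
    qed
    then show ?case using Cs(2) by (simp add: Cs(4) scale)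
  next
    case (insert i F)
    have eq: "Y (insert i F) = op_add H (op_scale H (r i) (A i)) (Y F)"
    proof
      fix x show "Y (insert i F) x = op_add H (op_scale H (r i) (A i)) (Y F) x"
      proof (cases "x \<in> carrier H")
        case True
        then show ?thesis
          using insert.hyps unfolding Y_def op_add_def op_scale_def by (simp add: M.finsum_insert)
      qed (simp add: Y_def op_add_def)
    qed
    have "op_scale H (r i) (A i) \<in> ?C" by (intro Cs(2-5) cstar_generated_mem)
    then show ?case
      using insert unfolding eq by (simp add: Cs(3) add scale cstar_generated_mem real power2_eq_square)
  qed
  define T where "T = Y UNIV"
  have T: "T \<in> ?C" and phiT: "\<phi> T = complex_of_real q"
    using YC[of UNIV] by (auto simp: T_def q_def)
  have Tc [simp]: "T x \<in> carrier H" if "x \<in> carrier H" for x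
    using Cs(1)[OF T] that by (rule bounded_ops_closed)
  have ipT: "ip H (T x) z = (\<Sum>i\<in>UNIV. r i * ip H (A i x) z)" if "x \<in> carrier H" "z \<in> carrier H" for x z
    using that unfolding T_def Y_def by (simp add: ip_finsum_left ip_linear)
  have ipT': "ip H z (T x) = (\<Sum>i\<in>UNIV. r i * ip H z (A i x))" if "x \<in> carrier H" "z \<in> carrier H" for x z
    using that unfolding T_def Y_def by (simp add: ip_finsum_right ip_linear)
  have T_adj: "ip H (T x) z = ip H x (T z)" if "x \<in> carrier H" "z \<in> carrier H" for x z
    using that by (simp add: ipT ipT' is_adjointD(1)[OF adj])
  have TT: "ip H (T x) (T z) = q * ip H x z" if x: "x \<in> carrier H" and z: "z \<in> carrier H" for x z
  proof -
    define S where "S i j = complex_of_real (r i * r j) * ip H (A i (A j x)) z" for i j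
    have S: "S i j = - S j i" if "i \<noteq> j" for i j
      using anti[OF that x z] by (simp add: S_def)
    have "ip H (T x) (T z) = (\<Sum>j\<in>UNIV. r j * ip H (A j x) (T z))" using x z by (intro ipT) auto
    also have "\<dots> = (\<Sum>j\<in>UNIV. \<Sum>i\<in>UNIV. S i j)"
      using x z by (simp add: ipT' S_def sum_distrib_left is_adjointD(1)[OF adj, symmetric] mult_ac)
    also have "\<dots> = (\<Sum>i\<in>UNIV. \<Sum>j\<in>UNIV. S i j)" by (rule sum.swap)
    also have "\<dots> = (\<Sum>i\<in>UNIV. S i i)" by (rule sum_antisymmetric_off_diagonal[OF finite S])
    also have "\<dots> = q * ip H x z"
      using x by (simp add: S_def sq q_def sum_distrib_right power2_eq_square)
    finally show ?thesis .
  qed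
  \<comment> \<open>The centred operator \<open>T - q\<close>; the value of the state at its square
    is the variance.\<close>
  define B where "B = op_add H T (op_scale H (- complex_of_real q) (op_one H))"
  have B: "B \<in> ?C" unfolding B_def by (intro Cs(2-5) T)
  have Bx: "B x = T x \<oplus> (- complex_of_real q) \<odot> x" if "x \<in> carrier H" for x
    using that by (simp add: B_def op_add_def op_scale_def op_one_def)
  have B_adj: "ip H (B x) z = ip H x (B z)" if "x \<in> carrier H" "z \<in> carrier H" for x z
    using that by (simp add: Bx ip_linear T_adj)
  have BB: "op_mult H B B = op_add H (op_scale H (- 2 * complex_of_real q) T) (op_scale H (complex_of_real (q + q\<^sup>2)) (op_one H))"
  proof
    fix x
    show "op_mult H B B x = op_add H (op_scale H (- 2 * complex_of_real q) T) (op_scale H (complex_of_real (q + q\<^sup>2)) (op_one H)) x"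
    proof (cases "x \<in> carrier H")
      case x: True
      have Bc [simp]: "B x \<in> carrier H" if "x \<in> carrier H" for x using that by (simp add: Bx)
      have "B (B x) = (- 2 * complex_of_real q) \<odot> T x \<oplus> complex_of_real (q + q\<^sup>2) \<odot> x"
      proof (rule vec_eqI)
        fix z assume z: "z \<in> carrier H"
        have "ip H (B (B x)) z = ip H (B x) (B z)" using x z by (simp add: B_adj)
        also have "\<dots> = q * ip H x z - q * ip H (T x) z - q * ip H x (T z) + q * q * ip H x z"
          using x z by (simp add: Bx ip_linear TT algebra_simps)
        finally show "ip H (B (B x)) z = ip H ((- 2 * complex_of_real q) \<odot> T x \<oplus> complex_of_real (q + q\<^sup>2) \<odot> x) z"
          using x z by (simp add: ip_linear power2_eq_square algebra_simps flip: T_adj)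
      qed (use x in auto)
      then show ?thesis using x by (simp add: compose_def op_add_def op_scale_def op_one_def)
    qed (simp add: compose_def op_add_def)
  qed
  have "0 \<le> \<phi> (op_mult H B B)" using B B_adj by (intro pos adjI)
  also have "\<phi> (op_mult H B B) = complex_of_real (q - q\<^sup>2)"
    unfolding BB using T by (simp add: add scale Cs one phiT power2_eq_square algebra_simps)
  finally have "0 \<le> q - q\<^sup>2"
    by (simp only: less_eq_complex_def zero_complex.sel Re_complex_of_real)
  then have "q * q \<le> q * 1" by (simp add: power2_eq_square)
  moreover have "0 \<le> q" by (simp add: q_def sum_nonneg)
  ultimately have "q \<le> 1" by (cases "q = 0") (auto simp: mult_le_cancel_left)
  then show ?thesis using that[OF real] by (simp add: q_def)
qed

section \<open>Matrices as operators\<close>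

lemma Cn_simps [simp]:
  "carrier (Cn n) = carrier_vec n" "add (Cn n) = (+)" "zero (Cn n) = 0\<^sub>v n"
  "smult (Cn n) = (\<cdot>\<^sub>v)" "ip (Cn n) = (\<bullet>c)"
  by (simp_all add: Cn_def module.extend_def hilbert.fields_def module_vec_def)

lemma Cn_inner_space: "inner_space (Cn n)"
proof -
  have ring: "cring (class_ring :: complex ring)" "field (class_ring :: complex ring)"
    using vec_vs[where 'a = complex, of n] unfolding vectorspace_def module_def by blast+
  have "abelian_group (Cn n)"
  proof (rule abelian_groupI)
    fix x assume "x \<in> carrier (Cn n)"
    then show "\<exists>y \<in> carrier (Cn n). y \<oplus>\<^bsub>Cn n\<^esub> x = \<zero>\<^bsub>Cn n\<^esub>"
      by (intro bexI[of _ "- x"]) auto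
  qed (auto simp: comm_add_vec[of _ n] assoc_add_vec[of _ n])
  then have "module class_ring (Cn n)"
    by (intro moduleI ring)
      (auto simp: smult_add_distrib_vec add_smult_distrib_vec smult_smult_assoc)
  then have "vectorspace class_ring (Cn n)"
    using ring by (simp add: vectorspace_def)
  moreover have "inner_space_axioms (Cn n)"
  proof
    fix x y z assume "x \<in> carrier (Cn n)" "y \<in> carrier (Cn n)" "z \<in> carrier (Cn n)"
    then show "ip (Cn n) (x \<oplus>\<^bsub>Cn n\<^esub> y) z = ip (Cn n) x z + ip (Cn n) y z"
      by (simp add: add_scalar_prod_distrib[of _ n])
  next
    fix x y and c :: complex assume "x \<in> carrier (Cn n)" "y \<in> carrier (Cn n)"
    then show "ip (Cn n) (c \<odot>\<^bsub>Cn n\<^esub> x) y = c * ip (Cn n) x y" by simp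
  next
    fix x y assume "x \<in> carrier (Cn n)" "y \<in> carrier (Cn n)"
    then show "ip (Cn n) y x = cnj (ip (Cn n) x y)"
      by (simp add: scalar_prod_def mult.commute)
  next
    fix x assume "x \<in> carrier (Cn n)" "x \<noteq> \<zero>\<^bsub>Cn n\<^esub>"
    then have "0 < x \<bullet>c x" by (simp add: conjugate_square_greater_0_vec)
    then show "0 < Re (ip (Cn n) x x)" by (simp add: less_complex_def)
  qed
  ultimately show ?thesis by (simp add: inner_space_def)
qed

lemma ip_Cn: "y \<in> carrier_vec n \<Longrightarrow> x \<bullet>c y = (\<Sum>k<n. x $v k * cnj (y $v k))"
  by (simp add: scalar_prod_def atLeast0LessThan)

lemma hnorm_Cn: "x \<in> carrier_vec n \<Longrightarrow> hnorm (Cn n) x = L2_set (\<lambda>k. cmod (x $v k)) {..<n}"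
  by (simp add: hnorm_def ip_Cn L2_set_def complex_norm_square[symmetric] flip: of_real_power)

lemma mat_adjoint_index:
  "\<lbrakk>i < dim_col A; j < dim_row A\<rbrakk> \<Longrightarrow> mat_adjoint A $$ (i, j) = conjugate (A $$ (j, i))"
  by (simp add: mat_adjoint_def mat_of_rows_index)

lemma mat_op_apply: "\<lbrakk>A \<in> carrier_mat n n; x \<in> carrier_vec n; k < n\<rbrakk> \<Longrightarrow>
    mat_op n A x $v k = (\<Sum>l<n. A $$ (k, l) * x $v l)"
  by (simp add: mat_op_def scalar_prod_def atLeast0LessThan)

lemma mat_op_closed: "\<lbrakk>A \<in> carrier_mat n n; x \<in> carrier_vec n\<rbrakk> \<Longrightarrow> mat_op n A x \<in> carrier_vec n"
  by (simp add: mat_op_def)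

lemma mat_op_bounded:
  assumes A: "A \<in> carrier_mat n n"
  shows "mat_op n A \<in> bounded_ops (Cn n) (Cn n)"
proof (rule bounded_opsI[where C = "\<Sum>k<n. \<Sum>l<n. cmod (A $$ (k, l))"])
  fix x assume "x \<in> carrier (Cn n)"
  then have x: "x \<in> carrier_vec n" by simp
  have "hnorm (Cn n) (mat_op n A x) \<le> (\<Sum>k<n. cmod (mat_op n A x $v k))"
    using mat_op_closed[OF A x] by (simp add: hnorm_Cn L2_set_le_sum)
  also have "\<dots> \<le> (\<Sum>k<n. \<Sum>l<n. cmod (A $$ (k, l)) * hnorm (Cn n) x)"
  proof (rule sum_mono)
    fix k assume "k \<in> {..<n}"
    then have "cmod (mat_op n A x $v k) \<le> (\<Sum>l<n. cmod (A $$ (k, l) * x $v l))"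
      using A x by (simp add: mat_op_apply norm_sum)
    also have "\<dots> \<le> (\<Sum>l<n. cmod (A $$ (k, l)) * hnorm (Cn n) x)"
      using x by (intro sum_mono) (auto simp: norm_mult hnorm_Cn intro!: mult_left_mono member_le_L2_set)
    finally show "cmod (mat_op n A x $v k) \<le> (\<Sum>l<n. cmod (A $$ (k, l)) * hnorm (Cn n) x)" .
  qed
  finally show "hnorm (Cn n) (mat_op n A x) \<le> (\<Sum>k<n. \<Sum>l<n. cmod (A $$ (k, l))) * hnorm (Cn n) x"
    by (simp add: sum_distrib_right)
qed (use A in \<open>auto simp: mat_op_def mult_add_distrib_mat_vec mult_mat_vec\<close>)

lemma mat_op_adjoint:
  assumes A: "A \<in> carrier_mat n n" and herm: "\<And>k l. k < n \<Longrightarrow> l < n \<Longrightarrow> cnj (A $$ (k, l)) = A $$ (l, k)"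
  shows "is_adjoint (Cn n) (Cn n) (mat_op n A) (mat_op n A)"
  unfolding is_adjoint_def
proof (intro conjI ballI mat_op_bounded A)
  fix x y assume "x \<in> carrier (Cn n)" "y \<in> carrier (Cn n)"
  then have x: "x \<in> carrier_vec n" and y: "y \<in> carrier_vec n" by auto
  have "mat_op n A x \<bullet>c y = (\<Sum>k<n. \<Sum>l<n. A $$ (k, l) * x $v l * cnj (y $v k))"
    using A x y by (simp add: ip_Cn mat_op_apply sum_distrib_right)
  also have "\<dots> = (\<Sum>l<n. \<Sum>k<n. A $$ (k, l) * x $v l * cnj (y $v k))" by (rule sum.swap)
  also have "\<dots> = (\<Sum>l<n. \<Sum>k<n. x $v l * (cnj (A $$ (l, k)) * cnj (y $v k)))"
    using herm by (intro sum.cong refl) simp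
  also have "\<dots> = x \<bullet>c mat_op n A y"
    using A x y by (simp add: ip_Cn[OF mat_op_closed[OF A y]] mat_op_apply sum_distrib_left)
  finally show "ip (Cn n) (mat_op n A x) y = ip (Cn n) x (mat_op n A y)" by simp
qed

section \<open>Anticommuting matrices\<close>

text \<open>By doubling: \<open>X i\<close> becomes the block diagonal matrix of \<open>X i\<close>
  and \<open>- X i\<close>, which is \<open>X i\<close> tensored with the Pauli matrix \<sigma>_z,
  and the new generator is the block swap, the identity tensored with \<sigma>_x. The new matrices
  anticommute because \<sigma>_z and \<sigma>_x do, and the blocks on each diagonal cancel in the
  trace.\<close>

lemma clifford_matrices_exist:
  assumes "finite F"
  shows "\<exists>n>0. \<exists>X :: 'd \<Rightarrow> complex mat. (\<forall>i\<in>F. X i \<in> carrier_mat n n \<and>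
    (\<forall>k<n. \<forall>l<n. cnj (X i $$ (k, l)) = X i $$ (l, k)) \<and> X i * X i = 1\<^sub>m n \<and> (\<Sum>k<n. X i $$ (k, k)) = 0) \<and>
    (\<forall>i\<in>F. \<forall>j\<in>F. i \<noteq> j \<longrightarrow> X i * X j = - (X j * X i))"
  using assms
proof (induction F)
  case empty
  \<comment> \<open>Any positive size will do, as the conditions range over no index.\<close>
  show ?case by (auto intro: exI[of _ 1])
next
  case (insert m F)
  then obtain n :: nat and X :: "'d \<Rightarrow> complex mat" where n: "n > 0"
    and P: "\<forall>i\<in>F. X i \<in> carrier_mat n n \<and>
      (\<forall>k<n. \<forall>l<n. cnj (X i $$ (k, l)) = X i $$ (l, k)) \<and> X i * X i = 1\<^sub>m n \<and> (\<Sum>k<n. X i $$ (k, k)) = 0"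
    and anti: "\<forall>i\<in>F. \<forall>j\<in>F. i \<noteq> j \<longrightarrow> X i * X j = - (X j * X i)"
    by (elim exE conjE)
  have X: "X i \<in> carrier_mat n n" if "i \<in> F" for i using P that by blast
  have herm: "cnj (X i $$ (k, l)) = X i $$ (l, k)" if "i \<in> F" "k < n" "l < n" for i k l using P that by blast
  have sq: "X i * X i = 1\<^sub>m n" if "i \<in> F" for i using P that by blast
  define Z :: "complex mat" where "Z = 0\<^sub>m n n"
  define J :: "complex mat" where "J = 1\<^sub>m n"
  have ZJ [simp]: "Z \<in> carrier_mat n n" "J \<in> carrier_mat n n" by (auto simp: Z_def J_def)
  have [simp]: "- 0\<^sub>m n n = (0\<^sub>m n n :: complex mat)" by (intro eq_matI) auto
  define Y where "Y i = (if i = m then four_block_mat Z J J Z else four_block_mat (X i) Z Z (- X i))" for i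
  have Ym: "Y m = four_block_mat Z J J Z" by (simp add: Y_def)
  have Yi: "Y i = four_block_mat (X i) Z Z (- X i)" if "i \<in> F" for i
    using that insert.hyps by (auto simp: Y_def)
  have mult: "four_block_mat A B C D * four_block_mat A' B' C' D' =
      four_block_mat (A * A' + B * C') (A * B' + B * D') (C * A' + D * C') (C * B' + D * D')"
    if "A \<in> carrier_mat n n" "B \<in> carrier_mat n n" "C \<in> carrier_mat n n" "D \<in> carrier_mat n n"
      "A' \<in> carrier_mat n n" "B' \<in> carrier_mat n n" "C' \<in> carrier_mat n n" "D' \<in> carrier_mat n n"
    for A B C D A' B' C' D' :: "complex mat"
    using that by (rule mult_four_block_mat)
  have neg: "- four_block_mat A B C D = four_block_mat (- A) (- B) (- C) (- D)"
    if "A \<in> carrier_mat n n" "B \<in> carrier_mat n n" "C \<in> carrier_mat n n" "D \<in> carrier_mat n n"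
    for A B C D :: "complex mat"
    using that by (intro eq_matI) auto
  have carr: "Y i \<in> carrier_mat (n + n) (n + n)" if "i \<in> insert m F" for i
    using that X Ym Yi ZJ four_block_carrier_mat[of _ n n _ n n] by (metis insert_iff uminus_carrier_iff_mat)
  have hermY: "cnj (Y i $$ (k, l)) = Y i $$ (l, k)" if "i \<in> insert m F" "k < n + n" "l < n + n" for i k l
  proof (cases "i = m")
    case True
    then show ?thesis using that by (auto simp: Ym Z_def J_def)
  next
    case False
    then have "i \<in> F" using that by simp
    then show ?thesis using that X[of i] herm[of i] by (auto simp: Yi Z_def)
  qed
  have split: "(\<Sum>k<n + m. f k) = (\<Sum>k<n. f k) + (\<Sum>k<m. f (n + k))" for f :: "nat \<Rightarrow> complex" and m
    by (induction m) (simp_all add: add.assoc)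
  have tr: "(\<Sum>k<n + n. Y i $$ (k, k)) = 0" if "i \<in> insert m F" for i
  proof (cases "i = m")
    case True
    then show ?thesis unfolding split by (simp add: Ym Z_def J_def)
  next
    case False
    then have "i \<in> F" using that by simp
    then show ?thesis using X[of i] unfolding split by (simp add: Yi Z_def sum_negf)
  qed
  have sqY: "Y i * Y i = 1\<^sub>m (n + n)" if "i \<in> insert m F" for i
  proof (cases "i = m")
    case True
    then show ?thesis by (simp add: Ym mult) (simp add: Z_def J_def)
  next
    case False
    then have i: "i \<in> F" using that by simp
    then show ?thesis using X[OF i] by (simp add: Yi mult) (simp add: Z_def sq[OF i])
  qed
  have antim: "Y i * Y m = - (Y m * Y i)" if i: "i \<in> F" for i
    using X[OF i] by (simp add: Yi[OF i] Ym mult neg) (simp add: Z_def J_def neg)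
  have antiY: "Y i * Y j = - (Y j * Y i)" if ij: "i \<in> F" "j \<in> F" "i \<noteq> j" for i j
  proof -
    have ij_anti: "X i * X j = - (X j * X i)" using anti ij by blast
    show ?thesis
      using X[OF ij(1)] X[OF ij(2)]
      by (simp add: Yi[OF ij(1)] Yi[OF ij(2)] mult neg) (simp add: Z_def ij_anti neg mult_carrier_mat[of _ n n _ n])
  qed
  have anti_all: "Y i * Y j = - (Y j * Y i)" if ij: "i \<in> insert m F" "j \<in> insert m F" "i \<noteq> j" for i j
  proof -
    consider "i = m" "j \<in> F" | "j = m" "i \<in> F" | "i \<in> F" "j \<in> F" using ij by blast
    then show ?thesis
    proof cases
      case 1
      then show ?thesis using antim[of j] X[of j] by simp
    next
      case 2
      then show ?thesis using antim[of i] by blast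
    next
      case 3
      then show ?thesis using antiY \<open>i \<noteq> j\<close> by blast
    qed
  qed
  have pos: "0 < n + n" using n by simp
  show ?case
    by (intro exI[of _ "n + n"] conjI exI[of _ Y] ballI allI impI pos carr hermY tr sqY anti_all) assumption+
qed

section \<open>Minimality\<close>

lemma scaled_lp_ball_1:
  assumes "c > 0"
  shows "(\<lambda>x. c *\<^sub>R x) ` (lp_ball 1 :: (real ^ 'd::finite) set) = {y. (\<Sum>i\<in>UNIV. \<bar>y $ i\<bar>) \<le> c}"
proof -
  have ball: "x \<in> lp_ball 1 \<longleftrightarrow> (\<Sum>i\<in>UNIV. \<bar>x $ i\<bar>) \<le> 1" for x :: "real ^ 'd"
    by (simp add: lp_ball_def lp_norm_def sum_nonneg)
  show ?thesis
  proof safe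
    fix x :: "real ^ 'd" assume "x \<in> lp_ball 1"
    then have "c * (\<Sum>i\<in>UNIV. \<bar>x $ i\<bar>) \<le> c * 1" using assms unfolding ball by (intro mult_left_mono) auto
    then show "(\<Sum>i\<in>UNIV. \<bar>(c *\<^sub>R x) $ i\<bar>) \<le> c" using assms by (simp add: abs_mult sum_distrib_left)
  next
    fix y :: "real ^ 'd" assume y: "(\<Sum>i\<in>UNIV. \<bar>y $ i\<bar>) \<le> c"
    have "(\<Sum>i\<in>UNIV. \<bar>(inverse c *\<^sub>R y) $ i\<bar>) = (\<Sum>i\<in>UNIV. \<bar>y $ i\<bar>) / c"
      using assms by (simp add: abs_mult divide_inverse_commute flip: sum_distrib_left)
    then have "inverse c *\<^sub>R y \<in> lp_ball 1" using y assms unfolding ball by (simp add: pos_divide_le_eq)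
    then show "y \<in> (\<lambda>x. c *\<^sub>R x) ` lp_ball 1"
      by (rule rev_image_eqI) (use assms in simp)
  qed
qed

lemma lp_ball_2: "x \<in> lp_ball 2 \<longleftrightarrow> (\<Sum>i\<in>UNIV. (x $ i)\<^sup>2) \<le> 1"
proof -
  have "\<bar>t\<bar> powr 2 = t\<^sup>2" for t :: real by (cases "t = 0") (auto simp: powr_numeral)
  moreover have "(s powr (1 / 2) \<le> 1) = (s \<le> 1)" if "0 \<le> s" for s :: real
    using that by (simp add: powr_half_sqrt)
  ultimately show ?thesis by (simp add: lp_ball_def lp_norm_def sum_nonneg)
qed

text \<open>Isometries are defined by norms, so polarisation is needed: the real part comes from the
  norm of a sum, the imaginary part from the real part with \<open>x\<close> multiplied by the
  imaginary unit.\<close>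

lemma isometry_ip:
  assumes "inner_space H\<^sub>1" "inner_space H\<^sub>2" and V: "isometry_op H\<^sub>1 H\<^sub>2 V"
    and x: "x \<in> carrier H\<^sub>1" and y: "y \<in> carrier H\<^sub>1"
  shows "ip H\<^sub>2 (V x) (V y) = ip H\<^sub>1 x y"
proof -
  interpret A: inner_space H\<^sub>1 by fact
  interpret B: inner_space H\<^sub>2 by fact
  have bdd: "V \<in> bounded_ops H\<^sub>1 H\<^sub>2" using V unfolding isometry_op_def by blast
  note [simp] = bounded_ops_closed[OF bdd]
  have norm: "Re (ip H\<^sub>2 (V x) (V x)) = Re (ip H\<^sub>1 x x)" if "x \<in> carrier H\<^sub>1" for x
  proof -
    have "(hnorm H\<^sub>2 (V x))\<^sup>2 = (hnorm H\<^sub>1 x)\<^sup>2"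
      using V that unfolding isometry_op_def by simp
    then show ?thesis using that by (simp add: A.hnorm_sq B.hnorm_sq)
  qed
  have re: "Re (ip H\<^sub>2 (V x) (V y)) = Re (ip H\<^sub>1 x y)" if x: "x \<in> carrier H\<^sub>1" and y: "y \<in> carrier H\<^sub>1" for x y
  proof -
    have "Re (ip H\<^sub>2 (V y) (V x)) = Re (ip H\<^sub>2 (V x) (V y))" "Re (ip H\<^sub>1 y x) = Re (ip H\<^sub>1 x y)"
      using x y A.ip_commute[of x y] B.ip_commute[of "V x" "V y"] by simp_all
    then show ?thesis
      using norm[of "x \<oplus>\<^bsub>H\<^sub>1\<^esub> y"] norm[OF x] norm[OF y] x y
      by (simp add: bounded_ops_add[OF bdd] A.ip_linear B.ip_linear)
  qed
  have "Im (ip H\<^sub>2 (V x) (V y)) = Im (ip H\<^sub>1 x y)"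
    using re[of "\<i> \<odot>\<^bsub>H\<^sub>1\<^esub> x" y] x y by (simp add: bounded_ops_smult[OF bdd] A.ip_linear B.ip_linear)
  then show ?thesis using re[OF x y] by (simp add: complex_eq_iff)
qed

lemma uminus_mat_mult_vec:
  fixes M :: "complex mat"
  assumes "M \<in> carrier_mat n n" "x \<in> carrier_vec n"
  shows "(- M) *\<^sub>v x = - (M *\<^sub>v x)"
  using assms by (intro eq_vecI) auto

text \<open>The matrix identities are unfolded into sums of entries, the form in which
  \<open>clifford_dilation\<close> assumes them.\<close>

lemma clifford_matrices:
  obtains n and X :: "'d::finite \<Rightarrow> complex mat"
  where "0 < n" "X \<in> Wmax (lp_ball 2) n"
    "\<forall>i. \<forall>k<n. \<forall>l<n. cnj (X i $$ (k, l)) = X i $$ (l, k)"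
    "\<forall>i. \<forall>k<n. \<forall>l<n. (\<Sum>m<n. X i $$ (k, m) * X i $$ (m, l)) = (if k = l then 1 else 0)"
    "\<forall>i j. i \<noteq> j \<longrightarrow> (\<forall>k<n. \<forall>l<n.
      (\<Sum>m<n. X i $$ (k, m) * X j $$ (m, l)) = - (\<Sum>m<n. X j $$ (k, m) * X i $$ (m, l)))"
    "\<forall>i. (\<Sum>k<n. X i $$ (k, k)) = 0"
proof -
  obtain n :: nat and X :: "'d \<Rightarrow> complex mat" where n: "n > 0"
    and P: "\<forall>i\<in>UNIV. X i \<in> carrier_mat n n \<and>
      (\<forall>k<n. \<forall>l<n. cnj (X i $$ (k, l)) = X i $$ (l, k)) \<and> X i * X i = 1\<^sub>m n \<and> (\<Sum>k<n. X i $$ (k, k)) = 0"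
    and anti': "\<forall>i\<in>UNIV. \<forall>j\<in>UNIV. i \<noteq> j \<longrightarrow> X i * X j = - (X j * X i)"
    using clifford_matrices_exist[OF finite, of UNIV] by (elim exE conjE)
  have X [simp]: "X i \<in> carrier_mat n n" for i using P by blast
  have herm: "cnj (X i $$ (k, l)) = X i $$ (l, k)" if "k < n" "l < n" for i k l using P that by blast
  have sq: "X i * X i = 1\<^sub>m n" for i using P by blast
  have anti: "X i * X j = - (X j * X i)" if "i \<noteq> j" for i j using anti' that by blast
  have dims [simp]: "dim_row (X i) = n" "dim_col (X i) = n" for i using carrier_matD[OF X] by auto
  have index: "(X i * X j) $$ (k, l) = (\<Sum>m<n. X i $$ (k, m) * X j $$ (m, l))" if "k < n" "l < n" for i j k l
    using that by (simp add: scalar_prod_def atLeast0LessThan)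
  have sa: "X \<in> sa_tuples n"
    unfolding sa_tuples_def
  proof (intro CollectI allI conjI X)
    fix i
    show "mat_adjoint (X i) = X i"
      by (rule eq_matI) (auto simp: mat_adjoint_index herm, auto simp: mat_adjoint_def)
  qed
  have "W1 (Cn n) (\<lambda>i. mat_op n (X i)) \<subseteq> complexify ` lp_ball 2"
  proof
    fix w assume "w \<in> W1 (Cn n) (\<lambda>i. mat_op n (X i))"
    then obtain \<phi> where w: "w = (\<chi> i. \<phi> (mat_op n (X i)))"
      and st: "state (Cn n) (cstar_generated (Cn n) (\<lambda>i. mat_op n (X i))) \<phi>"
      unfolding W1_def by blast
    obtain r where r: "\<And>i. \<phi> (mat_op n (X i)) = complex_of_real (r i)" "(\<Sum>i\<in>UNIV. (r i)\<^sup>2) \<le> 1"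
    proof (rule state_anticommuting_involutions[OF Cn_inner_space _ _ _ st])
      show "is_adjoint (Cn n) (Cn n) (mat_op n (X i)) (mat_op n (X i))" for i
        by (rule mat_op_adjoint) (auto simp: herm)
      show "mat_op n (X i) (mat_op n (X i) x) = x" if "x \<in> carrier (Cn n)" for i x
        using that assoc_mult_mat_vec[OF X X, of x i i] mult_mat_vec_carrier[OF X, of x i]
        by (simp add: mat_op_def sq)
      show "ip (Cn n) (mat_op n (X i) (mat_op n (X j) x)) z = - ip (Cn n) (mat_op n (X j) (mat_op n (X i) x)) z"
        if "i \<noteq> j" "x \<in> carrier (Cn n)" "z \<in> carrier (Cn n)" for i j x z
      proof -
        have "X i *\<^sub>v (X j *\<^sub>v x) = (X i * X j) *\<^sub>v x"
          using that assoc_mult_mat_vec[OF X X, of x i j] by simp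
        also have "\<dots> = - ((X j * X i) *\<^sub>v x)"
          unfolding anti[OF that(1)] using that by (intro uminus_mat_mult_vec[of _ n]) auto
        also have "(X j * X i) *\<^sub>v x = X j *\<^sub>v (X i *\<^sub>v x)"
          using that assoc_mult_mat_vec[OF X X, of x j i] by simp
        finally show ?thesis
          using that mult_mat_vec_carrier[OF X, of x] by (simp add: mat_op_def uminus_scalar_prod[of _ n])
      qed
    qed blast
    have "w = complexify (\<chi> i. r i)" by (simp add: w r(1) complexify_def)
    moreover have "(\<chi> i. r i) \<in> lp_ball 2" using r(2) by (simp add: lp_ball_2)
    ultimately show "w \<in> complexify ` lp_ball 2" by blast
  qed
  then have Wm: "X \<in> Wmax (lp_ball 2) n" using sa by (simp add: Wmax_def)
  have sq_sum: "(\<Sum>m<n. X i $$ (k, m) * X i $$ (m, l)) = (if k = l then 1 else 0)" if "k < n" "l < n" for i k l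
    using that index[of k l i i] by (simp add: sq)
  have anti_sum: "(\<Sum>m<n. X i $$ (k, m) * X j $$ (m, l)) = - (\<Sum>m<n. X j $$ (k, m) * X i $$ (m, l))"
    if "i \<noteq> j" "k < n" "l < n" for i j k l
  proof -
    have "(X i * X j) $$ (k, l) = - ((X j * X i) $$ (k, l))"
      unfolding anti[OF that(1)] using that by simp
    then show ?thesis using that by (simp only: index)
  qed
  have trace: "(\<Sum>k<n. X i $$ (k, k)) = 0" for i using P by blast
  show ?thesis
    using herm sq_sum anti_sum trace by (intro that[OF n Wm]) blast+
qed

lemma dilation_hull_extreme_point:
  fixes L :: "(real ^ 'd::finite) set"
  assumes hull: "L \<in> dilation_hulls TYPE('u) (lp_ball 2)"
    and L: "L \<subseteq> {y. (\<Sum>i\<in>UNIV. \<bar>y $ i\<bar>) \<le> real CARD('d)}"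
    and \<sigma>: "\<sigma> \<in> {1, -1}"
  shows "axis i (\<sigma> * real CARD('d)) \<in> L"
proof -
  obtain n and X :: "'d \<Rightarrow> complex mat" where n: "0 < n" and W: "X \<in> Wmax (lp_ball 2) n"
    and X: "\<forall>i. \<forall>k<n. \<forall>l<n. cnj (X i $$ (k, l)) = X i $$ (l, k)"
    "\<forall>i. \<forall>k<n. \<forall>l<n. (\<Sum>m<n. X i $$ (k, m) * X i $$ (m, l)) = (if k = l then 1 else 0)"
    "\<forall>i j. i \<noteq> j \<longrightarrow> (\<forall>k<n. \<forall>l<n.
      (\<Sum>m<n. X i $$ (k, m) * X j $$ (m, l)) = - (\<Sum>m<n. X j $$ (k, m) * X i $$ (m, l)))"
    "\<forall>i. (\<Sum>k<n. X i $$ (k, k)) = 0"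
    by (rule clifford_matrices)
  have "Wmax (lp_ball 2) n \<subseteq> Wmin TYPE('u) L n"
    using hull n unfolding dilation_hulls_def by (simp add: Suc_le_eq)
  then have "X \<in> Wmin TYPE('u) L n" using W by blast
  then obtain H :: "((nat \<Rightarrow> complex) + 'u) hilbert" and N V Vs where H: "hilbert_space H"
    and N: "normal_tuple H N" "joint_spectrum H N \<subseteq> complexify ` L"
    and V: "isometry_op (Cn n) H V" "is_adjoint (Cn n) H V Vs"
    and dil: "\<And>i. mat_op n (X i) = compose (carrier (Cn n)) Vs (compose (carrier (Cn n)) (N i) V)"
    and sa: "X \<in> sa_tuples n"
    unfolding Wmin_def dilation_def by blast
  interpret real_normal_tuple H N L
    using H N by (intro real_normal_tuple.intro hilbert_space_inner_space real_normal_tuple_axioms.intro)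
  have Xc: "X i \<in> carrier_mat n n" for i using sa by (simp add: sa_tuples_def)
  have bdd: "V \<in> bounded_ops (Cn n) H" "Vs \<in> bounded_ops H (Cn n)" using V(2) unfolding is_adjoint_def by auto
  define v where "v k = V (unit_vec n k)" for k
  have v: "v k \<in> carrier H" for k
    unfolding v_def by (rule bounded_ops_closed[OF bdd(1)]) simp
  interpret clifford_dilation H N L n v "\<lambda>i k l. X i $$ (k, l)" "real CARD('d)"
  proof
    show "ip H (v k) (v l) = (if k = l then 1 else 0)" if "k < n" "l < n" for k l
    proof -
      have "ip H (v k) (v l) = ip (Cn n) (unit_vec n k) (unit_vec n l)"
        unfolding v_def using H V(1) by (intro isometry_ip Cn_inner_space hilbert_space_inner_space) auto
      also have "\<dots> = (\<Sum>m<n. if m = l then (if k = l then 1 else 0) else 0)"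
        unfolding Cn_simps ip_Cn[OF unit_vec_carrier] by (intro sum.cong refl) (use that in auto)
      finally show ?thesis using that by simp
    qed
    show "ip H (N i (v l)) (v k) = X i $$ (k, l)" if "k < n" "l < n" for i k l
    proof -
      have c: "Vs (N i (v l)) \<in> carrier_vec n"
        using bounded_ops_closed[OF bdd(2), of "N i (v l)"] v by simp
      have eq: "Vs (N i (v l)) = mat_op n (X i) (unit_vec n l)"
        unfolding dil by (simp add: compose_def v_def)
      have "ip H (N i (v l)) (v k) = cnj (ip H (v k) (N i (v l)))"
        using v by (intro ip_commute) auto
      also have "ip H (v k) (N i (v l)) = ip (Cn n) (unit_vec n k) (Vs (N i (v l)))"
        using V(2) v unfolding is_adjoint_def v_def by simp
      also have "cnj \<dots> = (\<Sum>m<n. if m = k then Vs (N i (v l)) $v m else 0)"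
        unfolding Cn_simps ip_Cn[OF c] cnj_sum by (intro sum.cong refl) (use that in auto)
      also have "\<dots> = mat_op n (X i) (unit_vec n l) $v k" using that by (simp add: eq)
      also have "\<dots> = (\<Sum>m<n. if m = l then X i $$ (k, m) else 0)"
        unfolding mat_op_apply[OF Xc unit_vec_carrier that(1)] by (intro sum.cong refl) (use that in auto)
      finally show ?thesis using that by simp
    qed
    show "(\<Sum>i\<in>UNIV. \<bar>p $ i\<bar>) \<le> real CARD('d)" if "p \<in> L" for p using L that by blast
    show "0 < n" by fact
    show "v k \<in> carrier H" for k by (rule v)
    show "cnj (X i $$ (k, l)) = X i $$ (l, k)" if "k < n" "l < n" for i k l
      by (rule X(1)[rule_format, OF that])
    show "(\<Sum>m<n. X i $$ (k, m) * X i $$ (m, l)) = (if k = l then 1 else 0)" if "k < n" "l < n" for i k l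
      by (rule X(2)[rule_format, OF that])
    show "(\<Sum>m<n. X i $$ (k, m) * X j $$ (m, l)) = - (\<Sum>m<n. X j $$ (k, m) * X i $$ (m, l))"
      if "i \<noteq> j" "k < n" "l < n" for i j k l
      by (rule X(3)[rule_format, OF that])
    show "(\<Sum>k<n. X i $$ (k, k)) = 0" for i by (rule X(4)[rule_format])
  qed (rule refl)
  obtain p where p: "p \<in> L" "p $ i = \<sigma> * real CARD('d)" using extreme_point[OF \<sigma>] by blast
  \<comment> \<open>The i-th coordinate alone exhausts the l1 norm that points of \<open>L\<close>
    may have.\<close>
  have "p $ j = 0" if "j \<noteq> i" for j
  proof -
    have "(\<Sum>k\<in>{i, j}. \<bar>p $ k\<bar>) \<le> (\<Sum>k\<in>UNIV. \<bar>p $ k\<bar>)" by (rule sum_mono2) auto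
    also have "\<dots> \<le> real CARD('d)" using L p(1) by blast
    finally have "\<bar>p $ i\<bar> + \<bar>p $ j\<bar> \<le> real CARD('d)" using that by simp
    moreover have "\<bar>p $ i\<bar> = real CARD('d)" using p(2) \<sigma> by (auto simp: abs_mult)
    ultimately show ?thesis by simp
  qed
  then have "p = axis i (\<sigma> * real CARD('d))" using p(2) by (auto simp: Finite_Cartesian_Product.vec_eq_iff axis_def)
  then show ?thesis using p(1) by simp
qed

text \<open>With \<open>q\<close> the l1 norm of a nonzero \<open>y\<close>, the point
  \<open>y\<close> is \<open>q / c\<close> times a convex combination of the vertices that match the
  signs of \<open>y\<close>, with weights proportional to the absolute coordinates; the remaining
  weight \<open>1 - q / c\<close> goes to 0.\<close>

lemma cross_polytope_subset:
  fixes L :: "(real ^ 'd::finite) set"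
  assumes L: "convex L" "0 \<in> L" and c: "c > 0"
    and ext: "\<And>i \<sigma>. \<sigma> \<in> {1, -1} \<Longrightarrow> axis i (\<sigma> * c) \<in> L"
  shows "{y. (\<Sum>i\<in>UNIV. \<bar>y $ i\<bar>) \<le> c} \<subseteq> L"
proof
  fix y :: "real ^ 'd" assume "y \<in> {y. (\<Sum>i\<in>UNIV. \<bar>y $ i\<bar>) \<le> c}"
  define q where "q = (\<Sum>i\<in>UNIV. \<bar>y $ i\<bar>)"
  have q: "0 \<le> q" "q \<le> c" using \<open>y \<in> _\<close> by (auto simp: q_def sum_nonneg)
  show "y \<in> L"
  proof (cases "q = 0")
    case True
    then have "y = 0" by (simp add: q_def sum_nonneg_eq_0_iff Finite_Cartesian_Product.vec_eq_iff)
    then show ?thesis using L by simp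
  next
    case False
    define P where "P i = axis i ((if y $ i \<ge> 0 then 1 else -1) * c)" for i :: 'd
    have "(\<Sum>i\<in>UNIV. (\<bar>y $ i\<bar> / q) *\<^sub>R P i) \<in> L"
    proof (rule convex_sum[OF _ L(1)])
      show "(\<Sum>i\<in>UNIV. \<bar>y $ i\<bar> / q) = 1" using False by (simp add: q_def flip: sum_divide_distrib)
      show "P i \<in> L" for i unfolding P_def by (rule ext) auto
    qed (use q in auto)
    then have "(q / c) *\<^sub>R (\<Sum>i\<in>UNIV. (\<bar>y $ i\<bar> / q) *\<^sub>R P i) + (1 - q / c) *\<^sub>R 0 \<in> L"
      using q c L by (intro convexD[OF L(1)]) auto
    moreover have "(q / c) *\<^sub>R (\<Sum>i\<in>UNIV. (\<bar>y $ i\<bar> / q) *\<^sub>R P i) = y"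
    proof (subst Finite_Cartesian_Product.vec_eq_iff, intro allI)
      fix j
      have "((q / c) *\<^sub>R (\<Sum>i\<in>UNIV. (\<bar>y $ i\<bar> / q) *\<^sub>R P i)) $ j =
          (q / c) * (\<Sum>i\<in>UNIV. (\<bar>y $ i\<bar> / q) * P i $ j)"
        by (simp add: sum_component)
      also have "\<dots> = (q / c) *
          (\<Sum>i\<in>UNIV. if i = j then (\<bar>y $ j\<bar> / q) * ((if y $ j \<ge> 0 then 1 else -1) * c) else 0)"
        by (intro arg_cong2[where f = "(*)"] sum.cong refl) (simp add: P_def axis_def)
      also have "\<dots> = y $ j" using False c by simp
      finally show "((q / c) *\<^sub>R (\<Sum>i\<in>UNIV. (\<bar>y $ i\<bar> / q) *\<^sub>R P i)) $ j = y $ j" .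
    qed
    ultimately show ?thesis by simp
  qed
qed

section \<open>A normal dilation with joint spectrum in the cross-polytope\<close>

section \<open>Block spaces\<close>

text \<open>The Cayley-Hamilton theorem in factored form, by Schur triangularisation. It serves to
  confine characters: the value of a character at an operator is a root of every polynomial that
  annihilates the operator.\<close>

lemma annihilating_eigenvalues:
  fixes A :: "complex mat"
  assumes A: "A \<in> carrier_mat n n"
  obtains bs where "\<forall>b \<in> set bs. eigenvalue A b"
    "\<forall>x \<in> carrier_vec n. foldr (\<lambda>b y. A *\<^sub>v y - b \<cdot>\<^sub>v y) bs x = 0\<^sub>v n"
proof -
  obtain bs where bs: "char_poly A = (\<Prod>b\<leftarrow>bs. [:- b, 1:])" "length bs = n"
    using char_poly_factorized[OF A] by blast
  obtain B P Q where schur: "schur_decomposition A bs = (B, P, Q)"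
    by (cases "schur_decomposition A bs")
  have sim: "similar_mat_wit A B P Q" and ut: "upper_triangular B" and diag: "diag_mat B = bs"
    using schur_decomposition[OF A bs(1) schur] by auto
  note PQ = similar_mat_witD2[OF A sim]
  have ev: "eigenvalue A b" if "b \<in> set bs" for b
    unfolding eigenvalue_root_char_poly[OF A] bs(1) poly_prod_list
    using that by (auto simp: prod_list_zero_iff)
  define f where "f M b y = M *\<^sub>v y - b \<cdot>\<^sub>v y" for M b and y :: "complex Matrix.vec"
  have f_closed: "foldr (f M) cs x \<in> carrier_vec n" if "M \<in> carrier_mat n n" "x \<in> carrier_vec n" for M cs x
    using that by (induction cs) (auto simp: f_def)
  \<comment> \<open>\<open>foldr\<close> applies the last factor first. For the upper triangular
    \<open>B\<close> each factor kills one more coordinate from the bottom, so the factors from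
    position \<open>k\<close> on leave only the first \<open>k\<close> coordinates.\<close>
  have triangular: "\<forall>i. k \<le> i \<and> i < n \<longrightarrow> foldr (f B) (drop k bs) x $v i = 0"
    if "k \<le> n" and x: "x \<in> carrier_vec n" for k x
    using that(1)
  proof (induction rule: inc_induct)
    case base
    show ?case by (auto dest: leD)
  next
    case (step k)
    define y where "y = foldr (f B) (drop (Suc k) bs) x"
    have y: "y \<in> carrier_vec n" unfolding y_def by (rule f_closed[OF PQ(5) x])
    have y0: "y $v i = 0" if "Suc k \<le> i" "i < n" for i using step.IH that by (simp add: y_def)
    have "drop k bs = bs ! k # drop (Suc k) bs" using step bs(2) by (simp add: Cons_nth_drop_Suc)
    then have eq: "foldr (f B) (drop k bs) x = B *\<^sub>v y - bs ! k \<cdot>\<^sub>v y" by (simp add: y_def f_def)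
    have bk: "bs ! k = B $$ (k, k)"
      using step PQ(5) by (simp flip: diag add: diag_mat_def)
    show ?case
    proof (intro allI impI)
      fix i assume i: "k \<le> i \<and> i < n"
      have "(B *\<^sub>v y) $v i = (\<Sum>m<n. B $$ (i, m) * y $v m)"
        using PQ(5) y i by (simp add: scalar_prod_def atLeast0LessThan)
      also have "\<dots> = (\<Sum>m<n. if m = k then B $$ (i, k) * y $v k else 0)"
      proof (intro sum.cong refl)
        fix m assume m: "m \<in> {..<n}"
        show "B $$ (i, m) * y $v m = (if m = k then B $$ (i, k) * y $v k else 0)"
          using upper_triangularD[OF ut, of m i] y0[of m] m i PQ(5) by (cases "m < k") auto
      qed
      also have "\<dots> = B $$ (i, k) * y $v k" using step by simp
      finally have "(B *\<^sub>v y) $v i = B $$ (i, k) * y $v k" .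
      \<comment> \<open>Below the diagonal both sides have a zero factor: \<open>B $$ (i, k)\<close>
        by triangularity and \<open>y $v i\<close> by the induction hypothesis.\<close>
      moreover have "B $$ (i, k) * y $v k = B $$ (k, k) * y $v i"
        using upper_triangularD[OF ut, of k i] y0[of i] i PQ(5) by (cases "i = k") auto
      ultimately show "foldr (f B) (drop k bs) x $v i = 0"
        using PQ(5) y i by (simp add: eq bk)
    qed
  qed
  have zero: "foldr (f B) bs x = 0\<^sub>v n" if "x \<in> carrier_vec n" for x
    using triangular[of 0 x] that f_closed[OF PQ(5) that, of bs] by (intro eq_vecI) auto
  have conj: "foldr (f A) cs (P *\<^sub>v x) = P *\<^sub>v foldr (f B) cs x" if x: "x \<in> carrier_vec n" for cs x
  proof (induction cs)
    case (Cons b cs)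
    define y where "y = foldr (f B) cs x"
    have y: "y \<in> carrier_vec n" unfolding y_def by (rule f_closed[OF PQ(5) x])
    have "A *\<^sub>v (P *\<^sub>v y) = (A * P) *\<^sub>v y" using PQ y by (simp add: assoc_mult_mat_vec[of _ n n _ n])
    also have "A * P = P * B * (Q * P)"
      using PQ(3,5,6,7) by (simp add: assoc_mult_mat[of _ n n _ n _ n])
    also have "\<dots> = P * B" using PQ by (simp add: right_mult_one_mat[of _ n n])
    also have "(P * B) *\<^sub>v y = P *\<^sub>v (B *\<^sub>v y)" using PQ y by (simp add: assoc_mult_mat_vec[of _ n n _ n])
    finally have "f A b (P *\<^sub>v y) = P *\<^sub>v f B b y"
      using PQ y by (simp add: f_def mult_minus_distrib_mat_vec[of _ n n] mult_mat_vec[of _ n n])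
    then show ?case using Cons by (simp add: y_def)
  qed simp
  have "foldr (f A) bs x = 0\<^sub>v n" if x: "x \<in> carrier_vec n" for x
  proof -
    have "P *\<^sub>v (Q *\<^sub>v x) = x" using PQ x assoc_mult_mat_vec[of P n n Q n x] by simp
    then have "foldr (f A) bs x = P *\<^sub>v foldr (f B) bs (Q *\<^sub>v x)"
      using conj[of "Q *\<^sub>v x" bs] PQ x by simp
    also have "\<dots> = P *\<^sub>v 0\<^sub>v n" using zero PQ x by simp
    also have "P *\<^sub>v 0\<^sub>v n = 0\<^sub>v n" using PQ(6) by (intro eq_vecI) auto
    finally show ?thesis .
  qed
  then show ?thesis using that[of bs] ev unfolding f_def by blast
qed

text \<open>The vectors are functions on \<open>nat\<close> in the left summand because
  \<open>Wmin\<close> quantifies over spaces in the type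
  \<open>(nat \<Rightarrow> complex) + 'u\<close>. Vanishing outside \<open>I\<close> makes the
  inner product definite.\<close>

definition fin_space :: "nat set \<Rightarrow> ((nat \<Rightarrow> complex) + 'u) hilbert" where
  "fin_space I = \<lparr>carrier = Inl ` {f. \<forall>e. e \<notin> I \<longrightarrow> f e = 0}, mult = undefined, one = undefined,
     zero = Inl (\<lambda>_. 0), add = (\<lambda>x y. Inl (\<lambda>e. projl x e + projl y e)),
     smult = (\<lambda>c x. Inl (\<lambda>e. c * projl x e)), ip = (\<lambda>x y. \<Sum>e\<in>I. projl x e * cnj (projl y e))\<rparr>"

lemma fin_space_simps [simp]:
  "carrier (fin_space I) = Inl ` {f. \<forall>e. e \<notin> I \<longrightarrow> f e = 0}" "zero (fin_space I) = Inl (\<lambda>_. 0)"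
  "add (fin_space I) x y = Inl (\<lambda>e. projl x e + projl y e)"
  "smult (fin_space I) c x = Inl (\<lambda>e. c * projl x e)"
  "ip (fin_space I) x y = (\<Sum>e\<in>I. projl x e * cnj (projl y e))"
  by (simp_all add: fin_space_def)

lemma fin_space_inner_space:
  assumes I: "finite I"
  shows "inner_space (fin_space I)"
proof -
  have ring: "cring (class_ring :: complex ring)" "field (class_ring :: complex ring)"
    using vec_vs[where 'a = complex, of 0] unfolding vectorspace_def module_def by blast+
  have "abelian_group (fin_space I)"
  proof (rule abelian_groupI)
    fix x assume "x \<in> carrier (fin_space I)"
    then show "\<exists>y \<in> carrier (fin_space I). y \<oplus>\<^bsub>fin_space I\<^esub> x = \<zero>\<^bsub>fin_space I\<^esub>"
      by (intro bexI[of _ "Inl (\<lambda>e. - projl x e)"]) auto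
  qed (auto simp: algebra_simps)
  then have "module class_ring (fin_space I)"
    by (intro moduleI ring) (auto simp: algebra_simps)
  then have "vectorspace class_ring (fin_space I)"
    using ring by (simp add: vectorspace_def)
  moreover have "inner_space_axioms (fin_space I)"
  proof
    fix x assume "x \<in> carrier (fin_space I)" "x \<noteq> \<zero>\<^bsub>fin_space I\<^esub>"
    then obtain f where f: "x = Inl f" "\<forall>e. e \<notin> I \<longrightarrow> f e = 0" "f \<noteq> (\<lambda>_. 0)" by auto
    then obtain e where e: "f e \<noteq> 0" by blast
    then have "e \<in> I" using f by blast
    then have "0 < (\<Sum>e\<in>I. (cmod (f e))\<^sup>2)" using I e by (intro sum_pos2[of _ e]) auto
    then show "0 < Re (ip (fin_space I) x x)"
      by (simp add: f complex_norm_square[symmetric] flip: of_real_power)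
  qed (auto simp: algebra_simps sum.distrib sum_distrib_left)
  ultimately show ?thesis by (simp add: inner_space_def)
qed

lemma hnorm_fin_space: "hnorm (fin_space I) x = L2_set (\<lambda>e. cmod (projl x e)) I"
  by (simp add: hnorm_def L2_set_def complex_norm_square[symmetric] flip: of_real_power)

lemma fin_space_hilbert_space:
  assumes I: "finite I"
  shows "hilbert_space (fin_space I :: ((nat \<Rightarrow> complex) + 'u) hilbert)"
proof -
  let ?H = "fin_space I :: ((nat \<Rightarrow> complex) + 'u) hilbert"
  interpret inner_space ?H by (rule fin_space_inner_space[OF I])
  have minus: "x \<ominus>\<^bsub>?H\<^esub> y = Inl (\<lambda>e. projl x e - projl y e)" if "x \<in> carrier ?H" "y \<in> carrier ?H" for x y
  proof (rule vec_eqI)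
    fix z assume z: "z \<in> carrier ?H"
    show "ip ?H (x \<ominus>\<^bsub>?H\<^esub> y) z = ip ?H (Inl (\<lambda>e. projl x e - projl y e)) z"
      unfolding ip_minus_left[OF that z] by (simp add: left_diff_distrib sum_subtractf)
  next
    show "x \<ominus>\<^bsub>?H\<^esub> y \<in> carrier ?H" using that by (rule M.minus_closed)
  qed (use that in auto)
  have "hilbert_space_axioms ?H"
  proof
    fix s assume s: "\<And>k :: nat. s k \<in> carrier ?H"
      and cauchy: "\<And>e. 0 < e \<Longrightarrow> \<exists>M. \<forall>k\<ge>M. \<forall>m\<ge>M. hnorm ?H (s k \<ominus>\<^bsub>?H\<^esub> s m) < e"
    have "Cauchy (\<lambda>k. projl (s k) e)" if e: "e \<in> I" for e
    proof (rule CauchyI)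
      fix \<epsilon> :: real assume "0 < \<epsilon>"
      then obtain M where M: "\<And>k m. k \<ge> M \<Longrightarrow> m \<ge> M \<Longrightarrow> hnorm ?H (s k \<ominus>\<^bsub>?H\<^esub> s m) < \<epsilon>"
        using cauchy by blast
      show "\<exists>M. \<forall>k\<ge>M. \<forall>m\<ge>M. norm (projl (s k) e - projl (s m) e) < \<epsilon>"
      proof (intro exI[of _ M] allI impI)
        fix k m assume "M \<le> k" "M \<le> m"
        have "norm (projl (s k) e - projl (s m) e) \<le> hnorm ?H (s k \<ominus>\<^bsub>?H\<^esub> s m)"
          unfolding minus[OF s s] hnorm_fin_space
          using member_le_L2_set[OF I e, of "\<lambda>e. cmod (projl (s k) e - projl (s m) e)"] by simp
        also have "\<dots> < \<epsilon>" using \<open>M \<le> k\<close> \<open>M \<le> m\<close> by (rule M)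
        finally show "norm (projl (s k) e - projl (s m) e) < \<epsilon>" .
      qed
    qed
    then have "\<forall>e\<in>I. \<exists>l. (\<lambda>k. projl (s k) e) \<longlonglongrightarrow> l"
      by (simp add: Cauchy_convergent_iff convergent_def)
    then obtain g where g: "\<forall>e\<in>I. (\<lambda>k. projl (s k) e) \<longlonglongrightarrow> g e"
      by (rule bchoice[THEN exE])
    define x :: "(nat \<Rightarrow> complex) + 'u" where "x = Inl (\<lambda>e. if e \<in> I then g e else 0)"
    have x: "x \<in> carrier ?H" by (auto simp: x_def)
    have "hnorm ?H (s k \<ominus>\<^bsub>?H\<^esub> x) = L2_set (\<lambda>e. cmod (projl (s k) e - g e)) I" for k
      unfolding minus[OF s x] hnorm_fin_space by (rule L2_set_cong) (auto simp: x_def)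
    moreover have "(\<lambda>k. L2_set (\<lambda>e. cmod (projl (s k) e - g e)) I) \<longlonglongrightarrow> sqrt (\<Sum>e\<in>I. (cmod (g e - g e))\<^sup>2)"
      unfolding L2_set_def using g by (intro tendsto_intros) auto
    ultimately show "\<exists>x\<in>carrier ?H. (\<lambda>k. hnorm ?H (s k \<ominus>\<^bsub>?H\<^esub> x)) \<longlonglongrightarrow> 0"
      using x by (intro bexI[of _ x]) simp_all
  qed (fact ip_add_left ip_smult_left ip_commute ip_pos)+
  then show ?thesis
    using vectorspace_axioms by (simp add: hilbert_space_def)
qed

text \<open>\<open>block_space n\<close> is \<open>(\<complex>\<^sup>n)\<^sup>d\<close>; \<open>block i x\<close> is the \<open>i\<close>-th component of \<open>x\<close>.\<close>

definition block_index :: "'d::finite itself \<Rightarrow> nat \<Rightarrow> nat set" where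
  "block_index D n = to_nat ` ((UNIV :: 'd set) \<times> {..<n})"

definition block :: "nat \<Rightarrow> 'd::finite \<Rightarrow> (nat \<Rightarrow> complex) + 'u \<Rightarrow> complex Matrix.vec" where
  "block n i x = Matrix.vec n (\<lambda>k. projl x (to_nat (i, k)))"

definition of_blocks :: "nat \<Rightarrow> ('d::finite \<Rightarrow> complex Matrix.vec) \<Rightarrow> (nat \<Rightarrow> complex) + 'u" where
  "of_blocks n g = Inl (\<lambda>e. if e \<in> block_index TYPE('d) n
     then g (fst (from_nat e :: 'd \<times> nat)) $v snd (from_nat e :: 'd \<times> nat) else 0)"

abbreviation block_space :: "'d::finite itself \<Rightarrow> nat \<Rightarrow> ((nat \<Rightarrow> complex) + 'u) hilbert" where
  "block_space D n \<equiv> fin_space (block_index D n)"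

lemma finite_block_index: "finite (block_index D n)"
  by (simp add: block_index_def)

lemma block_closed [simp]: "block n i x \<in> carrier_vec n" "dim_vec (block n i x) = n"
  by (simp_all add: block_def)

lemma of_blocks_closed: "(of_blocks n (g :: 'd::finite \<Rightarrow> _) :: (nat \<Rightarrow> complex) + 'u) \<in> carrier (block_space TYPE('d) n)"
  by (auto simp: of_blocks_def)

lemma block_of_blocks: "g i \<in> carrier_vec n \<Longrightarrow> block n i (of_blocks n g :: (nat \<Rightarrow> complex) + 'u) = g i"
  by (intro eq_vecI) (auto simp: block_def of_blocks_def block_index_def)

lemma block_eqI:
  fixes x y :: "(nat \<Rightarrow> complex) + 'u"
  assumes "x \<in> carrier (block_space TYPE('d::finite) n)" "y \<in> carrier (block_space TYPE('d) n)"
    and eq: "\<And>i :: 'd. block n i x = block n i y"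
  shows "x = y"
proof -
  obtain f g where fg: "x = Inl f" "y = Inl g" "\<And>e. e \<notin> block_index TYPE('d) n \<Longrightarrow> f e = 0"
    "\<And>e. e \<notin> block_index TYPE('d) n \<Longrightarrow> g e = 0"
    using assms(1,2) by auto
  have "f e = g e" for e
  proof (cases "e \<in> block_index TYPE('d) n")
    case True
    then obtain i :: 'd and k where e: "e = to_nat (i, k)" "k < n" by (auto simp: block_index_def)
    have "block n i x $v k = block n i y $v k" by (simp add: eq)
    then show ?thesis using e fg by (simp add: block_def)
  qed (simp add: fg)
  then show ?thesis using fg by (simp add: fun_eq_iff)
qed

lemma block_linear:
  "block n i (x \<oplus>\<^bsub>fin_space I\<^esub> y) = block n i x + block n i y"
  "block n i (c \<odot>\<^bsub>fin_space I\<^esub> x) = c \<cdot>\<^sub>v block n i x"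
  by (auto simp: block_def intro!: eq_vecI)

lemma ip_block_space:
  "ip (block_space TYPE('d::finite) n) x y = (\<Sum>i\<in>(UNIV :: 'd set). block n i x \<bullet>c block n i y)"
proof -
  have "ip (block_space TYPE('d) n) x y =
      (\<Sum>(i, k)\<in>(UNIV :: 'd set) \<times> {..<n}. projl x (to_nat (i, k)) * cnj (projl y (to_nat (i, k))))"
    unfolding fin_space_simps block_index_def
    by (subst sum.reindex) (auto simp: inj_on_def intro!: sum.cong)
  then show ?thesis
    by (simp add: sum.cartesian_product ip_Cn block_def case_prod_unfold)
qed

section \<open>The cross-polytope is a dilation hull\<close>

text \<open>For a unit eigenvector \<open>w\<close>, the eigenvalue is \<open>c\<close> times the
  value at \<open>X i\<close> of the vector state of \<open>w\<close>; the values of this state at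
  the whole tuple form a point of the Euclidean unit ball.\<close>

lemma Wmax_lp_ball_2_eigenvalue:
  fixes X :: "'d::finite \<Rightarrow> complex mat"
  assumes X: "X \<in> Wmax (lp_ball 2) n" and c: "0 \<le> c"
    and ev: "eigenvalue (complex_of_real c \<cdot>\<^sub>m X i) b"
  obtains t where "b = complex_of_real t" "\<bar>t\<bar> \<le> c"
proof -
  interpret inner_space "Cn n" by (rule Cn_inner_space)
  have Xc: "X j \<in> carrier_mat n n" for j using X by (simp add: Wmax_def sa_tuples_def)
  obtain u where u: "u \<in> carrier_vec n" "u \<noteq> 0\<^sub>v n" "(complex_of_real c \<cdot>\<^sub>m X i) *\<^sub>v u = b \<cdot>\<^sub>v u"
    using ev Xc[of i] unfolding eigenvalue_def eigenvector_def by auto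
  obtain w a where w: "w \<in> carrier (Cn n)" "hnorm (Cn n) w = 1" and wa: "w = a \<odot>\<^bsub>Cn n\<^esub> u"
    using normalize_approx[of u] u by (metis Cn_simps(1,3))
  have wc: "w \<in> carrier_vec n" using w by simp
  have Xw: "X i *\<^sub>v w \<in> carrier_vec n" using mult_mat_vec_carrier[OF Xc wc] .
  have "(complex_of_real c \<cdot>\<^sub>m X i) *\<^sub>v w = a \<cdot>\<^sub>v (b \<cdot>\<^sub>v u)"
    using u Xc[of i] by (simp add: wa mult_mat_vec[of _ n n])
  also have "\<dots> = b \<cdot>\<^sub>v w" using u by (simp add: wa smult_smult_assoc mult.commute)
  finally have eq: "(complex_of_real c \<cdot>\<^sub>m X i) *\<^sub>v w = b \<cdot>\<^sub>v w" .
  have "(complex_of_real c \<cdot>\<^sub>m X i) *\<^sub>v w = complex_of_real c \<cdot>\<^sub>v (X i *\<^sub>v w)"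
    using Xc[of i] wc by (intro eq_vecI) (auto simp: scalar_prod_def sum_distrib_left mult.assoc)
  then have "b * (w \<bullet>c w) = complex_of_real c * ((X i *\<^sub>v w) \<bullet>c w)"
    using eq wc Xw by (metis carrier_vec_conjugate smult_scalar_prod_distrib)
  moreover have "w \<bullet>c w = 1" using ip_self[OF w(1)] w(2) by simp
  ultimately have b: "b = complex_of_real c * ip (Cn n) (mat_op n (X i) w) w"
    using wc by (simp add: mat_op_def)
  have "(\<chi> j. ip (Cn n) (mat_op n (X j) w) w) \<in> W1 (Cn n) (\<lambda>j. mat_op n (X j))"
    using mat_op_bounded[OF Xc] w by (intro vector_state_W1)
  then have "(\<chi> j. ip (Cn n) (mat_op n (X j) w) w) \<in> complexify ` lp_ball 2"
    using X unfolding Wmax_def by blast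
  then obtain p where p: "p \<in> lp_ball 2" "(\<chi> j. ip (Cn n) (mat_op n (X j) w) w) = complexify p" by blast
  have "ip (Cn n) (mat_op n (X i) w) w = complex_of_real (p $ i)"
    using arg_cong[OF p(2), of "\<lambda>q. q $ i"] by (simp add: complexify_def)
  then have "b = complex_of_real (c * p $ i)" by (simp add: b)
  moreover have "\<bar>p $ i\<bar> \<le> 1"
  proof -
    have "(p $ i)\<^sup>2 \<le> (\<Sum>j\<in>UNIV. (p $ j)\<^sup>2)" by (rule member_le_sum) auto
    also have "\<dots> \<le> 1" using p(1) by (simp add: lp_ball_2)
    finally show ?thesis by (simp add: abs_square_le_1)
  qed
  then have "\<bar>c * p $ i\<bar> \<le> c" using c by (simp add: abs_mult mult_left_le)
  ultimately show ?thesis using that by blast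
qed

lemma Wmax_subset_Wmin:
  fixes X :: "'d::finite \<Rightarrow> complex mat"
  assumes X: "X \<in> Wmax (lp_ball 2) n"
  shows "X \<in> Wmin TYPE('u) {y. (\<Sum>i\<in>UNIV. \<bar>y $ i\<bar>) \<le> real CARD('d)} n"
proof -
  define K :: "((nat \<Rightarrow> complex) + 'u) hilbert" where "K = block_space TYPE('d) n"
  define d where "d = real CARD('d)"
  have d: "0 < d" by (simp add: d_def)
  have sa: "X \<in> sa_tuples n" using X by (simp add: Wmax_def)
  have Xc [simp]: "X i \<in> carrier_mat n n" and Xa: "mat_adjoint (X i) = X i" for i
    using sa by (simp_all add: sa_tuples_def)
  have dims [simp]: "dim_row (X i) = n" "dim_col (X i) = n" for i using carrier_matD[OF Xc] by auto
  have herm: "cnj (X i $$ (k, l)) = X i $$ (l, k)" if "k < n" "l < n" for i k l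
    using mat_adjoint_index[of l "X i" k] that by (simp add: Xa)
  \<comment> \<open>Compression along the diagonal embedding takes the mean over the
    \<open>d\<close> blocks, and \<open>N i\<close> acts on one of them only; the factor
    \<open>d\<close> makes up for that.\<close>
  define M where "M i = complex_of_real d \<cdot>\<^sub>m X i" for i
  have Mc [simp]: "M i \<in> carrier_mat n n" for i by (simp add: M_def)
  have M_closed [simp]: "M i *\<^sub>v u \<in> carrier_vec n" if "u \<in> carrier_vec n" for i u
    using mult_mat_vec_carrier[OF Mc that] .
  have M_adj: "(M i *\<^sub>v u) \<bullet>c w = u \<bullet>c (M i *\<^sub>v w)" if "u \<in> carrier_vec n" "w \<in> carrier_vec n" for i u w
  proof -
    have "is_adjoint (Cn n) (Cn n) (mat_op n (M i)) (mat_op n (M i))"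
      by (rule mat_op_adjoint) (auto simp: M_def herm)
    then show ?thesis using that unfolding is_adjoint_def by (simp add: mat_op_def)
  qed
  interpret C: inner_space "Cn n" by (rule Cn_inner_space)
  have hK: "hilbert_space K" unfolding K_def by (rule fin_space_hilbert_space[OF finite_block_index])
  interpret K: inner_space K by (rule hilbert_space_inner_space[OF hK])
  have eqI: "x = y" if "x \<in> carrier K" "y \<in> carrier K" "\<And>i :: 'd. block n i x = block n i y" for x y
    using that unfolding K_def by (rule block_eqI)
  have mk_closed [simp]: "of_blocks n (g :: 'd \<Rightarrow> _) \<in> carrier K" for g
    unfolding K_def by (rule of_blocks_closed)
  have block_lin [simp]: "block n i (x \<oplus>\<^bsub>K\<^esub> y) = block n i x + block n i y"
    "block n i (c \<odot>\<^bsub>K\<^esub> x) = c \<cdot>\<^sub>v block n i x" for i :: 'd and x y c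
    unfolding K_def by (rule block_linear)+
  have ipK: "ip K x y = (\<Sum>i\<in>(UNIV :: 'd set). block n i x \<bullet>c block n i y)" for x y
    unfolding K_def by (rule ip_block_space)
  have normK: "(hnorm K x)\<^sup>2 = (\<Sum>i\<in>(UNIV :: 'd set). (hnorm (Cn n) (block n i x))\<^sup>2)" if "x \<in> carrier K" for x
    using that by (simp add: K.hnorm_sq C.hnorm_sq ipK)
  have block_le: "hnorm (Cn n) (block n i x) \<le> hnorm K x" if x: "x \<in> carrier K" for i :: 'd and x
  proof (rule power2_le_imp_le)
    show "(hnorm (Cn n) (block n i x))\<^sup>2 \<le> (hnorm K x)\<^sup>2"
      unfolding normK[OF x] by (rule member_le_sum) auto
  qed (use x in auto)
  define N where "N i = (\<lambda>x\<in>carrier K. of_blocks n (\<lambda>j. if j = i then M i *\<^sub>v block n i x else 0\<^sub>v n) :: (nat \<Rightarrow> complex) + 'u)" for i :: 'd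
  have N_closed [simp]: "N i x \<in> carrier K" if "x \<in> carrier K" for i x using that by (simp add: N_def)
  have block_N: "block n j (N i x) = (if j = i then M i *\<^sub>v block n i x else 0\<^sub>v n)" if "x \<in> carrier K" for i j :: 'd and x
    using that by (simp add: N_def block_of_blocks)
  have N_bounded: "N i \<in> bounded_ops K K" for i
  proof -
    obtain B where B: "\<And>u. u \<in> carrier (Cn n) \<Longrightarrow> hnorm (Cn n) (mat_op n (M i) u) \<le> B * hnorm (Cn n) u" "1 \<le> B"
      using C.bounded_ops_bound[OF mat_op_bounded[OF Mc]] by blast
    show ?thesis
    proof (rule bounded_opsI[where C = B])
      fix x assume x: "x \<in> carrier K"
      have "(hnorm K (N i x))\<^sup>2 = (\<Sum>j\<in>UNIV. if j = i then (hnorm (Cn n) (M i *\<^sub>v block n i x))\<^sup>2 else 0)"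
        unfolding normK[OF N_closed[OF x]] using C.hnorm_zero by (intro sum.cong refl) (simp add: block_N[OF x])
      also have "\<dots> = (hnorm (Cn n) (mat_op n (M i) (block n i x)))\<^sup>2" by (simp add: mat_op_def)
      finally have "hnorm K (N i x) = hnorm (Cn n) (mat_op n (M i) (block n i x))"
        using x by (simp add: power2_eq_iff_nonneg mat_op_closed)
      also have "\<dots> \<le> B * hnorm (Cn n) (block n i x)" by (rule B(1)) simp
      also have "\<dots> \<le> B * hnorm K x" using B(2) block_le[OF x] by (intro mult_left_mono) auto
      finally show "hnorm K (N i x) \<le> B * hnorm K x" .
    next
      fix x y assume "x \<in> carrier K" "y \<in> carrier K"
      then show "N i (x \<oplus>\<^bsub>K\<^esub> y) = N i x \<oplus>\<^bsub>K\<^esub> N i y"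
        by (intro eqI) (auto simp: block_N mult_add_distrib_mat_vec[of _ n n])
    next
      fix c x assume "x \<in> carrier K"
      then show "N i (c \<odot>\<^bsub>K\<^esub> x) = c \<odot>\<^bsub>K\<^esub> N i x"
        by (intro eqI) (auto simp: block_N mult_mat_vec[of _ n n])
    qed (simp_all add: N_def)
  qed
  have N_adj: "is_adjoint K K (N i) (N i)" for i
    unfolding is_adjoint_def
  proof (intro conjI ballI N_bounded)
    fix x y assume x: "x \<in> carrier K" and y: "y \<in> carrier K"
    show "ip K (N i x) y = ip K x (N i y)"
      unfolding ipK using x y by (intro sum.cong refl) (simp add: block_N M_adj)
  qed
  have N_mult: "op_mult K (N i) (N j) = op_scale K 0 (op_one K)" if "i \<noteq> j" for i j
  proof
    fix x show "op_mult K (N i) (N j) x = op_scale K 0 (op_one K) x"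
    proof (cases "x \<in> carrier K")
      case True
      have "M i *\<^sub>v 0\<^sub>v n = 0\<^sub>v n" by (intro eq_vecI) (auto simp: M_def)
      then have "N i (N j x) = 0 \<odot>\<^bsub>K\<^esub> x" using True that by (intro eqI) (auto simp: block_N)
      then show ?thesis using True by (simp add: compose_def op_scale_def op_one_def)
    qed (simp add: compose_def op_scale_def)
  qed
  have N_normal: "normal_tuple K N"
    unfolding normal_tuple_def
  proof (intro conjI allI)
    show "op_mult K (N i) (N j) = op_mult K (N j) (N i)" for i j
      using N_mult[of i j] N_mult[of j i] by (cases "i = j") auto
  qed (use N_bounded N_adj in blast)+
  \<comment> \<open>As products of distinct \<open>N i\<close> vanish, a character is nonzero at one
    of them at most, and it remains to bound that single value by \<open>d\<close>.\<close>
  have spectrum: "joint_spectrum K N \<subseteq> complexify ` {y. (\<Sum>i\<in>UNIV. \<bar>y $ i\<bar>) \<le> d}"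
  proof
    fix z assume "z \<in> joint_spectrum K N"
    then obtain \<phi> where z: "z = (\<chi> i. \<phi> (N i))" and \<phi>: "character K (cstar_generated K N) \<phi>"
      unfolding joint_spectrum_def by blast
    let ?A = "cstar_generated K N"
    have A: "cstar_subalgebra K ?A"
      by (rule cstar_subalgebra_generated[OF K.inner_space_axioms N_bounded])
    note As = cstar_subalgebraD(2-5)[OF A]
    have add: "\<phi> (op_add K S T) = \<phi> S + \<phi> T" if "S \<in> ?A" "T \<in> ?A" for S T
      using \<phi> that unfolding character_def linear_functional_on_def by blast
    have scale: "\<phi> (op_scale K c T) = c * \<phi> T" if "T \<in> ?A" for c T
      using \<phi> that unfolding character_def linear_functional_on_def by blast
    have mult: "\<phi> (op_mult K S T) = \<phi> S * \<phi> T" if "S \<in> ?A" "T \<in> ?A" for S T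
      using \<phi> that unfolding character_def by blast
    have NA: "N i \<in> ?A" for i by (rule cstar_generated_mem)
    have prod0: "\<phi> (N i) * \<phi> (N j) = 0" if "i \<noteq> j" for i j
      using mult[OF NA NA, of i j] scale[OF As(1), of 0] by (simp add: N_mult[OF that])
    have real: "\<exists>t. \<phi> (N i) = complex_of_real t \<and> \<bar>t\<bar> \<le> d" for i
    proof -
      obtain bs where bs: "\<forall>b \<in> set bs. eigenvalue (M i) b"
        "\<forall>x \<in> carrier_vec n. foldr (\<lambda>b y. M i *\<^sub>v y - b \<cdot>\<^sub>v y) bs x = 0\<^sub>v n"
        by (rule annihilating_eigenvalues[OF Mc])
      define f where "f cs x = foldr (\<lambda>b y. M i *\<^sub>v y - b \<cdot>\<^sub>v y) cs x" for cs x
      have f_Cons: "f (b # cs) x = M i *\<^sub>v f cs x - b \<cdot>\<^sub>v f cs x" for b cs x by (simp add: f_def)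
      have f_closed: "f cs x \<in> carrier_vec n" if "x \<in> carrier_vec n" for cs x
        using that by (induction cs) (auto simp: f_def)
      \<comment> \<open>The product of the factors \<open>N i - b\<close> starts from
        \<open>N i\<close> and not from the identity: the factors annihilate block \<open>i\<close>,
        and the extra \<open>N i\<close> kills the other blocks. This adds 0 to the possible values
        of the character.\<close>
      define R where "R cs = foldr (\<lambda>b T. op_add K (op_mult K (N i) T) (op_scale K (- b) T)) cs (N i)" for cs
      have R: "R cs \<in> ?A \<and> \<phi> (R cs) = (\<Prod>b\<leftarrow>cs. \<phi> (N i) - b) * \<phi> (N i)" for cs
        by (induction cs) (simp_all add: R_def NA As add scale mult algebra_simps)
      have R_block: "R cs x \<in> carrier K \<and> block n j (R cs x) = (if j = i then f cs (M i *\<^sub>v block n i x) else 0\<^sub>v n)"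
        if x: "x \<in> carrier K" for cs x and j :: 'd
      proof (induction cs arbitrary: j)
        case Nil
        then show ?case using x by (simp add: R_def f_def block_N)
      next
        case (Cons b cs)
        define y where "y = R cs x"
        have y: "y \<in> carrier K" and block_y: "block n j y = (if j = i then f cs (M i *\<^sub>v block n i x) else 0\<^sub>v n)" for j :: 'd
          using Cons by (auto simp: y_def)
        have eq: "R (b # cs) x = N i y \<oplus>\<^bsub>K\<^esub> (- b) \<odot>\<^bsub>K\<^esub> y"
          using x by (simp add: R_def y_def op_add_def op_scale_def compose_def)
        have fc: "f cs (M i *\<^sub>v block n i x) \<in> carrier_vec n" by (rule f_closed) simp
        have "M i *\<^sub>v f cs (M i *\<^sub>v block n i x) + (- b) \<cdot>\<^sub>v f cs (M i *\<^sub>v block n i x) = f (b # cs) (M i *\<^sub>v block n i x)"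
          using fc M_closed[OF fc, of i] unfolding f_Cons by (intro eq_vecI) auto
        then show ?case
          unfolding eq using y by (auto simp: block_N block_y intro!: eq_vecI)
      qed
      have "R bs = op_scale K 0 (op_one K)"
      proof
        fix x show "R bs x = op_scale K 0 (op_one K) x"
        proof (cases "x \<in> carrier K")
          case True
          have "R bs x = 0 \<odot>\<^bsub>K\<^esub> x"
            using R_block[OF True, of bs] True bs(2) by (intro eqI) (auto simp: f_def)
          then show ?thesis using True by (simp add: op_scale_def op_one_def)
        next
          case False
          have "R bs \<in> extensional (carrier K)"
            using R cstar_subalgebraD(1)[OF A] bounded_ops_extensional by blast
          then show ?thesis using False by (simp add: extensional_def op_scale_def)
        qed
      qed
      then have "(\<Prod>b\<leftarrow>bs. \<phi> (N i) - b) * \<phi> (N i) = 0"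
        using R[of bs] scale[OF As(1), of 0] by simp
      then have "\<phi> (N i) = 0 \<or> \<phi> (N i) \<in> set bs" by (auto simp: prod_list_zero_iff)
      then show ?thesis
      proof
        assume "\<phi> (N i) = 0"
        then show ?thesis using d by (intro exI[of _ 0]) auto
      next
        assume "\<phi> (N i) \<in> set bs"
        then have "eigenvalue (complex_of_real d \<cdot>\<^sub>m X i) (\<phi> (N i))" using bs(1) by (simp add: M_def)
        then obtain t where "\<phi> (N i) = complex_of_real t" "\<bar>t\<bar> \<le> d"
          by (rule Wmax_lp_ball_2_eigenvalue[OF X less_imp_le[OF d]])
        then show ?thesis by blast
      qed
    qed
    then obtain t where t: "\<And>i. \<phi> (N i) = complex_of_real (t i)" "\<And>i. \<bar>t i\<bar> \<le> d" by metis
    have "(\<Sum>i\<in>UNIV. \<bar>t i\<bar>) \<le> d"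
    proof (cases "\<exists>i. t i \<noteq> 0")
      case True
      then obtain i where "t i \<noteq> 0" by blast
      then have "t j = 0" if "j \<noteq> i" for j using prod0[OF that] by (simp add: t(1))
      then have "(\<Sum>j\<in>UNIV. \<bar>t j\<bar>) = (\<Sum>j\<in>UNIV. if j = i then \<bar>t i\<bar> else 0)"
        by (intro sum.cong refl) auto
      then show ?thesis using t(2)[of i] by simp
    next
      case False
      then show ?thesis using d by simp
    qed
    then have "(\<chi> i. t i) \<in> {y. (\<Sum>i\<in>UNIV. \<bar>y $ i\<bar>) \<le> d}" by simp
    moreover have "z = complexify (\<chi> i. t i)" by (simp add: z t(1) complexify_def)
    ultimately show "z \<in> complexify ` {y. (\<Sum>i\<in>UNIV. \<bar>y $ i\<bar>) \<le> d}" by blast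
  qed
  \<comment> \<open>The square of \<open>\<rho>\<close> is \<open>1 / d\<close>, which makes the
    diagonal embedding into \<open>d\<close> blocks isometric.\<close>
  define \<rho> where "\<rho> = complex_of_real (1 / sqrt d)"
  have \<rho>: "cnj \<rho> = \<rho>" "complex_of_real d * (\<rho> * \<rho>) = 1"
    using d by (simp_all add: \<rho>_def flip: of_real_mult)
  define V where "V = (\<lambda>h\<in>carrier_vec n. of_blocks n (\<lambda>_::'d. \<rho> \<cdot>\<^sub>v h) :: (nat \<Rightarrow> complex) + 'u)"
  have V_closed [simp]: "V h \<in> carrier K" if "h \<in> carrier_vec n" for h using that by (simp add: V_def)
  have block_V: "block n i (V h) = \<rho> \<cdot>\<^sub>v h" if "h \<in> carrier_vec n" for h and i :: 'd
    using that by (simp add: V_def block_of_blocks)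
  have V_norm: "hnorm K (V h) = hnorm (Cn n) h" if h: "h \<in> carrier_vec n" for h
  proof -
    have "ip K (V h) (V h) = (complex_of_real d * (\<rho> * \<rho>)) * (h \<bullet>c h)"
      using h by (simp add: ipK block_V \<rho>(1) d_def conjugate_smult_vec algebra_simps)
    then show ?thesis unfolding \<rho>(2) by (simp add: hnorm_def)
  qed
  have V_bounded: "V \<in> bounded_ops (Cn n) K"
  proof (rule bounded_opsI[where C = 1])
    fix x y assume "x \<in> carrier (Cn n)" "y \<in> carrier (Cn n)"
    then show "V (x \<oplus>\<^bsub>Cn n\<^esub> y) = V x \<oplus>\<^bsub>K\<^esub> V y"
      by (intro eqI) (auto simp: block_V smult_add_distrib_vec)
  next
    fix c x assume "x \<in> carrier (Cn n)"
    then show "V (c \<odot>\<^bsub>Cn n\<^esub> x) = c \<odot>\<^bsub>K\<^esub> V x"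
      by (intro eqI) (auto simp: block_V smult_smult_assoc mult.commute)
  qed (auto simp: V_norm, simp add: V_def)
  define W where "W = (\<lambda>x\<in>carrier K. Matrix.vec n (\<lambda>k. \<Sum>i\<in>(UNIV :: 'd set). \<rho> * block n i x $v k))"
  have W_closed [simp]: "W x \<in> carrier_vec n" if "x \<in> carrier K" for x using that by (simp add: W_def)
  have VW: "ip K (V h) x = ip (Cn n) h (W x)" if h: "h \<in> carrier_vec n" and x: "x \<in> carrier K" for h x
  proof -
    have "ip K (V h) x = (\<Sum>i\<in>(UNIV::'d set). \<Sum>k<n. \<rho> * h $v k * cnj (block n i x $v k))"
      unfolding ipK using h by (intro sum.cong refl) (simp add: block_V ip_Cn[OF block_closed(1)] sum_distrib_left mult.assoc)
    also have "\<dots> = (\<Sum>k<n. \<Sum>i\<in>(UNIV::'d set). \<rho> * h $v k * cnj (block n i x $v k))" by (rule sum.swap)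
    also have "\<dots> = ip (Cn n) h (W x)"
      unfolding Cn_simps ip_Cn[OF W_closed[OF x]] using x \<rho>(1)
      by (intro sum.cong refl) (simp add: W_def sum_distrib_left mult_ac)
    finally show ?thesis .
  qed
  have W_bounded: "W \<in> bounded_ops K (Cn n)"
  proof (rule bounded_opsI[where C = 1])
    fix x assume x: "x \<in> carrier K"
    \<comment> \<open>Boundedness of the adjoint comes from the isometry: the squared norm of
      \<open>W x\<close> is the inner product of \<open>V (W x)\<close> with
      \<open>x\<close>.\<close>
    have "(hnorm (Cn n) (W x))\<^sup>2 = Re (ip K (V (W x)) x)"
      using x by (simp add: C.hnorm_sq VW)
    also have "\<dots> \<le> cmod (ip K (V (W x)) x)" by (rule complex_Re_le_cmod)
    also have "\<dots> \<le> hnorm (Cn n) (W x) * hnorm K x"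
      using K.cauchy_schwarz[of "V (W x)" x] x by (simp add: V_norm)
    finally have "hnorm (Cn n) (W x) * hnorm (Cn n) (W x) \<le> hnorm (Cn n) (W x) * hnorm K x"
      by (simp add: power2_eq_square)
    moreover have "0 \<le> hnorm (Cn n) (W x)" using x by (intro C.hnorm_nonneg) simp
    ultimately show "hnorm (Cn n) (W x) \<le> 1 * hnorm K x"
      using x by (cases "hnorm (Cn n) (W x) = 0") (auto dest: mult_left_le_imp_le)
  next
    fix x y assume "x \<in> carrier K" "y \<in> carrier K"
    then show "W (x \<oplus>\<^bsub>K\<^esub> y) = W x \<oplus>\<^bsub>Cn n\<^esub> W y"
      by (intro eq_vecI) (auto simp: W_def algebra_simps sum.distrib)
  next
    fix c x assume x: "x \<in> carrier K"
    then show "W (c \<odot>\<^bsub>K\<^esub> x) = c \<odot>\<^bsub>Cn n\<^esub> W x"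
      by (intro eq_vecI) (auto simp: W_def sum_distrib_left mult_ac)
  qed (auto simp: W_def)
  have VW_adj: "is_adjoint (Cn n) K V W"
    unfolding is_adjoint_def using V_bounded W_bounded VW by simp
  have compression: "mat_op n (X i) = compose (carrier (Cn n)) W (compose (carrier (Cn n)) (N i) V)" for i
  proof
    fix h show "mat_op n (X i) h = compose (carrier (Cn n)) W (compose (carrier (Cn n)) (N i) V) h"
    proof (cases "h \<in> carrier_vec n")
      case True
      have "W (N i (V h)) = X i *\<^sub>v h"
      proof (rule eq_vecI)
        fix k assume "k < dim_vec (X i *\<^sub>v h)"
        then have k: "k < n" by simp
        have "W (N i (V h)) $v k = (\<Sum>j\<in>(UNIV::'d set). \<rho> * block n j (N i (V h)) $v k)"
          using k True by (simp add: W_def)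
        also have "\<dots> = (\<Sum>j\<in>(UNIV::'d set). if j = i then \<rho> * (M i *\<^sub>v (\<rho> \<cdot>\<^sub>v h)) $v k else 0)"
          using k True by (intro sum.cong refl) (simp add: block_N block_V)
        also have "\<dots> = \<rho> * (M i *\<^sub>v (\<rho> \<cdot>\<^sub>v h)) $v k" by simp
        also have "\<dots> = (complex_of_real d * (\<rho> * \<rho>)) * (X i *\<^sub>v h) $v k"
          using k True by (simp add: M_def scalar_prod_def sum_distrib_left mult_ac)
        finally show "W (N i (V h)) $v k = (X i *\<^sub>v h) $v k" unfolding \<rho>(2) by simp
      qed (use True carrier_vecD[OF W_closed[of "N i (V h)"]] in simp)
      then show ?thesis using True by (simp add: mat_op_def compose_def)
    qed (simp add: mat_op_def compose_def)
  qed
  have "isometry_op (Cn n) K V" unfolding isometry_op_def using V_bounded V_norm by simp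
  then have "dilation (Cn n) (\<lambda>i. mat_op n (X i)) K N"
    unfolding dilation_def using VW_adj compression by blast
  then show ?thesis
    unfolding Wmin_def using sa hK N_normal spectrum unfolding d_def by blast
qed

theorem proposition8p3:
  shows "(\<lambda>x. real CARD('d) *\<^sub>R x) ` (lp_ball 1 :: (real ^ 'd::finite) set)
           \<in> minimal_dilation_hulls TYPE('u) (lp_ball 2)"
proof -
  define P where "P = {y :: real ^ 'd. (\<Sum>i\<in>UNIV. \<bar>y $ i\<bar>) \<le> real CARD('d)}"
  have P: "(\<lambda>x. real CARD('d) *\<^sub>R x) ` (lp_ball 1 :: (real ^ 'd) set) = P"
    unfolding P_def by (rule scaled_lp_ball_1) simp
  have ball: "lp_ball 2 \<subseteq> P"
  proof
    fix x :: "real ^ 'd" assume "x \<in> lp_ball 2"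
    then have sq: "(\<Sum>i\<in>UNIV. (x $ i)\<^sup>2) \<le> 1" by (simp add: lp_ball_2)
    have "\<bar>x $ i\<bar> \<le> 1" for i
    proof -
      have "(x $ i)\<^sup>2 \<le> (\<Sum>i\<in>UNIV. (x $ i)\<^sup>2)" by (rule member_le_sum) auto
      then have "(x $ i)\<^sup>2 \<le> 1" using sq by linarith
      then show ?thesis by (simp add: abs_square_le_1)
    qed
    then have "(\<Sum>i\<in>UNIV. \<bar>x $ i\<bar>) \<le> (\<Sum>i\<in>(UNIV :: 'd set). 1)" by (intro sum_mono) auto
    then show "x \<in> P" by (simp add: P_def)
  qed
  have "closed P"
    unfolding P_def by (intro closed_Collect_le continuous_intros)
  moreover have "bounded P"
  proof (rule boundedI)
    fix x assume "x \<in> P"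
    then show "norm x \<le> real CARD('d)" using norm_le_l1_cart[of x] by (simp add: P_def)
  qed
  ultimately have compact: "compact P" by (simp add: compact_eq_bounded_closed)
  have convex: "convex P"
  proof (rule convexI)
    fix x y :: "real ^ 'd" and u v :: real
    assume xy: "x \<in> P" "y \<in> P" and uv: "0 \<le> u" "0 \<le> v" "u + v = 1"
    have "(\<Sum>i\<in>UNIV. \<bar>(u *\<^sub>R x + v *\<^sub>R y) $ i\<bar>) \<le> (\<Sum>i\<in>UNIV. u * \<bar>x $ i\<bar> + v * \<bar>y $ i\<bar>)"
    proof (rule sum_mono)
      fix i
      show "\<bar>(u *\<^sub>R x + v *\<^sub>R y) $ i\<bar> \<le> u * \<bar>x $ i\<bar> + v * \<bar>y $ i\<bar>"
        using abs_triangle_ineq[of "u * x $ i" "v * y $ i"] uv by (simp add: abs_mult)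
    qed
    also have "\<dots> = u * (\<Sum>i\<in>UNIV. \<bar>x $ i\<bar>) + v * (\<Sum>i\<in>UNIV. \<bar>y $ i\<bar>)"
      by (simp add: sum.distrib sum_distrib_left)
    also have "\<dots> \<le> u * real CARD('d) + v * real CARD('d)"
      using xy uv by (intro add_mono mult_left_mono) (auto simp: P_def)
    also have "\<dots> = real CARD('d)" using uv by (simp flip: distrib_right)
    finally show "u *\<^sub>R x + v *\<^sub>R y \<in> P" by (simp add: P_def)
  qed
  have "P \<in> dilation_hulls TYPE('u) (lp_ball 2)"
    unfolding dilation_hulls_def using ball compact convex Wmax_subset_Wmin unfolding P_def by blast
  moreover have "L = P" if L: "L \<in> dilation_hulls TYPE('u) (lp_ball 2)" and sub: "L \<subseteq> P" for L
  proof
    have "axis i (\<sigma> * real CARD('d)) \<in> L" if "\<sigma> \<in> {1, -1}" for i \<sigma>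
      using L sub that unfolding P_def by (rule dilation_hull_extreme_point)
    \<comment> \<open>A hull contains the ball and hence 0, the one point that
      \<open>cross_polytope_subset\<close> asks for besides the vertices.\<close>
    moreover have "(0 :: real ^ 'd) \<in> lp_ball 2" by (simp add: lp_ball_2)
    then have "0 \<in> L" "convex L" using L unfolding dilation_hulls_def by auto
    ultimately show "P \<subseteq> L" unfolding P_def by (intro cross_polytope_subset) auto
  qed (rule sub)
  ultimately show ?thesis
    unfolding P minimal_dilation_hulls_def by blast
qed

end
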